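(* Define $\Lambda:\mathcal H_{\mathbf T}\to\mathbf{WQSym}$ on a topology $\mathcal T$ on $[n]$ by $\Lambda(\mathcal T)=\sum_{f\in\mathcal L_{\mathcal T}(Z)}f(1)\cdots f(n)$, where $Z$ is an infinite totally ordered alphabet of noncommuting variables and $\mathbf{WQSym}(Z)$ is identified with $\mathbf{WQSym}$; equivalently $\Lambda(\mathcal T)=\sum_w M_w$ over all packed words $w=w_1\cdots w_n$ such that $i<_{\mathcal T}j\Rightarrow w_i<w_j$ and $i\sim_{\mathcal T}j\Rightarrow w_i=w_j$. Then $\Lambda$ is a Hopf algebra morphism from $(\mathcal H_{\mathbf T},\cdot,\Delta)$ to $(\mathbf{WQSym},\cdot,\Delta)$, and it is compatible with the internal coproducts: $(\Lambda\otimes\Lambda)\circ\Gamma=\rho\circ\Lambda$.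
   Context: For a topology $\mathcal T$ on a finite set $X$: $x\le_{\mathcal T}y$ iff every open set containing $x$ contains $y$ (open sets = final segments); $x\sim_{\mathcal T}y$ iff $x\le_{\mathcal T}y\le_{\mathcal T}x$; $x<_{\mathcal T}y$ iff $x\le_{\mathcal T}y$ and not $y\le_{\mathcal T}x$; $\mathcal T|_Y=\{W\cap Y:W\in\mathcal T\}$; $Y$ is $\mathcal T$-connected if $(Y,\mathcal T|_Y)$ is connected. $\mathcal L_{\mathcal T}(Z)$ is the set of maps $f:[n]\to Z$ with $i<_{\mathcal T}j\Rightarrow f(i)<f(j)$ and $i\sim_{\mathcal T}j\Rightarrow f(i)=f(j)$. $\mathcal H_{\mathbf T}$ is the graded vector space with basis all topologies on $[n]=\{1,\dots,n\}$, $n\ge0$. Product: for $\mathcal T$ on $[n]$, $\mathcal T'$ on $[n']$, $\mathcal T\cdot\mathcal T'$ is the topology on $[n+n']$ whose open sets are $Y\sqcup(Y'+n)$, $Y\in\mathcal T$, $Y'\in\mathcal T'$. For a totally ordered finite set $E$ with $|E|=m$, $\mathrm{Std}$ transports structures along the increasing bijection $E\to[m]$. Coproduct: $\Delta(\mathcal T)=\sum_{Y\in\mathcal T}\mathrm{Std}(\mathcal T|_{[n]\setminus Y})\otimes\mathrm{Std}(\mathcal T|_Y)$. Internal coproduct on each homogeneous component: $\Gamma(\mathcal T)=\sum\mathcal T'\otimes\mathcal T/\mathcal T'$ over $\mathcal T$-admissible topologies $\mathcal T'$ on $[n]$, where $\mathcal T'\prec\mathcal T$ means every $\mathcal T$-open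 set is $\mathcal T'$-open, $\mathcal T/\mathcal T'$ is the topology on $[n]$ with quasi-order the transitive closure of $x\,\mathcal R\,y\iff(x\le_{\mathcal T}y\text{ or }y\le_{\mathcal T'}x)$, and $\mathcal T'$ is $\mathcal T$-admissible if $\mathcal T'\prec\mathcal T$, $\mathcal T'|_Y=\mathcal T|_Y$ for every $\mathcal T'$-connected $Y$, and $x\sim_{\mathcal T/\mathcal T'}y\iff x\sim_{\mathcal T'/\mathcal T'}y$. $\mathbf{WQSym}$: a packed word is a surjection $w:[k]\to[\max w]$, written $w_1\cdots w_k$; basis $M_w$, realized as $M_w(Z)=\sum X_1\cdots X_k$ over words in $Z$ whose packing (replace letters by their rank among the letters occurring) is $w$. For $i_1,\dots,i_p\ge0$, $\mathrm{QSh}(i_1,\dots,i_p)$ is the set of surjections $u:[i_1+\dots+i_p]\to[\max u]$ strictly increasing on each consecutive block of sizes $i_1,\dots,i_p$. Product: $M_uM_v=\sum_{w\in\mathrm{QSh}(\max u,\max v)}M_{w\circ(u\,v[\max u])}$, where $v[m]$ adds $m$ to each letter of $v$ and $u\,v[m]$ is concatenation. Coproduct: $\Delta(M_w)=\sum_{k=0}^{\max w}M_{w|_{\{1,\dots,k\}}}\otimes M_{\mathrm{Pack}(w|_{\{k+1,\dots,\max w\}})}$, where $w|_I$ keeps the letters of $w$ in $I$. Internal coproduct: $\rho(M_u)=\sum_{i_1+\dots+i_p=\max u}\sum_{v\in\mathrm{QSh}(i_1,\dots,i_p)}M_{v\circ u}\otimes M_{(1^{i_1}2^{i_2}\cdots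 p^{i_p})\circ u}$, where $1^{i_1}\cdots p^{i_p}$ is the word with $i_1$ letters $1$, then $i_2$ letters $2$, etc., viewed as a map $[\max u]\to[p]$. *)

theory Defs
  imports "HOL-Analysis.Abstract_Topology" "HOL-Library.Poly_Mapping" "HOL-Library.FuncSet"
begin

section \<open>Vector spaces with a distinguished basis\<close>

text \<open>
  The vector space over \<^typ>\<open>'k\<close> with basis \<^typ>\<open>'b\<close> is \<^typ>\<open>'b \<Rightarrow>\<^sub>0 'k\<close>; the tensor product
  of the spaces with bases \<^typ>\<open>'a\<close> and \<^typ>\<open>'b\<close> is the space with basis \<^typ>\<open>'a \<times> 'b\<close>,
  the pair \<open>(a, b)\<close> standing for the tensor of the two basis vectors.
\<close>

definition bas :: "'b \<Rightarrow> 'b \<Rightarrow>\<^sub>0 'k::field" where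
  "bas b = Poly_Mapping.single b 1"

definition scale :: "'k::field \<Rightarrow> ('b \<Rightarrow>\<^sub>0 'k) \<Rightarrow> 'b \<Rightarrow>\<^sub>0 'k" where
  "scale c x = Poly_Mapping.map ((*) c) x"

definition lin_ext :: "('a \<Rightarrow> 'b \<Rightarrow>\<^sub>0 'k::field) \<Rightarrow> ('a \<Rightarrow>\<^sub>0 'k) \<Rightarrow> 'b \<Rightarrow>\<^sub>0 'k" where
  "lin_ext f x = (\<Sum>a\<in>Poly_Mapping.keys x. scale (Poly_Mapping.lookup x a) (f a))"

definition bilin_ext ::
    "('a \<Rightarrow> 'b \<Rightarrow> 'c \<Rightarrow>\<^sub>0 'k::field) \<Rightarrow> ('a \<Rightarrow>\<^sub>0 'k) \<Rightarrow> ('b \<Rightarrow>\<^sub>0 'k) \<Rightarrow> 'c \<Rightarrow>\<^sub>0 'k" where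
  "bilin_ext f x y = (\<Sum>a\<in>Poly_Mapping.keys x. \<Sum>b\<in>Poly_Mapping.keys y.
     scale (Poly_Mapping.lookup x a * Poly_Mapping.lookup y b) (f a b))"

definition tensor ::
    "('a \<Rightarrow>\<^sub>0 'k::field) \<Rightarrow> ('b \<Rightarrow>\<^sub>0 'k) \<Rightarrow> ('a \<times> 'b) \<Rightarrow>\<^sub>0 'k" where
  "tensor = bilin_ext (\<lambda>a b. bas (a, b))"

definition tensor_map ::
    "(('a \<Rightarrow>\<^sub>0 'k::field) \<Rightarrow> 'c \<Rightarrow>\<^sub>0 'k) \<Rightarrow> (('b \<Rightarrow>\<^sub>0 'k) \<Rightarrow> 'd \<Rightarrow>\<^sub>0 'k)
      \<Rightarrow> (('a \<times> 'b) \<Rightarrow>\<^sub>0 'k) \<Rightarrow> ('c \<times> 'd) \<Rightarrow>\<^sub>0 'k" where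
  "tensor_map f g = lin_ext (\<lambda>(a, b). tensor (f (bas a)) (g (bas b)))"

definition tensor_assoc :: "((('a \<times> 'b) \<times> 'c) \<Rightarrow>\<^sub>0 'k::field) \<Rightarrow> ('a \<times> 'b \<times> 'c) \<Rightarrow>\<^sub>0 'k" where
  "tensor_assoc = lin_ext (\<lambda>((a, b), c). bas (a, b, c))"

section \<open>Hopf algebras\<close>

record (overloaded) ('b, 'k::zero) hopf_data =
  mul :: "('b \<Rightarrow>\<^sub>0 'k) \<Rightarrow> ('b \<Rightarrow>\<^sub>0 'k) \<Rightarrow> 'b \<Rightarrow>\<^sub>0 'k"
  unit :: "'b \<Rightarrow>\<^sub>0 'k"
  comul :: "('b \<Rightarrow>\<^sub>0 'k) \<Rightarrow> ('b \<times> 'b) \<Rightarrow>\<^sub>0 'k"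
  counit :: "('b \<Rightarrow>\<^sub>0 'k) \<Rightarrow> 'k"

definition mul_tensor :: "('b, 'k::field) hopf_data \<Rightarrow> (('b \<times> 'b) \<Rightarrow>\<^sub>0 'k) \<Rightarrow> 'b \<Rightarrow>\<^sub>0 'k" where
  "mul_tensor A = lin_ext (\<lambda>(a, b). mul A (bas a) (bas b))"

definition tensor_square_mul ::
    "('b, 'k::field) hopf_data \<Rightarrow> (('b \<times> 'b) \<Rightarrow>\<^sub>0 'k) \<Rightarrow> (('b \<times> 'b) \<Rightarrow>\<^sub>0 'k) \<Rightarrow> ('b \<times> 'b) \<Rightarrow>\<^sub>0 'k" where
  "tensor_square_mul A = bilin_ext (\<lambda>(a, b) (c, d).
     tensor (mul A (bas a) (bas c)) (mul A (bas b) (bas d)))"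

definition is_algebra :: "('b, 'k::field) hopf_data \<Rightarrow> bool" where
  "is_algebra A \<longleftrightarrow>
     (\<forall>y. Vector_Spaces.linear scale scale (\<lambda>x. mul A x y)) \<and>
     (\<forall>x. Vector_Spaces.linear scale scale (mul A x)) \<and>
     (\<forall>x y z. mul A (mul A x y) z = mul A x (mul A y z)) \<and>
     (\<forall>x. mul A (unit A) x = x \<and> mul A x (unit A) = x)"

definition is_coalgebra :: "('b, 'k::field) hopf_data \<Rightarrow> bool" where
  "is_coalgebra A \<longleftrightarrow>
     Vector_Spaces.linear scale scale (comul A) \<and>
     Vector_Spaces.linear scale (*) (counit A) \<and>
     (\<forall>x. tensor_assoc (tensor_map (comul A) id (comul A x)) = tensor_map id (comul A) (comul A x)) \<and>
     (\<forall>x. lin_ext (\<lambda>(a, b). scale (counit A (bas a)) (bas b)) (comul A x) = x) \<and>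
     (\<forall>x. lin_ext (\<lambda>(a, b). scale (counit A (bas b)) (bas a)) (comul A x) = x)"

definition is_bialgebra :: "('b, 'k::field) hopf_data \<Rightarrow> bool" where
  "is_bialgebra A \<longleftrightarrow> is_algebra A \<and> is_coalgebra A \<and>
     (\<forall>x y. comul A (mul A x y) = tensor_square_mul A (comul A x) (comul A y)) \<and>
     comul A (unit A) = tensor (unit A) (unit A) \<and>
     (\<forall>x y. counit A (mul A x y) = counit A x * counit A y) \<and>
     counit A (unit A) = 1"

definition is_antipode ::
    "('b, 'k::field) hopf_data \<Rightarrow> (('b \<Rightarrow>\<^sub>0 'k) \<Rightarrow> 'b \<Rightarrow>\<^sub>0 'k) \<Rightarrow> bool" where
  "is_antipode A S \<longleftrightarrow> Vector_Spaces.linear scale scale S \<and>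
     (\<forall>x. mul_tensor A (tensor_map S id (comul A x)) = scale (counit A x) (unit A)) \<and>
     (\<forall>x. mul_tensor A (tensor_map id S (comul A x)) = scale (counit A x) (unit A))"

definition is_hopf_algebra :: "('b, 'k::field) hopf_data \<Rightarrow> bool" where
  "is_hopf_algebra A \<longleftrightarrow> is_bialgebra A \<and> (\<exists>S. is_antipode A S)"

definition is_hopf_morphism ::
    "('a, 'k::field) hopf_data \<Rightarrow> ('b, 'k) hopf_data \<Rightarrow> (('a \<Rightarrow>\<^sub>0 'k) \<Rightarrow> 'b \<Rightarrow>\<^sub>0 'k) \<Rightarrow> bool" where
  "is_hopf_morphism A B f \<longleftrightarrow> is_hopf_algebra A \<and> is_hopf_algebra B \<and>
     Vector_Spaces.linear scale scale f \<and>
     (\<forall>x y. f (mul A x y) = mul B (f x) (f y)) \<and>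
     f (unit A) = unit B \<and>
     (\<forall>x. comul B (f x) = tensor_map f f (comul A x)) \<and>
     (\<forall>x. counit B (f x) = counit A x) \<and>
     (\<forall>S S'. is_antipode A S \<longrightarrow> is_antipode B S' \<longrightarrow> (\<forall>x. f (S x) = S' (f x)))"

section \<open>Topologies on initial segments of the positive integers\<close>

definition top_le :: "'a topology \<Rightarrow> 'a \<Rightarrow> 'a \<Rightarrow> bool" where
  "top_le T x y \<longleftrightarrow> x \<in> topspace T \<and> y \<in> topspace T \<and> (\<forall>U. openin T U \<longrightarrow> x \<in> U \<longrightarrow> y \<in> U)"

definition top_eqv :: "'a topology \<Rightarrow> 'a \<Rightarrow> 'a \<Rightarrow> bool" where
  "top_eqv T x y \<longleftrightarrow> top_le T x y \<and> top_le T y x"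

definition top_less :: "'a topology \<Rightarrow> 'a \<Rightarrow> 'a \<Rightarrow> bool" where
  "top_less T x y \<longleftrightarrow> top_le T x y \<and> \<not> top_le T y x"

definition top_of_order :: "'a set \<Rightarrow> ('a \<Rightarrow> 'a \<Rightarrow> bool) \<Rightarrow> 'a topology" where
  "top_of_order X R = topology (\<lambda>U. U \<subseteq> X \<and> (\<forall>x\<in>U. \<forall>y\<in>X. R x y \<longrightarrow> y \<in> U))"

lemma openin_top_of_order:
  "openin (top_of_order X R) U \<longleftrightarrow> U \<subseteq> X \<and> (\<forall>x\<in>U. \<forall>y\<in>X. R x y \<longrightarrow> y \<in> U)"
proof -
  have "istopology (\<lambda>U. U \<subseteq> X \<and> (\<forall>x\<in>U. \<forall>y\<in>X. R x y \<longrightarrow> y \<in> U))"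
    unfolding istopology_def by blast
  then show ?thesis
    by (simp add: top_of_order_def)
qed

lemma topspace_top_of_order: "topspace (top_of_order X R) = X"
  by (auto simp: topspace_def openin_top_of_order)

definition quot_top :: "'a topology \<Rightarrow> 'a topology \<Rightarrow> 'a topology" where
  "quot_top T T' = top_of_order (topspace T) (\<lambda>x y. top_le T x y \<or> top_le T' y x)\<^sup>+\<^sup>+"

definition admissible :: "'a topology \<Rightarrow> 'a topology \<Rightarrow> bool" where
  "admissible T T' \<longleftrightarrow> topspace T' = topspace T \<and>
     (\<forall>U. openin T U \<longrightarrow> openin T' U) \<and>
     (\<forall>Y. connectedin T' Y \<longrightarrow> subtopology T' Y = subtopology T Y) \<and>
     (\<forall>x\<in>topspace T. \<forall>y\<in>topspace T.
        top_eqv (quot_top T T') x y \<longleftrightarrow> top_eqv (quot_top T' T') x y)"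

text \<open>On a finite set \<open>E\<close>, \<open>std_rank E\<close> is the increasing bijection onto \<open>{1..card E}\<close>.\<close>

definition std_rank :: "'a::linorder set \<Rightarrow> 'a \<Rightarrow> nat" where
  "std_rank E x = card {e \<in> E. e \<le> x}"

lemma std_rank_strict_mono:
  assumes "finite E" "y \<in> E" "x < y"
  shows "std_rank E x < std_rank E y"
  unfolding std_rank_def
  by (rule psubset_card_mono) (use assms in \<open>auto simp: psubset_eq set_eq_iff not_le intro: exI[of _ y]\<close>)

lemma std_rank_inj_on:
  assumes "finite E"
  shows "inj_on (std_rank E) E"
  using std_rank_strict_mono[OF assms] by (metis inj_onI less_irrefl linorder_less_linear)

lemma std_rank_image:
  assumes "finite E"
  shows "std_rank E ` E = {1..card E}"
proof (rule card_subset_eq)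
  show "std_rank E ` E \<subseteq> {1..card E}"
  proof
    fix i assume "i \<in> std_rank E ` E"
    then obtain x where x: "x \<in> E" "i = card {e \<in> E. e \<le> x}"
      by (auto simp: std_rank_def)
    have "card {e \<in> E. e \<le> x} \<le> card E"
      using assms by (intro card_mono) auto
    moreover have "card {e \<in> E. e \<le> x} \<noteq> 0"
      using assms x by auto
    ultimately show "i \<in> {1..card E}"
      using x by auto
  qed
  show "card (std_rank E ` E) = card {1..card E}"
    by (simp add: card_image[OF std_rank_inj_on[OF assms]])
qed simp

definition std_top :: "'a::linorder topology \<Rightarrow> nat topology" where
  "std_top T = topology (\<lambda>U. \<exists>V. openin T V \<and> U = std_rank (topspace T) ` V)"

lemma openin_std_top:
  assumes "finite (topspace T)"
  shows "openin (std_top T) U \<longleftrightarrow> (\<exists>V. openin T V \<and> U = std_rank (topspace T) ` V)"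
proof -
  let ?r = "std_rank (topspace T)"
  have int: "\<exists>V. openin T V \<and> ?r ` A \<inter> ?r ` B = ?r ` V" if "openin T A" "openin T B" for A B
  proof (intro exI conjI)
    show "openin T (A \<inter> B)"
      using that by (rule openin_Int)
    show "?r ` A \<inter> ?r ` B = ?r ` (A \<inter> B)"
      using inj_on_image_Int[OF std_rank_inj_on[OF assms] that[THEN openin_subset]] by simp
  qed
  have un: "\<exists>V. openin T V \<and> \<Union>\<K> = ?r ` V"
    if ex: "\<forall>K\<in>\<K>. \<exists>V. openin T V \<and> K = ?r ` V" for \<K>
  proof -
    obtain g where g: "\<forall>K\<in>\<K>. openin T (g K) \<and> K = ?r ` g K"
      using bchoice[OF ex] by (rule exE)
    have "openin T (\<Union>(g ` \<K>))"
      using g by (intro openin_Union) auto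
    moreover have "\<Union>\<K> = ?r ` \<Union>(g ` \<K>)"
    proof -
      have "\<Union>\<K> = (\<Union>K\<in>\<K>. ?r ` g K)"
        using g by (metis (no_types, lifting) SUP_cong image_ident)
      then show ?thesis
        by (simp only: image_UN)
    qed
    ultimately show ?thesis
      by blast
  qed
  have "istopology (\<lambda>U. \<exists>V. openin T V \<and> U = ?r ` V)"
    unfolding istopology_def using int by (intro conjI allI impI un) auto
  then show ?thesis
    by (simp add: std_top_def)
qed

lemma topspace_std_top:
  assumes "finite (topspace T)"
  shows "topspace (std_top T) = {1..card (topspace T)}"
proof -
  have "topspace (std_top T) = std_rank (topspace T) ` topspace T"
    unfolding topspace_def[of "std_top T"] openin_std_top[OF assms]
    using openin_subset by blast
  then show ?thesis
    by (simp add: std_rank_image[OF assms])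
qed

definition shift_prod_top :: "nat topology \<Rightarrow> nat topology \<Rightarrow> nat topology" where
  "shift_prod_top T T' = topology (\<lambda>U. \<exists>Y Y'. openin T Y \<and> openin T' Y' \<and>
     U = Y \<union> (\<lambda>i. i + card (topspace T)) ` Y')"

lemma openin_shift_prod_top:
  assumes "topspace T = {1..n}" "topspace T' = {1..n'}"
  shows "openin (shift_prod_top T T') U \<longleftrightarrow>
    (\<exists>Y Y'. openin T Y \<and> openin T' Y' \<and> U = Y \<union> (\<lambda>i. i + n) ` Y')"
proof -
  let ?P = "\<lambda>U. \<exists>Y Y'. openin T Y \<and> openin T' Y' \<and> U = Y \<union> (\<lambda>i. i + n) ` Y'"
  have int: "?P (A \<inter> B)" if A: "?P A" and B: "?P B" for A B
  proof -
    obtain Y Y' where Y: "openin T Y" "openin T' Y'" "A = Y \<union> (\<lambda>i. i + n) ` Y'"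
      using A by blast
    obtain V V' where V: "openin T V" "openin T' V'" "B = V \<union> (\<lambda>i. i + n) ` V'"
      using B by blast
    have "Y \<subseteq> {1..n}" "V \<subseteq> {1..n}" "Y' \<subseteq> {1..n'}" "V' \<subseteq> {1..n'}"
      using Y V assms openin_subset by metis+
    then have "A \<inter> B = (Y \<inter> V) \<union> (\<lambda>i. i + n) ` (Y' \<inter> V')"
      unfolding Y V by fastforce
    then show ?thesis
      using Y V by blast
  qed
  have un: "?P (\<Union>\<K>)" if "\<forall>K\<in>\<K>. ?P K" for \<K>
  proof -
    have "\<forall>K\<in>\<K>. \<exists>q. openin T (fst q) \<and> openin T' (snd q) \<and> K = fst q \<union> (\<lambda>i. i + n) ` snd q"
      using that by fastforce
    then obtain q where q: "\<forall>K\<in>\<K>. openin T (fst (q K)) \<and> openin T' (snd (q K)) \<and>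
        K = fst (q K) \<union> (\<lambda>i. i + n) ` snd (q K)"
      by (metis (no_types, lifting))
    have "openin T (\<Union>K\<in>\<K>. fst (q K))" "openin T' (\<Union>K\<in>\<K>. snd (q K))"
      using q by (auto intro!: openin_Union)
    moreover have "\<Union>\<K> = (\<Union>K\<in>\<K>. fst (q K)) \<union> (\<lambda>i. i + n) ` (\<Union>K\<in>\<K>. snd (q K))"
    proof -
      have "\<Union>\<K> = (\<Union>K\<in>\<K>. fst (q K) \<union> (\<lambda>i. i + n) ` snd (q K))"
        using q by (metis (no_types, lifting) SUP_cong image_ident)
      then show ?thesis
        by (simp only: image_UN UN_Un_distrib)
    qed
    ultimately show ?thesis
      by blast
  qed
  have "istopology ?P"
    unfolding istopology_def by (intro conjI allI impI int un) auto
  then show ?thesis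
    by (simp add: shift_prod_top_def assms)
qed

lemma topspace_shift_prod_top:
  assumes "topspace T = {1..n}" "topspace T' = {1..n'}"
  shows "topspace (shift_prod_top T T') = {1..n + n'}"
proof -
  have "topspace (shift_prod_top T T') = topspace T \<union> (\<lambda>i. i + n) ` topspace T'"
    unfolding topspace_def[of "shift_prod_top T T'"] openin_shift_prod_top[OF assms]
    using openin_subset by blast
  also have "\<dots> = {1..n + n'}"
  proof -
    have "(\<lambda>i. i + n) ` {1..n'} = {1 + n..n' + n}"
      by (rule image_add_atLeastAtMost')
    then show ?thesis
      unfolding assms by auto
  qed
  finally show ?thesis .
qed

typedef fin_top = "{T :: nat topology. \<exists>n. topspace T = {1..n}}"
  morphisms top_of Abs_fin_top
  by (auto intro!: exI[of _ "discrete_topology {1..0}"] exI[of _ 0])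

setup_lifting type_definition_fin_top

lift_definition size_top :: "fin_top \<Rightarrow> nat" is "\<lambda>T. card (topspace T)" .

lift_definition empty_top :: fin_top is "discrete_topology {}"
  by (auto intro: exI[of _ 0])

lift_definition prod_top :: "fin_top \<Rightarrow> fin_top \<Rightarrow> fin_top" is shift_prod_top
  using topspace_shift_prod_top by blast

lift_definition std_restrict :: "fin_top \<Rightarrow> nat set \<Rightarrow> fin_top" is
  "\<lambda>T Y. std_top (subtopology T Y)"
proof -
  fix T :: "nat topology" and Y :: "nat set"
  assume "\<exists>n. topspace T = {1..n}"
  then have "finite (topspace (subtopology T Y))"
    by auto
  from topspace_std_top[OF this] show "\<exists>n. topspace (std_top (subtopology T Y)) = {1..n}"
    by blast
qed

lift_definition quotient_top :: "fin_top \<Rightarrow> fin_top \<Rightarrow> fin_top" is quot_top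
  by (simp add: quot_top_def topspace_top_of_order)

definition HT_coproduct :: "(fin_top \<Rightarrow>\<^sub>0 'k::field) \<Rightarrow> (fin_top \<times> fin_top) \<Rightarrow>\<^sub>0 'k" where
  "HT_coproduct = lin_ext (\<lambda>T. \<Sum>Y\<in>{Y. openin (top_of T) Y}.
     bas (std_restrict T ({1..size_top T} - Y), std_restrict T Y))"

text \<open>The counit kills all basis elements of positive degree.\<close>

definition HT :: "(fin_top, 'k::field) hopf_data" where
  "HT = \<lparr> mul = bilin_ext (\<lambda>T T'. bas (prod_top T T')),
          unit = bas empty_top,
          comul = HT_coproduct,
          counit = (\<lambda>x. Poly_Mapping.lookup x empty_top) \<rparr>"

definition HT_internal :: "(fin_top \<Rightarrow>\<^sub>0 'k::field) \<Rightarrow> (fin_top \<times> fin_top) \<Rightarrow>\<^sub>0 'k" where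
  "HT_internal = lin_ext (\<lambda>T. \<Sum>T'\<in>{T'. admissible (top_of T) (top_of T')}.
     bas (T', quotient_top T T'))"

section \<open>Packed words\<close>

definition wmax :: "nat list \<Rightarrow> nat" where
  "wmax w = Max (insert 0 (set w))"

definition packed :: "nat list \<Rightarrow> bool" where
  "packed w \<longleftrightarrow> set w = {1..wmax w}"

lemma packedI:
  assumes "set w = {1..m}"
  shows "packed w"
proof -
  have "wmax w = m"
    unfolding wmax_def assms by (rule Max_eqI) auto
  then show ?thesis
    by (simp add: packed_def assms)
qed

text \<open>A word is regarded as a map defined on \<open>{1..length w}\<close>.\<close>

definition letter :: "'a list \<Rightarrow> nat \<Rightarrow> 'a" where
  "letter w i = w ! (i - 1)"

definition word_comp :: "nat list \<Rightarrow> nat list \<Rightarrow> nat list" where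
  "word_comp w u = map (letter w) u"

lemma packed_word_comp:
  assumes "packed w" "set u = {1..length w}"
  shows "packed (word_comp w u)"
proof -
  have "letter w ` {1..length w} = set w"
  proof -
    have "{1..length w} = Suc ` {..<length w}"
      by (simp add: image_Suc_lessThan)
    then show ?thesis
      by (auto simp: letter_def image_image set_conv_nth)
  qed
  then show ?thesis
    using assms by (intro packedI[of _ "wmax w"]) (simp add: word_comp_def packed_def)
qed

definition pack :: "'a::linorder list \<Rightarrow> nat list" where
  "pack v = map (std_rank (set v)) v"

lemma packed_pack: "packed (pack v)"
  by (rule packedI[of _ "card (set v)"]) (simp only: pack_def set_map std_rank_image[OF finite_set])

typedef packed_word = "{w. packed w}"
  morphisms letters Abs_packed_word
proof
  show "[] \<in> {w. packed w}"
    by (simp add: packedI[of _ 0])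
qed

text \<open>Only meaningful on packed words; the lemmas \<open>packed_*\<close> justify its uses below.\<close>

definition Mbas :: "nat list \<Rightarrow> packed_word \<Rightarrow>\<^sub>0 'k::field" where
  "Mbas w = bas (Abs_packed_word w)"

definition QSh :: "nat list \<Rightarrow> nat list set" where
  "QSh is = {u. length u = sum_list is \<and> packed u \<and>
     (\<forall>j<length is. sorted_wrt (<) (take (is ! j) (drop (sum_list (take j is)) u)))}"

definition shifted_concat :: "nat list \<Rightarrow> nat list \<Rightarrow> nat list" where
  "shifted_concat u v = u @ map (\<lambda>a. a + wmax u) v"

lemma packed_product_term:
  assumes "packed u" "packed v" "w \<in> QSh [wmax u, wmax v]"
  shows "packed (word_comp w (shifted_concat u v))"
proof (rule packed_word_comp)
  show "packed w"
    using assms by (simp add: QSh_def)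
  have "(\<lambda>a. a + wmax u) ` {1..wmax v} = {1 + wmax u..wmax v + wmax u}"
    by (rule image_add_atLeastAtMost')
  then have "set (shifted_concat u v) = {1..wmax u} \<union> {1 + wmax u..wmax v + wmax u}"
    using assms by (simp add: shifted_concat_def packed_def)
  then show "set (shifted_concat u v) = {1..length w}"
    using assms by (auto simp: QSh_def)
qed

definition restrict_word :: "nat list \<Rightarrow> nat set \<Rightarrow> nat list" where
  "restrict_word w I = filter (\<lambda>a. a \<in> I) w"

lemma packed_restrict_word:
  assumes "packed w" "k \<le> wmax w"
  shows "packed (restrict_word w {1..k})"
  using assms by (intro packedI[of _ k]) (auto simp: restrict_word_def packed_def)

text \<open>Compositions have positive parts: the sum is finite and the words below are packed.\<close>

definition compositions :: "nat \<Rightarrow> nat list set" where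
  "compositions m = {is. sum_list is = m \<and> 0 \<notin> set is}"

definition block_word :: "nat list \<Rightarrow> nat list" where
  "block_word is = concat (map (\<lambda>j. replicate (is ! j) (j + 1)) [0..<length is])"

lemma packed_internal_terms:
  assumes "packed u" "is \<in> compositions (wmax u)"
  shows "v \<in> QSh is \<Longrightarrow> packed (word_comp v u)" "packed (word_comp (block_word is) u)"
proof -
  show "packed (word_comp v u)" if "v \<in> QSh is"
    using that assms by (intro packed_word_comp) (auto simp: QSh_def compositions_def packed_def)
  have pos: "is ! j \<noteq> 0" if "j < length is" for j
    using that assms by (metis (mono_tags, lifting) compositions_def mem_Collect_eq nth_mem)
  have "set (block_word is) = Suc ` {..<length is}"
    using pos by (auto simp: block_word_def)
  then have "packed (block_word is)"
    by (intro packedI[of _ "length is"]) (simp add: image_Suc_lessThan)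
  moreover have "length (block_word is) = sum_list is"
    by (simp add: block_word_def length_concat o_def map_nth)
  ultimately show "packed (word_comp (block_word is) u)"
    using assms by (intro packed_word_comp) (auto simp: compositions_def packed_def)
qed

definition WQSym_coproduct ::
    "(packed_word \<Rightarrow>\<^sub>0 'k::field) \<Rightarrow> (packed_word \<times> packed_word) \<Rightarrow>\<^sub>0 'k" where
  "WQSym_coproduct = lin_ext (\<lambda>w. \<Sum>k=0..wmax (letters w).
     tensor (Mbas (restrict_word (letters w) {1..k}))
            (Mbas (pack (restrict_word (letters w) {k+1..wmax (letters w)}))))"

definition WQSym :: "(packed_word, 'k::field) hopf_data" where
  "WQSym = \<lparr> mul = bilin_ext (\<lambda>u v. \<Sum>w\<in>QSh [wmax (letters u), wmax (letters v)].
                Mbas (word_comp w (shifted_concat (letters u) (letters v)))),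
             unit = Mbas [],
             comul = WQSym_coproduct,
             counit = (\<lambda>x. Poly_Mapping.lookup x (Abs_packed_word [])) \<rparr>"

definition WQSym_internal ::
    "(packed_word \<Rightarrow>\<^sub>0 'k::field) \<Rightarrow> (packed_word \<times> packed_word) \<Rightarrow>\<^sub>0 'k" where
  "WQSym_internal = lin_ext (\<lambda>u. \<Sum>is\<in>compositions (wmax (letters u)). \<Sum>v\<in>QSh is.
     tensor (Mbas (word_comp v (letters u))) (Mbas (word_comp (block_word is) (letters u))))"

text \<open>
  Formal series in the noncommuting variables \<^typ>\<open>'z\<close> are functions
  \<^typ>\<open>'z list \<Rightarrow> 'k\<close>, giving the coefficient of each word.
\<close>

definition realization :: "(packed_word \<Rightarrow>\<^sub>0 'k::field) \<Rightarrow> 'z::linorder list \<Rightarrow> 'k" where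
  "realization x v = (\<Sum>w\<in>Poly_Mapping.keys x.
     Poly_Mapping.lookup x w * (if pack v = letters w then 1 else 0))"

section \<open>The map from topologies to packed words\<close>

definition lin_maps :: "nat topology \<Rightarrow> (nat \<Rightarrow> 'z::linorder) set" where
  "lin_maps T = {f \<in> topspace T \<rightarrow>\<^sub>E UNIV.
     (\<forall>i j. top_less T i j \<longrightarrow> f i < f j) \<and> (\<forall>i j. top_eqv T i j \<longrightarrow> f i = f j)}"

text \<open>The series given by the sum of the words \<open>f 1 \<dots> f n\<close> over all \<open>f\<close> in \<open>lin_maps T\<close>.\<close>

definition Lambda_series :: "fin_top \<Rightarrow> 'z::linorder list \<Rightarrow> 'k::field" where
  "Lambda_series T v =
     of_nat (card {f \<in> lin_maps (top_of T). map f [1..<size_top T + 1] = v})"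

definition lin_words :: "fin_top \<Rightarrow> packed_word set" where
  "lin_words T = {w. length (letters w) = size_top T \<and>
     (\<forall>i j. top_less (top_of T) i j \<longrightarrow> letter (letters w) i < letter (letters w) j) \<and>
     (\<forall>i j. top_eqv (top_of T) i j \<longrightarrow> letter (letters w) i = letter (letters w) j)}"

definition Lambda :: "(fin_top \<Rightarrow>\<^sub>0 'k::field) \<Rightarrow> packed_word \<Rightarrow>\<^sub>0 'k" where
  "Lambda = lin_ext (\<lambda>T. \<Sum>w\<in>lin_words T. bas w)"

end

theory Submission
  imports Defs "HOL-Library.Product_Lexorder" "HOL-Library.Multiset"
begin


section \<open>Linear maps on spaces with a distinguished basis\<close>

text \<open>After expansion on basis elements, the claims on products and coproducts become
  bijections between sets of words. A linear extension is a matter of comparisons between letters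
  only, so packing a word does not affect it (\<open>lin_on_pack\<close>).

  Product: no relation of a product topology crosses from the first block of points to the second,
  so a word extends the product iff its prefix and its suffix, once packed, extend the factors
  (\<open>mem_lin_words_prod_top\<close>). On the other side, the product of \<open>M_u\<close> and
  \<open>M_v\<close> is the sum of the \<open>M_x\<close> whose prefix packs to \<open>u\<close> and
  whose suffix packs to \<open>v\<close> (\<open>WQSym_mul_bas\<close>).

  Coproduct: cut a packed linear extension \<open>f\<close> at a height \<open>k\<close>. As
  \<open>f\<close> is increasing, the points above \<open>k\<close> form an open set
  \<open>Y\<close>, and \<open>f\<close> restricts to extensions of both pieces. Conversely,
  extensions \<open>g\<close> of the complement and \<open>h\<close> of \<open>Y\<close> are glued
  by lifting \<open>h\<close> above all values of \<open>g\<close>. Thus pairs \<open>(f, k)\<close>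
  correspond to triples \<open>(Y, g, h)\<close> (\<open>Lambda_comul_std_order\<close>).

  Internal coproducts: \<rho> of \<open>M_u\<close> is the sum of the tensors of \<open>M_a\<close>
  and \<open>M_b\<close> over the pairs of words for which the word with letters
  \<open>(b_i, a_i)\<close>, ordered lexicographically, packs to \<open>u\<close>
  (\<open>WQSym_internal_bas\<close>). So \<rho> after \<Lambda>, at \<open>T\<close>, sums over the
  pairs for which this word of pairs extends \<open>T\<close>. For each such pair exactly one
  admissible \<open>T'\<close> has \<open>a\<close> extending \<open>T'\<close> and \<open>b\<close>
  extending the quotient of \<open>T\<close> by \<open>T'\<close>, namely \<open>T\<close> cut along
  the level sets of \<open>b\<close>, and all admissible data arise in this way
  (\<open>admissible_iff_lexicographic\<close>).

  Hopf structures: the axioms for topologies are checked on quasi-orders over arbitrary finite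
  carriers, which avoids renumbering (\<open>HT_bialgebra\<close>). Every packed word is the only
  linear extension of the total quasi-order given by its letters, so \<Lambda> is onto and
  \<open>WQSym\<close> inherits the axioms (\<open>bialgebra_transfer\<close>). Both bialgebras are
  graded and connected, so antipodes exist by recursion on the degree; \<Lambda> respects them
  because convolution inverses are unique.

  Realization: the coefficient of a series at a word is the coordinate at its packing, and an
  infinite alphabet contains words of every packing (\<open>inj_realization\<close>).\<close>

lemma lookup_scale [simp]: "Poly_Mapping.lookup (scale c x) k = c * Poly_Mapping.lookup x k"
  unfolding scale_def by (transfer) (simp add: when_def)

lemma lookup_bas: "Poly_Mapping.lookup (bas b) k = (if b = k then 1 else 0)"
  by (simp add: bas_def lookup_single when_def)

lemma vector_space_scale: "vector_space (scale :: 'k::field \<Rightarrow> ('b \<Rightarrow>\<^sub>0 'k) \<Rightarrow> 'b \<Rightarrow>\<^sub>0 'k)"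
  by unfold_locales (auto intro!: poly_mapping_eqI simp: lookup_add algebra_simps)

lemma scale_1 [simp]: "scale 1 x = x"
  by (rule poly_mapping_eqI) simp

lemma scale_0_left [simp]: "scale 0 x = 0"
  by (rule poly_mapping_eqI) simp

lemma scale_scale: "scale c (scale d x) = scale (c * d) x"
  by (rule poly_mapping_eqI) (simp add: mult.assoc)

abbreviation lin :: "(('a \<Rightarrow>\<^sub>0 'k::field) \<Rightarrow> 'b \<Rightarrow>\<^sub>0 'k) \<Rightarrow> bool" where
  "lin f \<equiv> Vector_Spaces.linear scale scale f"

lemma linI:
  fixes f :: "('a \<Rightarrow>\<^sub>0 'k::field) \<Rightarrow> 'c \<Rightarrow>\<^sub>0 'k"
  assumes "\<And>x y. f (x + y) = f x + f y" "\<And>c x. f (scale c x) = scale c (f x)"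
  shows "lin f"
  unfolding linear_iff_module_hom module_hom_def module_hom_axioms_def
  using assms vector_space_scale[where ?'b = 'a] vector_space_scale[where ?'b = 'c]
  by (auto simp: module_iff_vector_space)

lemma linD:
  assumes "lin f"
  shows "f (x + y) = f x + f y" "f (scale c x) = scale c (f x)" "f 0 = 0" "f (x - y) = f x - f y"
    "f (sum g A) = (\<Sum>a\<in>A. f (g a))"
proof -
  interpret Vector_Spaces.linear scale scale f by (rule assms)
  show "f (x + y) = f x + f y" "f (scale c x) = scale c (f x)" "f 0 = 0" "f (x - y) = f x - f y"
    "f (sum g A) = (\<Sum>a\<in>A. f (g a))"
    by (rule add scale zero diff sum)+
qed

lemma lin_id: "lin id" "lin (\<lambda>x. x)"
  by (auto intro!: linI)

lemma lin_comp: "lin f \<Longrightarrow> lin g \<Longrightarrow> lin (\<lambda>x. f (g x))"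
  by (rule linI) (simp_all add: linD)

lemma lin_scale: "lin (scale c)"
  by (rule linI) (auto intro!: poly_mapping_eqI simp: lookup_add algebra_simps)

lemma lin_sum: "(\<And>i. i \<in> I \<Longrightarrow> lin (f i)) \<Longrightarrow> lin (\<lambda>x. \<Sum>i\<in>I. f i x)"
  by (rule linI) (simp_all add: linD sum.distrib linD(5)[OF lin_scale])

text \<open>Multiplying a fixed vector by a functional gives a vector-valued map, so that
  functionals too can be compared on the basis with \<open>lin_eqI\<close>.\<close>

lemma lin_scale_left:
  assumes "Vector_Spaces.linear scale (*) h"
  shows "lin (\<lambda>x. scale (h x) v)"
proof -
  have "h (x + y) = h x + h y" "h (scale c x) = c * h x" for x y c
    using assms by (simp_all add: linear_iff_module_hom module_hom_def module_hom_axioms_def)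
  then show ?thesis
    by (intro linI poly_mapping_eqI) (simp_all add: lookup_add distrib_right)
qed

lemma scale_sum: "scale c (sum g A) = (\<Sum>a\<in>A. scale c (g a))"
  by (rule linD(5)[OF lin_scale])

text \<open>The support of a sum can be smaller than the union of the supports. Summing over any
  finite superset puts \<open>x\<close>, \<open>y\<close> and \<open>x + y\<close> on a common index
  set.\<close>

lemma lin_ext_superset:
  assumes "finite S" "Poly_Mapping.keys x \<subseteq> S"
  shows "lin_ext f x = (\<Sum>a\<in>S. scale (Poly_Mapping.lookup x a) (f a))"
  unfolding lin_ext_def using assms
  by (intro sum.mono_neutral_left) (auto simp: in_keys_iff)

lemma lin_lin_ext:
  fixes f :: "'a \<Rightarrow> 'b \<Rightarrow>\<^sub>0 'k::field"
  shows "lin (lin_ext f)"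
proof (rule linI)
  fix x y :: "'a \<Rightarrow>\<^sub>0 'k"
  let ?S = "Poly_Mapping.keys x \<union> Poly_Mapping.keys y"
  have "lin_ext f z = (\<Sum>a\<in>?S. scale (Poly_Mapping.lookup z a) (f a))"
    if "z \<in> {x, y, x + y}" for z
    by (rule lin_ext_superset) (use that keys_add[of x y] in auto)
  then show "lin_ext f (x + y) = lin_ext f x + lin_ext f y"
    by (auto intro!: poly_mapping_eqI
        simp: sum.distrib[symmetric] lookup_add lookup_sum algebra_simps)
next
  fix c and x :: "'a \<Rightarrow>\<^sub>0 'k"
  have "lin_ext f (scale c x) = (\<Sum>a\<in>Poly_Mapping.keys x. scale (Poly_Mapping.lookup (scale c x) a) (f a))"
    by (rule lin_ext_superset) (auto simp: in_keys_iff)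
  then show "lin_ext f (scale c x) = scale c (lin_ext f x)"
    by (simp add: lin_ext_def scale_sum scale_scale)
qed

lemma lin_ext_bas [simp]: "lin_ext f (bas a) = f a"
  by (subst lin_ext_superset[of "{a}"]) (auto simp: bas_def)

lemma basis_expansion: "x = (\<Sum>a\<in>Poly_Mapping.keys x. scale (Poly_Mapping.lookup x a) (bas a))"
proof (rule poly_mapping_eqI)
  fix k
  show "Poly_Mapping.lookup x k = Poly_Mapping.lookup (\<Sum>a\<in>Poly_Mapping.keys x. scale (Poly_Mapping.lookup x a) (bas a)) k"
    by (simp add: lookup_sum lookup_bas if_distrib sum.delta cong: if_cong) (simp add: in_keys_iff)
qed

lemma lin_eqI:
  assumes "lin f" "lin g" "\<And>a. f (bas a) = g (bas a)"
  shows "f x = g x"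
proof -
  have "f (\<Sum>a\<in>Poly_Mapping.keys x. scale (Poly_Mapping.lookup x a) (bas a))
      = g (\<Sum>a\<in>Poly_Mapping.keys x. scale (Poly_Mapping.lookup x a) (bas a))"
    by (simp add: linD[OF assms(1)] linD[OF assms(2)] assms(3))
  then show ?thesis
    using basis_expansion[of x] by simp
qed

lemma lin_lin_ext_param: "(\<And>a. lin (\<lambda>y. f y a)) \<Longrightarrow> lin (\<lambda>y. lin_ext (f y) x)"
  unfolding lin_ext_def by (intro lin_sum lin_comp[OF lin_scale]) auto

section \<open>Bilinear extension and tensor products\<close>

lemma bilin_ext_conv_left: "bilin_ext f x y = lin_ext (\<lambda>a. lin_ext (f a) y) x"
  by (simp add: bilin_ext_def lin_ext_def scale_sum scale_scale)

lemma lin_bilin_ext_left: "lin (\<lambda>x. bilin_ext f x y)"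
  unfolding bilin_ext_conv_left by (rule lin_lin_ext)

lemma lin_bilin_ext_right: "lin (bilin_ext f x)"
  unfolding bilin_ext_conv_left[abs_def] by (intro lin_lin_ext_param lin_lin_ext)

lemma bilin_ext_bas [simp]: "bilin_ext f (bas a) (bas b) = f a b"
  by (simp add: bilin_ext_conv_left)

lemma lin_tensor: "lin (\<lambda>x. tensor x y)" "lin (tensor x)"
  unfolding tensor_def by (rule lin_bilin_ext_left lin_bilin_ext_right)+

lemma tensor_bas [simp]: "tensor (bas a) (bas b) = bas (a, b)"
  by (simp add: tensor_def)

lemma lin_tensor_map: "lin (tensor_map f g)"
  unfolding tensor_map_def by (rule lin_lin_ext)

lemma lin_tensor_assoc: "lin tensor_assoc"
  unfolding tensor_assoc_def by (rule lin_lin_ext)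

lemma lin_mul_tensor: "lin (mul_tensor A)"
  unfolding mul_tensor_def by (rule lin_lin_ext)

lemma tensor_map_bas [simp]: "tensor_map f g (bas (a, b)) = tensor (f (bas a)) (g (bas b))"
  by (simp add: tensor_map_def)

lemma tensor_assoc_bas [simp]: "tensor_assoc (bas ((a, b), c)) = bas (a, b, c)"
  by (simp add: tensor_assoc_def)

lemma mul_tensor_bas [simp]: "mul_tensor A (bas (a, b)) = mul A (bas a) (bas b)"
  by (simp add: mul_tensor_def)

lemma lin_eqI2:
  assumes "\<And>y. lin (\<lambda>x. f x y)" "\<And>y. lin (\<lambda>x. g x y)" "\<And>x. lin (f x)" "\<And>x. lin (g x)"
    "\<And>a b. f (bas a) (bas b) = g (bas a) (bas b)"
  shows "f x y = g x y"
proof -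
  have "f (bas a) y = g (bas a) y" for a
    by (rule lin_eqI[where f = "f (bas a)"]) (auto intro: assms)
  then show ?thesis
    by (rule lin_eqI[where f = "\<lambda>x. f x y", rotated 2]) (auto intro: assms)
qed

text \<open>\<open>tensor_map\<close> is given by its values on pairs of basis vectors; linearity of
  both factors is what extends the formula to all pure tensors.\<close>

lemma tensor_map_tensor:
  assumes "lin f" "lin g"
  shows "tensor_map f g (tensor x y) = tensor (f x) (g y)"
  by (rule lin_eqI2[where f = "\<lambda>x y. tensor_map f g (tensor x y)"])
    (auto intro!: lin_comp[OF lin_tensor_map] lin_tensor
        lin_comp[OF lin_tensor(1) assms(1)] lin_comp[OF lin_tensor(2) assms(2)])

lemma tensor_map_comp:
  assumes "lin f" "lin g" "lin f'" "lin g'"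
  shows "tensor_map f g (tensor_map f' g' x) = tensor_map (\<lambda>x. f (f' x)) (\<lambda>x. g (g' x)) x"
  by (rule lin_eqI) (auto intro!: lin_comp[OF lin_tensor_map lin_tensor_map] lin_tensor_map simp: tensor_map_tensor assms)

lemma tensor_assoc_tensor: "tensor_assoc (tensor (tensor x y) z) = tensor x (tensor y z)"
proof -
  have "tensor_assoc (tensor (tensor x y) (bas c)) = tensor x (tensor y (bas c))" for c
    by (rule lin_eqI2[where f = "\<lambda>x y. tensor_assoc (tensor (tensor x y) (bas c))"])
      (auto intro!: lin_comp[OF lin_tensor_assoc] lin_comp[OF lin_tensor(1) lin_tensor(1)]
        lin_comp[OF lin_tensor(1) lin_tensor(2)] lin_tensor
        lin_comp[OF lin_tensor(2) lin_tensor(1)])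
  then show ?thesis
    by (rule lin_eqI[where x = z, rotated 2])
      (auto intro!: lin_comp[OF lin_tensor_assoc] lin_tensor
        lin_comp[OF lin_tensor(2) lin_tensor(2)])
qed

text \<open>Naturality of the associator, which lets coassociativity be used under a tensor product
  of three maps.\<close>

lemma tensor_assoc_tensor_map:
  assumes "lin f" "lin g" "lin h"
  shows "tensor_assoc (tensor_map (tensor_map f g) h x) = tensor_map f (tensor_map g h) (tensor_assoc x)"
  by (rule lin_eqI)
    (auto intro!: lin_comp[OF lin_tensor_assoc lin_tensor_map] lin_comp[OF lin_tensor_map lin_tensor_assoc]
      simp: tensor_assoc_tensor tensor_map_tensor assms split: prod.split)

lemma tensor_sum_left: "tensor (sum f A) y = (\<Sum>a\<in>A. tensor (f a) y)"
  by (rule linD(5)[OF lin_tensor(1)])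

lemma tensor_sum_right: "tensor x (sum f A) = (\<Sum>a\<in>A. tensor x (f a))"
  by (rule linD(5)[OF lin_tensor(2)])

section \<open>Convolution, antipodes and transfer along surjections\<close>

lemma algebraD:
  assumes "is_algebra A"
  shows "lin (\<lambda>x. mul A x y)" "lin (mul A x)" "mul A (mul A x y) z = mul A x (mul A y z)"
    "mul A (unit A) x = x" "mul A x (unit A) = x"
  using assms unfolding is_algebra_def by blast+

lemma coalgebraD:
  assumes "is_coalgebra A"
  shows "lin (comul A)" "Vector_Spaces.linear scale (*) (counit A)"
    "tensor_assoc (tensor_map (comul A) id (comul A x)) = tensor_map id (comul A) (comul A x)"
    "lin_ext (\<lambda>(a, b). scale (counit A (bas a)) (bas b)) (comul A x) = x"
    "lin_ext (\<lambda>(a, b). scale (counit A (bas b)) (bas a)) (comul A x) = x"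
  using assms unfolding is_coalgebra_def by blast+

lemma mul_tensor_tensor:
  assumes "is_algebra A"
  shows "mul_tensor A (tensor x y) = mul A x y"
  by (rule lin_eqI2[where f = "\<lambda>x y. mul_tensor A (tensor x y)"])
    (simp_all add: algebraD[OF assms] lin_comp[OF lin_mul_tensor] lin_tensor)

lemma mul_tensor_assoc:
  assumes "is_algebra A"
  shows "mul_tensor A (tensor_map (mul_tensor A) id z)
    = mul_tensor A (tensor_map id (mul_tensor A) (tensor_assoc z))"
  by (rule lin_eqI)
    (auto simp: mul_tensor_tensor[OF assms] algebraD[OF assms]
      intro!: lin_comp[OF lin_mul_tensor] lin_tensor_map lin_comp[OF lin_tensor_map lin_tensor_assoc])

text \<open>The convolution product on linear maps from a coalgebra \<open>A\<close> to an algebra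
  \<open>B\<close>. Source and target may differ because the comparison of two antipodes takes place
  among maps from one Hopf algebra to the other.\<close>

definition convolution :: "('a, 'k::field) hopf_data \<Rightarrow> ('b, 'k) hopf_data \<Rightarrow>
    (('a \<Rightarrow>\<^sub>0 'k) \<Rightarrow> 'b \<Rightarrow>\<^sub>0 'k) \<Rightarrow> (('a \<Rightarrow>\<^sub>0 'k) \<Rightarrow> 'b \<Rightarrow>\<^sub>0 'k) \<Rightarrow> ('a \<Rightarrow>\<^sub>0 'k) \<Rightarrow> 'b \<Rightarrow>\<^sub>0 'k" where
  "convolution A B f g x = mul_tensor B (tensor_map f g (comul A x))"

lemma lin_convolution:
  assumes "is_coalgebra A"
  shows "lin (convolution A B f g)"
  unfolding convolution_def[abs_def]
  by (intro lin_comp[OF lin_mul_tensor] lin_comp[OF lin_tensor_map] coalgebraD assms)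

text \<open>Associativity of \<open>B\<close> and coassociativity of \<open>A\<close>, joined by
  naturality of the associator.\<close>

lemma convolution_assoc:
  assumes A: "is_coalgebra A" and B: "is_algebra B" and lin: "lin f" "lin g" "lin h"
  shows "convolution A B (convolution A B f g) h x = convolution A B f (convolution A B g h) x"
proof -
  note \<Delta> = coalgebraD(1)[OF A]
  have "convolution A B (convolution A B f g) h x
      = mul_tensor B (tensor_map (mul_tensor B) id
          (tensor_map (tensor_map f g) h (tensor_map (comul A) id (comul A x))))"
    by (simp add: convolution_def[abs_def] tensor_map_comp lin_mul_tensor lin_id lin_tensor_map
        \<Delta> lin lin_comp[OF lin_tensor_map \<Delta>])
  also have "\<dots> = mul_tensor B (tensor_map id (mul_tensor B)
          (tensor_map f (tensor_map g h) (tensor_map id (comul A) (comul A x))))"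
    by (simp add: mul_tensor_assoc[OF B] tensor_assoc_tensor_map lin coalgebraD(3)[OF A])
  also have "\<dots> = convolution A B f (convolution A B g h) x"
    by (simp add: convolution_def[abs_def] tensor_map_comp lin_mul_tensor lin_id lin_tensor_map
        \<Delta> lin lin_comp[OF lin_tensor_map \<Delta>])
  finally show ?thesis .
qed

lemma convolution_unit_right:
  assumes A: "is_coalgebra A" and B: "is_algebra B" and f: "lin f"
  shows "convolution A B f (\<lambda>x. scale (counit A x) (unit B)) x = f x"
proof -
  have "mul_tensor B (tensor_map f (\<lambda>x. scale (counit A x) (unit B)) z)
      = f (lin_ext (\<lambda>(a, b). scale (counit A (bas b)) (bas a)) z)" for z
    by (rule lin_eqI)
      (auto intro!: lin_comp[OF lin_mul_tensor] lin_comp[OF f] lin_tensor_map lin_lin_ext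
        simp: mul_tensor_tensor[OF B] algebraD[OF B] linD[OF algebraD(2)[OF B]] linD[OF f])
  then show ?thesis
    by (simp add: convolution_def coalgebraD(5)[OF A])
qed

lemma convolution_unit_left:
  assumes A: "is_coalgebra A" and B: "is_algebra B" and f: "lin f"
  shows "convolution A B (\<lambda>x. scale (counit A x) (unit B)) f x = f x"
proof -
  have "mul_tensor B (tensor_map (\<lambda>x. scale (counit A x) (unit B)) f z)
      = f (lin_ext (\<lambda>(a, b). scale (counit A (bas a)) (bas b)) z)" for z
    by (rule lin_eqI)
      (auto intro!: lin_comp[OF lin_mul_tensor] lin_comp[OF f] lin_tensor_map lin_lin_ext
        simp: mul_tensor_tensor[OF B] algebraD[OF B] linD[OF algebraD(1)[OF B]] linD[OF f])
  then show ?thesis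
    by (simp add: convolution_def coalgebraD(4)[OF A])
qed

text \<open>A left inverse \<open>f\<close> and a right inverse \<open>h\<close> of the same
  \<open>g\<close> agree: bracket the product of \<open>f\<close>, \<open>g\<close> and
  \<open>h\<close> in both ways.\<close>

lemma convolution_inverse_unique:
  assumes A: "is_coalgebra A" and B: "is_algebra B" and lin: "lin f" "lin g" "lin h"
    and fg: "\<And>x. convolution A B f g x = scale (counit A x) (unit B)"
    and gh: "\<And>x. convolution A B g h x = scale (counit A x) (unit B)"
  shows "f x = h x"
proof -
  have "convolution A B f g = (\<lambda>x. scale (counit A x) (unit B))"
    "convolution A B g h = (\<lambda>x. scale (counit A x) (unit B))"
    using fg gh by auto
  then show ?thesis
    using convolution_assoc[OF A B lin, of x] convolution_unit_left[OF A B lin(3)]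
      convolution_unit_right[OF A B lin(1)] by simp
qed

section \<open>Antipodes: compatibility with morphisms and existence\<close>

lemma is_antipode_convolution:
  "is_antipode A S \<longleftrightarrow> lin S \<and>
    (\<forall>x. convolution A A S id x = scale (counit A x) (unit A)) \<and>
    (\<forall>x. convolution A A id S x = scale (counit A x) (unit A))"
  by (simp add: is_antipode_def convolution_def)

text \<open>Both composites are convolution inverses of \<open>f\<close>.\<close>

lemma bialgebra_morphism_antipode:
  assumes A: "is_bialgebra A" and B: "is_bialgebra B" and f: "lin f"
    and mul: "\<And>x y. f (mul A x y) = mul B (f x) (f y)" and unit: "f (unit A) = unit B"
    and comul: "\<And>x. comul B (f x) = tensor_map f f (comul A x)"
    and counit: "\<And>x. counit B (f x) = counit A x"
    and S: "is_antipode A S" and S': "is_antipode B S'"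
  shows "f (S x) = S' (f x)"
proof -
  have alg: "is_algebra A" "is_algebra B" "is_coalgebra A"
    using A B by (auto simp: is_bialgebra_def)
  have lin: "lin S" "lin S'"
    using S S' by (auto simp: is_antipode_def)
  have mult: "f (mul_tensor A z) = mul_tensor B (tensor_map f f z)" for z
    by (rule lin_eqI) (auto intro!: lin_comp[OF f] lin_comp[OF lin_mul_tensor] lin_tensor_map lin_mul_tensor
        simp: mul_tensor_tensor[OF alg(2)] mul)
  have 1: "convolution A B (\<lambda>x. f (S x)) f x = scale (counit A x) (unit B)" for x
  proof -
    have "convolution A B (\<lambda>x. f (S x)) f x = f (mul_tensor A (tensor_map S id (comul A x)))"
      by (simp add: mult convolution_def tensor_map_comp f lin lin_id)
    then show ?thesis
      using S by (simp add: is_antipode_def linD[OF f] unit)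
  qed
  have 2: "convolution A B f (\<lambda>x. S' (f x)) x = scale (counit A x) (unit B)" for x
  proof -
    have "convolution A B f (\<lambda>x. S' (f x)) x = mul_tensor B (tensor_map id S' (comul B (f x)))"
      by (simp add: comul convolution_def tensor_map_comp f lin lin_id)
    then show ?thesis
      using S' by (simp add: is_antipode_def counit)
  qed
  show ?thesis
    by (rule convolution_inverse_unique[OF alg(3) alg(2) lin_comp[OF f lin(1)] f lin_comp[OF lin(2) f] 1 2])
qed

text \<open>In \<open>D b\<close> the only term with right factor \<open>e\<close> is
  \<open>(b, e)\<close>, with coefficient 1, and all other left factors have smaller degree. The
  equation at \<open>b\<close> therefore expresses \<open>S b\<close> through values at smaller
  degrees. \<open>m\<close> and \<open>D\<close> are kept abstract so that the same recursion yields
  left and right inverses.\<close>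

lemma left_convolution_inverse_exists:
  fixes D :: "'b \<Rightarrow> ('b \<times> 'b) \<Rightarrow>\<^sub>0 'k::field" and deg :: "'b \<Rightarrow> nat"
  assumes unit: "\<And>x. m x e = x"
    and D_unit: "\<And>b c. Poly_Mapping.lookup (D b) (c, e) = (if c = b then 1 else 0)"
    and D_deg: "\<And>b c d. (c, d) \<in> Poly_Mapping.keys (D b) \<Longrightarrow> d \<noteq> e \<Longrightarrow> deg c < deg b"
  shows "\<exists>S :: 'b \<Rightarrow> 'c \<Rightarrow>\<^sub>0 'k. \<forall>b. lin_ext (\<lambda>(c, d). m (S c) d) (D b) = t b"
proof -
  define K where "K b = {p \<in> Poly_Mapping.keys (D b). snd p \<noteq> e}" for b
  define G where "G S b = (\<Sum>p\<in>K b. scale (Poly_Mapping.lookup (D b) p) (m (S (fst p)) (snd p)))"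
    for S :: "'b \<Rightarrow> 'c \<Rightarrow>\<^sub>0 'k" and b
  define S where "S = wfrec (measure deg) (\<lambda>S b. t b - G S b)"
  have S_eq: "S b = t b - G S b" for b
  proof -
    \<comment> \<open>\<open>G\<close> calls \<open>S\<close> only at left factors of smaller
      degree, so truncating \<open>S\<close> outside the recursion relation changes nothing.\<close>
    have "G (cut S (measure deg) b) b = G S b"
      unfolding G_def K_def by (rule sum.cong) (auto simp: cut_apply D_deg)
    then show ?thesis
      unfolding S_def by (subst wfrec) simp_all
  qed
  have "lin_ext (\<lambda>(c, d). m (S c) d) (D b) = t b" for b
  proof -
    have keys: "Poly_Mapping.keys (D b) = insert (b, e) (K b)"
      unfolding K_def using D_unit by (auto simp: in_keys_iff split: if_splits)
    have "lin_ext (\<lambda>(c, d). m (S c) d) (D b) = m (S b) e + G S b"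
      unfolding lin_ext_def keys G_def
      by (subst sum.insert) (auto simp: K_def D_unit case_prod_beta)
    then show ?thesis
      using S_eq[of b] by (simp add: unit)
  qed
  then show ?thesis
    by blast
qed

text \<open>Connectedness is the assumption that degree zero contains only the unit
  \<open>e\<close>. The recursion produces a left and a right convolution inverse of the identity,
  and uniqueness of inverses identifies them.\<close>

lemma connected_graded_antipode_exists:
  fixes A :: "('b, 'k::field) hopf_data" and deg :: "'b \<Rightarrow> nat"
  assumes A: "is_bialgebra A" and unit: "unit A = bas e"
    and counit: "\<And>b. counit A (bas b) = (if b = e then 1 else 0)"
    and deg_0: "\<And>b. deg b = 0 \<Longrightarrow> b = e"
    and deg: "\<And>b c d. (c, d) \<in> Poly_Mapping.keys (comul A (bas b)) \<Longrightarrow> deg c + deg d = deg b"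
  shows "\<exists>S. is_antipode A S"
proof -
  have alg: "is_algebra A" and coalg: "is_coalgebra A"
    using A by (auto simp: is_bialgebra_def)
  \<comment> \<open>Exchanging the tensor factors turns the equation for a right inverse into the
    one for a left inverse.\<close>
  define sw :: "('b \<times> 'b \<Rightarrow>\<^sub>0 'k) \<Rightarrow> ('b \<times> 'b) \<Rightarrow>\<^sub>0 'k"
    where "sw = lin_ext (\<lambda>(a, b). bas (b, a))"
  have lookup_sw: "Poly_Mapping.lookup (sw z) (a, b) = Poly_Mapping.lookup z (b, a)" for z a b
  proof -
    have "Poly_Mapping.lookup (sw z) (a, b)
        = (\<Sum>p\<in>Poly_Mapping.keys z. if p = (b, a) then Poly_Mapping.lookup z p else 0)"
      unfolding sw_def lin_ext_def lookup_sum
      by (rule sum.cong) (auto simp: lookup_bas split: prod.splits)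
    then show ?thesis
      by (simp add: sum.delta in_keys_iff)
  qed
  \<comment> \<open>Since the counit vanishes on all basis vectors but \<open>e\<close>, the counit
    axiom reads off the coefficients of the terms with right factor \<open>e\<close>.\<close>
  have r: "Poly_Mapping.lookup (comul A (bas b)) (c, e) = (if c = b then 1 else 0)" for b c
  proof -
    have "Poly_Mapping.lookup (bas b) c = Poly_Mapping.lookup
        (lin_ext (\<lambda>(a, b). scale (counit A (bas b)) (bas a)) (comul A (bas b))) c"
      by (simp add: coalgebraD(5)[OF coalg])
    also have "\<dots> = (\<Sum>p\<in>Poly_Mapping.keys (comul A (bas b)).
        if p = (c, e) then Poly_Mapping.lookup (comul A (bas b)) p else 0)"
      unfolding lin_ext_def lookup_sum
      by (rule sum.cong) (auto simp: lookup_bas counit split: prod.splits)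
    finally show ?thesis
      by (simp add: sum.delta in_keys_iff lookup_bas split: if_splits)
  qed
  have l: "Poly_Mapping.lookup (comul A (bas b)) (e, c) = (if c = b then 1 else 0)" for b c
  proof -
    have "Poly_Mapping.lookup (bas b) c = Poly_Mapping.lookup
        (lin_ext (\<lambda>(a, b). scale (counit A (bas a)) (bas b)) (comul A (bas b))) c"
      by (simp add: coalgebraD(4)[OF coalg])
    also have "\<dots> = (\<Sum>p\<in>Poly_Mapping.keys (comul A (bas b)).
        if p = (e, c) then Poly_Mapping.lookup (comul A (bas b)) p else 0)"
      unfolding lin_ext_def lookup_sum
      by (rule sum.cong) (auto simp: lookup_bas counit split: prod.splits)
    finally show ?thesis
      by (simp add: sum.delta in_keys_iff lookup_bas split: if_splits)
  qed
  \<comment> \<open>A basis vector other than \<open>e\<close> has positive degree, so its partner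
    in the coproduct has degree below that of \<open>b\<close>.\<close>
  have deg_less: "deg c < deg b"
    if "(c, d) \<in> Poly_Mapping.keys (comul A (bas b)) \<or> (d, c) \<in> Poly_Mapping.keys (comul A (bas b))"
      "d \<noteq> e" for b c d
    using that deg[of c d b] deg[of d c b] deg_0[of d] by fastforce
  let ?u = "\<lambda>x. scale (counit A x) (unit A)"
  note lin_u = lin_scale_left[OF coalgebraD(2)[OF coalg]]
  obtain S where S: "lin_ext (\<lambda>(c, d). mul A (S c) (bas d)) (comul A (bas b)) = ?u (bas b)" for b
    using left_convolution_inverse_exists[where m = "\<lambda>x d. mul A x (bas d)" and e = e and deg = deg
        and D = "\<lambda>b. comul A (bas b)" and t = "\<lambda>b. ?u (bas b)"] algebraD(5)[OF alg] r deg_less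
    unfolding unit by blast
  obtain S' where S': "lin_ext (\<lambda>(c, d). mul A (bas d) (S' c)) (sw (comul A (bas b))) = ?u (bas b)" for b
    using left_convolution_inverse_exists[where m = "\<lambda>x d. mul A (bas d) x" and e = e and deg = deg
        and D = "\<lambda>b. sw (comul A (bas b))" and t = "\<lambda>b. ?u (bas b)"] algebraD(4)[OF alg] l deg_less
    unfolding unit lookup_sw in_keys_iff by blast
  have left: "convolution A A (lin_ext S) id x = ?u x" for x
  proof (rule lin_eqI[OF lin_convolution[OF coalg] lin_u])
    fix b
    have "mul_tensor A (tensor_map (lin_ext S) id z) = lin_ext (\<lambda>(c, d). mul A (S c) (bas d)) z" for z
      by (rule lin_eqI) (auto intro!: lin_comp[OF lin_mul_tensor] lin_tensor_map lin_lin_ext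
          simp: mul_tensor_tensor[OF alg])
    then show "convolution A A (lin_ext S) id (bas b) = ?u (bas b)"
      by (simp add: convolution_def S)
  qed
  have right: "convolution A A id (lin_ext S') x = ?u x" for x
  proof (rule lin_eqI[OF lin_convolution[OF coalg] lin_u])
    fix b
    have "mul_tensor A (tensor_map id (lin_ext S') z)
        = lin_ext (\<lambda>(c, d). mul A (bas d) (S' c)) (sw z)" for z
      unfolding sw_def
      by (rule lin_eqI) (auto intro!: lin_comp[OF lin_mul_tensor] lin_comp[OF lin_lin_ext] lin_tensor_map lin_lin_ext
          simp: mul_tensor_tensor[OF alg])
    then show "convolution A A id (lin_ext S') (bas b) = ?u (bas b)"
      by (simp add: convolution_def S')
  qed
  have "lin_ext S x = lin_ext S' x" for x
    by (rule convolution_inverse_unique[OF coalg alg lin_lin_ext lin_id(1) lin_lin_ext left right])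
  then have "lin_ext S = lin_ext S'"
    by auto
  then have "is_antipode A (lin_ext S)"
    using left right by (simp add: is_antipode_convolution lin_lin_ext)
  then show ?thesis
    by blast
qed

section \<open>Transfer of bialgebra axioms along a surjection\<close>

lemma lin_tensor_square_mul: "lin (\<lambda>x. tensor_square_mul A x y)" "lin (tensor_square_mul A x)"
  unfolding tensor_square_mul_def by (rule lin_bilin_ext_left lin_bilin_ext_right)+

lemma tensor_square_mul_tensor:
  assumes "is_algebra A"
  shows "tensor_square_mul A (tensor p q) (tensor r s) = tensor (mul A p r) (mul A q s)"
proof -
  note alg = algebraD[OF assms]
  have 1: "tensor_square_mul A (bas (a, b)) (tensor r s) = tensor (mul A (bas a) r) (mul A (bas b) s)"
    for a b
    by (rule lin_eqI2[where f = "\<lambda>r s. tensor_square_mul A (bas (a, b)) (tensor r s)"])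
      (auto simp: tensor_square_mul_def intro!: lin_comp[OF lin_bilin_ext_right] lin_tensor
        lin_comp[OF lin_tensor(1) alg(2)] lin_comp[OF lin_tensor(2) alg(2)])
  show ?thesis
    by (rule lin_eqI2[where f = "\<lambda>p q. tensor_square_mul A (tensor p q) (tensor r s)"])
      (auto simp: 1 intro!: lin_comp[OF lin_tensor_square_mul(1)] lin_tensor
        lin_comp[OF lin_tensor(1) alg(1)] lin_comp[OF lin_tensor(2) alg(1)])
qed

lemma tensor_square_mul_bas:
  "tensor_square_mul A (bas (a, b)) (bas (c, d)) = tensor (mul A (bas a) (bas c)) (mul A (bas b) (bas d))"
  by (simp add: tensor_square_mul_def)

text \<open>Every element of \<open>B\<close> is an image under \<open>f\<close>, and on images the
  two sides of an axiom for \<open>B\<close> are the images of the two sides of the same axiom for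
  \<open>A\<close>. Only linearity of the structure maps of \<open>B\<close> has to be known
  beforehand.\<close>

lemma bialgebra_transfer:
  assumes A: "is_bialgebra A" and f: "lin f" and surj: "surj f"
    and mul: "\<And>x y. f (mul A x y) = mul B (f x) (f y)" and unit: "f (unit A) = unit B"
    and comul: "\<And>x. comul B (f x) = tensor_map f f (comul A x)"
    and counit: "\<And>x. counit B (f x) = counit A x"
    and lin_mul: "\<And>y. lin (\<lambda>x. mul B x y)" "\<And>x. lin (mul B x)"
    and lin_comul: "lin (comul B)" and lin_counit: "Vector_Spaces.linear scale (*) (counit B)"
  shows "is_bialgebra B"
proof -
  have alg: "is_algebra A" and coalg: "is_coalgebra A"
    using A by (auto simp: is_bialgebra_def)
  have ex: "\<exists>x. y = f x" for y
    using surj by (rule surjD)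
  have algB: "is_algebra B"
    unfolding is_algebra_def
  proof (intro conjI allI lin_mul)
    fix x y z
    obtain x' y' z' where "x = f x'" "y = f y'" "z = f z'"
      using ex by meson
    then show "mul B (mul B x y) z = mul B x (mul B y z)"
      "mul B (unit B) x = x" "mul B x (unit B) = x"
      by (simp_all add: mul[symmetric] unit[symmetric] algebraD[OF alg])
  qed
  \<comment> \<open>Applying the counit of \<open>B\<close> to the left factor commutes with
    \<open>f\<close>; this carries the left counit law over, and \<open>c2\<close> does the same on
    the right.\<close>
  have c1: "lin_ext (\<lambda>(a, b). scale (counit B (bas a)) (bas b)) (tensor_map f f z)
      = f (lin_ext (\<lambda>(a, b). scale (counit A (bas a)) (bas b)) z)" for z
  proof (rule lin_eqI[where x = z])
    have 1: "lin_ext (\<lambda>(a, b). scale (counit B (bas a)) (bas b)) (tensor x y) = scale (counit B x) y" for x y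
      by (rule lin_eqI2[where f = "\<lambda>x y. lin_ext (\<lambda>(a, b). scale (counit B (bas a)) (bas b)) (tensor x y)"])
        (auto intro!: lin_comp[OF lin_lin_ext] lin_tensor lin_scale lin_scale_left[OF lin_counit])
    show "lin_ext (\<lambda>(a, b). scale (counit B (bas a)) (bas b)) (tensor_map f f (bas p))
      = f (lin_ext (\<lambda>(a, b). scale (counit A (bas a)) (bas b)) (bas p))" for p
      by (cases p) (simp add: 1 counit linD[OF f])
  qed (auto intro!: lin_comp[OF lin_lin_ext] lin_comp[OF f] lin_tensor_map lin_lin_ext)
  have c2: "lin_ext (\<lambda>(a, b). scale (counit B (bas b)) (bas a)) (tensor_map f f z)
      = f (lin_ext (\<lambda>(a, b). scale (counit A (bas b)) (bas a)) z)" for z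
  proof (rule lin_eqI[where x = z])
    have 1: "lin_ext (\<lambda>(a, b). scale (counit B (bas b)) (bas a)) (tensor x y) = scale (counit B y) x" for x y
      by (rule lin_eqI2[where f = "\<lambda>x y. lin_ext (\<lambda>(a, b). scale (counit B (bas b)) (bas a)) (tensor x y)"])
        (auto intro!: lin_comp[OF lin_lin_ext] lin_tensor lin_scale lin_scale_left[OF lin_counit])
    show "lin_ext (\<lambda>(a, b). scale (counit B (bas b)) (bas a)) (tensor_map f f (bas p))
      = f (lin_ext (\<lambda>(a, b). scale (counit A (bas b)) (bas a)) (bas p))" for p
      by (cases p) (simp add: 1 counit linD[OF f])
  qed (auto intro!: lin_comp[OF lin_lin_ext] lin_comp[OF f] lin_tensor_map lin_lin_ext)
  have coalgB: "is_coalgebra B"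
    unfolding is_coalgebra_def
  proof (intro conjI allI lin_comul lin_counit)
    fix x
    obtain y where y: "x = f y"
      using ex by meson
    have "tensor_map (comul B) id (comul B x)
        = tensor_map (\<lambda>x. tensor_map f f (comul A x)) f (comul A y)"
      by (simp add: y comul tensor_map_comp lin_comul f lin_id)
    also have "\<dots> = tensor_map (tensor_map f f) f (tensor_map (comul A) id (comul A y))"
      by (simp add: tensor_map_comp lin_tensor_map coalgebraD(1)[OF coalg] f lin_id)
    finally have "tensor_assoc (tensor_map (comul B) id (comul B x))
        = tensor_map f (tensor_map f f) (tensor_map id (comul A) (comul A y))"
      by (simp add: tensor_assoc_tensor_map f coalgebraD(3)[OF coalg])
    also have "\<dots> = tensor_map f (\<lambda>x. tensor_map f f (comul A x)) (comul A y)"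
      by (simp add: tensor_map_comp lin_tensor_map coalgebraD(1)[OF coalg] f lin_id)
    also have "\<dots> = tensor_map id (comul B) (comul B x)"
      by (simp add: y comul tensor_map_comp lin_comul f lin_id)
    finally show "tensor_assoc (tensor_map (comul B) id (comul B x)) = tensor_map id (comul B) (comul B x)" .
    show "lin_ext (\<lambda>(a, b). scale (counit B (bas a)) (bas b)) (comul B x) = x"
      by (simp add: y comul c1 coalgebraD(4)[OF coalg])
    show "lin_ext (\<lambda>(a, b). scale (counit B (bas b)) (bas a)) (comul B x) = x"
      by (simp add: y comul c2 coalgebraD(5)[OF coalg])
  qed
  have sq: "tensor_map f f (tensor_square_mul A z z')
      = tensor_square_mul B (tensor_map f f z) (tensor_map f f z')" for z z'
    by (rule lin_eqI2[where f = "\<lambda>z z'. tensor_map f f (tensor_square_mul A z z')"])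
      (auto intro!: lin_comp[OF lin_tensor_map] lin_tensor_square_mul
        lin_comp[OF lin_tensor_square_mul(1) lin_tensor_map] lin_comp[OF lin_tensor_square_mul(2) lin_tensor_map]
        simp: tensor_square_mul_tensor[OF algB] tensor_square_mul_bas tensor_map_tensor f mul)
  show ?thesis
    unfolding is_bialgebra_def
  proof (intro conjI allI algB coalgB)
    fix x y
    obtain x' y' where "x = f x'" "y = f y'"
      using ex by meson
    then show "comul B (mul B x y) = tensor_square_mul B (comul B x) (comul B y)"
      "counit B (mul B x y) = counit B x * counit B y"
      using A by (simp_all add: mul[symmetric] comul counit sq[symmetric] is_bialgebra_def)
    show "comul B (unit B) = tensor (unit B) (unit B)" "counit B (unit B) = 1"
      using A by (simp_all add: unit[symmetric] comul counit is_bialgebra_def tensor_map_tensor f)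
  qed
qed


section \<open>Finite topologies as quasi-orders\<close>

lemma top_le_trans: "top_le T x y \<Longrightarrow> top_le T y z \<Longrightarrow> top_le T x z"
  by (auto simp: top_le_def)

lemma top_le_refl: "top_le T x x \<longleftrightarrow> x \<in> topspace T"
  by (auto simp: top_le_def)

lemma top_leD: "top_le T x y \<Longrightarrow> x \<in> topspace T" "top_le T x y \<Longrightarrow> y \<in> topspace T"
  by (auto simp: top_le_def)

text \<open>Finiteness makes the intersection of all open sets containing \<open>x\<close> open;
  this intersection is the principal final segment of \<open>x\<close>, and every final segment is a
  union of such sets.\<close>

lemma openin_iff_final_segment:
  assumes "finite (topspace T)"
  shows "openin T U \<longleftrightarrow> U \<subseteq> topspace T \<and> (\<forall>x\<in>U. \<forall>y. top_le T x y \<longrightarrow> y \<in> U)"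
proof
  assume "openin T U"
  then show "U \<subseteq> topspace T \<and> (\<forall>x\<in>U. \<forall>y. top_le T x y \<longrightarrow> y \<in> U)"
    using openin_subset[of T U] by (auto simp: top_le_def)
next
  assume U: "U \<subseteq> topspace T \<and> (\<forall>x\<in>U. \<forall>y. top_le T x y \<longrightarrow> y \<in> U)"
  have "openin T {y. top_le T x y}" if "x \<in> topspace T" for x
  proof -
    have "finite {V. openin T V \<and> x \<in> V}"
      by (rule finite_subset[of _ "Pow (topspace T)"]) (use assms openin_subset in auto)
    then have "openin T (\<Inter>{V. openin T V \<and> x \<in> V})"
      using that by (intro openin_Inter) auto
    moreover have "\<Inter>{V. openin T V \<and> x \<in> V} = {y. top_le T x y}"
      using that by (auto simp: top_le_def)
    ultimately show ?thesis
      by simp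
  qed
  then have "openin T (\<Union>x\<in>U. {y. top_le T x y})"
    using U by blast
  moreover have "(\<Union>x\<in>U. {y. top_le T x y}) = U"
    using U top_le_refl[of T] by blast
  ultimately show "openin T U"
    by simp
qed

lemma topology_eqI_top_le:
  assumes "finite (topspace T)" "topspace T' = topspace T" "\<And>x y. top_le T x y \<longleftrightarrow> top_le T' x y"
  shows "T = T'"
  using assms by (simp add: topology_eq openin_iff_final_segment)

lemma top_le_subtopology: "top_le (subtopology T Y) x y \<longleftrightarrow> x \<in> Y \<and> y \<in> Y \<and> top_le T x y"
  unfolding top_le_def openin_subtopology by auto

definition preorder_on_set :: "'a set \<Rightarrow> ('a \<Rightarrow> 'a \<Rightarrow> bool) \<Rightarrow> bool" where
  "preorder_on_set E R \<longleftrightarrow> (\<forall>x\<in>E. R x x) \<and> (\<forall>x\<in>E. \<forall>y\<in>E. \<forall>z\<in>E. R x y \<longrightarrow> R y z \<longrightarrow> R x z)"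

lemma preorder_on_subset: "preorder_on_set E R \<Longrightarrow> F \<subseteq> E \<Longrightarrow> preorder_on_set F R"
  unfolding preorder_on_set_def by blast

lemma preorder_on_top_le: "preorder_on_set (topspace T) (top_le T)"
  by (auto simp: preorder_on_set_def top_le_refl intro: top_le_trans)

text \<open>The principal final segment of \<open>x\<close> is open by transitivity and contains
  \<open>x\<close> by reflexivity, so it tests the relation exactly.\<close>

lemma top_le_top_of_order:
  assumes "preorder_on_set X R"
  shows "top_le (top_of_order X R) x y \<longleftrightarrow> x \<in> X \<and> y \<in> X \<and> R x y"
proof
  assume "top_le (top_of_order X R) x y"
  moreover from this have "x \<in> X" "y \<in> X"
    by (auto simp: top_le_def topspace_top_of_order)
  moreover have "openin (top_of_order X R) {y \<in> X. R x y}"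
    using assms \<open>x \<in> X\<close> unfolding openin_top_of_order preorder_on_set_def by blast
  moreover have "x \<in> {y \<in> X. R x y}"
    using assms \<open>x \<in> X\<close> by (auto simp: preorder_on_set_def)
  ultimately show "x \<in> X \<and> y \<in> X \<and> R x y"
    unfolding top_le_def by blast
next
  assume "x \<in> X \<and> y \<in> X \<and> R x y"
  then show "top_le (top_of_order X R) x y"
    by (auto simp: top_le_def topspace_top_of_order openin_top_of_order)
qed

lemma top_le_std_top:
  assumes "finite (topspace T)" "x \<in> topspace T" "y \<in> topspace T"
  shows "top_le (std_top T) (std_rank (topspace T) x) (std_rank (topspace T) y) \<longleftrightarrow> top_le T x y"
proof -
  have mem: "std_rank (topspace T) z \<in> std_rank (topspace T) ` V \<longleftrightarrow> z \<in> V"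
    if "openin T V" "z \<in> topspace T" for z V
    by (rule inj_on_image_mem_iff[OF std_rank_inj_on[OF assms(1)] that(2) openin_subset[OF that(1)]])
  have "std_rank (topspace T) z \<in> {1..card (topspace T)}" if "z \<in> topspace T" for z
    using that std_rank_image[OF assms(1)] by blast
  then have "top_le (std_top T) (std_rank (topspace T) x) (std_rank (topspace T) y) \<longleftrightarrow>
      (\<forall>V. openin T V \<longrightarrow> std_rank (topspace T) x \<in> std_rank (topspace T) ` V
        \<longrightarrow> std_rank (topspace T) y \<in> std_rank (topspace T) ` V)"
    unfolding top_le_def topspace_std_top[OF assms(1)] openin_std_top[OF assms(1)]
    using assms(2,3) by blast
  also have "\<dots> \<longleftrightarrow> top_le T x y"
    unfolding top_le_def using mem assms(2,3) by blast
  finally show ?thesis .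
qed

text \<open>Ranks depend on the order type alone; invariance of both standardization and packing
  under increasing relabelling rests on this.\<close>

lemma std_rank_strict_mono_image:
  assumes "strict_mono_on E h" "x \<in> E"
  shows "std_rank (h ` E) (h x) = std_rank E x"
proof -
  have "{e \<in> h ` E. e \<le> h x} = h ` {e \<in> E. e \<le> x}"
    using assms by (auto simp: strict_mono_on_less_eq)
  moreover have "inj_on h {e \<in> E. e \<le> x}"
    using strict_mono_on_imp_inj_on[OF assms(1)] by (rule inj_on_subset) auto
  ultimately show ?thesis
    by (simp add: std_rank_def card_image)
qed

lemma std_rank_strict_mono_on: "finite E \<Longrightarrow> strict_mono_on E (std_rank E)"
  by (auto simp: strict_mono_on_def intro: std_rank_strict_mono)

lemma std_rank_initial_segment: "x \<in> {1..n} \<Longrightarrow> std_rank {1..n} x = x" for x n :: nat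
proof -
  assume "x \<in> {1..n}"
  then have "{e \<in> {1..n}. e \<le> x} = {1..x}"
    by auto
  then show ?thesis
    by (simp add: std_rank_def)
qed

section \<open>Standardized quasi-orders on arbitrary finite carriers\<close>

abbreviation tle :: "fin_top \<Rightarrow> nat \<Rightarrow> nat \<Rightarrow> bool" where
  "tle T \<equiv> top_le (top_of T)"

lemma topspace_top_of: "topspace (top_of T) = {1..size_top T}"
proof -
  obtain n where "topspace (top_of T) = {1..n}"
    using top_of[of T] by auto
  then show ?thesis
    by (simp add: size_top.rep_eq)
qed

lemma fin_top_eqI:
  assumes "size_top T = size_top T'" "\<And>x y. tle T x y \<longleftrightarrow> tle T' x y"
  shows "T = T'"
proof -
  have "top_of T = top_of T'"
    by (rule topology_eqI_top_le) (simp_all add: topspace_top_of assms)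
  then show ?thesis
    by (simp add: top_of_inject)
qed

lemma tle_mem: "tle T x y \<Longrightarrow> 1 \<le> x \<and> x \<le> size_top T \<and> 1 \<le> y \<and> y \<le> size_top T"
  using top_leD[of "top_of T" x y] by (simp add: topspace_top_of)

lemma preorder_on_tle: "preorder_on_set {1..size_top T} (tle T)"
  using preorder_on_top_le[of "top_of T"] by (simp add: topspace_top_of)

text \<open>Presents a basis topology by a quasi-order on any finite set of numbers. Restricting to
  a subset then keeps the relation \<open>R\<close> and only shrinks the carrier, so that iterated
  restrictions need no renumbering.\<close>

definition std_order :: "nat set \<Rightarrow> (nat \<Rightarrow> nat \<Rightarrow> bool) \<Rightarrow> fin_top" where
  "std_order E R = Abs_fin_top (std_top (top_of_order E R))"

lemma top_of_std_order: "finite E \<Longrightarrow> top_of (std_order E R) = std_top (top_of_order E R)"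
  unfolding std_order_def
  by (rule Abs_fin_top_inverse) (auto simp: topspace_std_top topspace_top_of_order)

lemma size_std_order [simp]: "finite E \<Longrightarrow> size_top (std_order E R) = card E"
  by (simp add: size_top.rep_eq top_of_std_order topspace_std_top topspace_top_of_order)

lemma tle_std_order:
  assumes "finite E" "preorder_on_set E R" "x \<in> E" "y \<in> E"
  shows "tle (std_order E R) (std_rank E x) (std_rank E y) \<longleftrightarrow> R x y"
  using top_le_std_top[of "top_of_order E R" x y] assms
  by (simp add: top_of_std_order topspace_top_of_order top_le_top_of_order)

lemma eq_std_orderI:
  assumes "finite E" "preorder_on_set E R" "size_top T = card E"
    and "\<And>x y. x \<in> E \<Longrightarrow> y \<in> E \<Longrightarrow> tle T (std_rank E x) (std_rank E y) \<longleftrightarrow> R x y"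
  shows "T = std_order E R"
proof (rule fin_top_eqI)
  fix i j
  show "tle T i j \<longleftrightarrow> tle (std_order E R) i j"
  proof (cases "i \<in> {1..card E} \<and> j \<in> {1..card E}")
    case True
    then obtain x y where "x \<in> E" "y \<in> E" "i = std_rank E x" "j = std_rank E y"
      unfolding std_rank_image[OF assms(1), symmetric] by blast
    then show ?thesis
      using assms tle_std_order by simp
  next
    case False
    then show ?thesis
      using tle_mem[of T i j] tle_mem[of "std_order E R" i j] assms by auto
  qed
qed (simp add: assms)

text \<open>Only the order type of the carrier counts: an increasing relabelling \<open>h\<close>
  preserves ranks and therefore the standardized topology.\<close>

lemma std_order_reindex:
  assumes "finite E" "preorder_on_set E R" "strict_mono_on E h"
    and R: "\<And>x y. x \<in> E \<Longrightarrow> y \<in> E \<Longrightarrow> R x y \<longleftrightarrow> R' (h x) (h y)"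
  shows "std_order (h ` E) R' = std_order E R"
proof (rule eq_std_orderI)
  have pre: "preorder_on_set (h ` E) R'"
    using assms(2) R unfolding preorder_on_set_def by fastforce
  show "size_top (std_order (h ` E) R') = card E"
    using assms by (simp add: card_image strict_mono_on_imp_inj_on)
  fix x y assume "x \<in> E" "y \<in> E"
  then show "tle (std_order (h ` E) R') (std_rank E x) (std_rank E y) \<longleftrightarrow> R x y"
    using assms tle_std_order[OF _ pre, of "h x" "h y"] by (simp add: std_rank_strict_mono_image)
qed (use assms in auto)

lemma std_order_fin_top: "std_order {1..size_top T} (tle T) = T"
  by (rule eq_std_orderI[symmetric]) (simp_all add: preorder_on_tle std_rank_initial_segment del: One_nat_def)

lemma std_order_cong:
  assumes "finite E" "preorder_on_set E R" "\<And>x y. x \<in> E \<Longrightarrow> y \<in> E \<Longrightarrow> R x y \<longleftrightarrow> R' x y"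
  shows "std_order E R' = std_order E R"
  using std_order_reindex[of E R "\<lambda>x. x" R'] assms by (simp add: strict_mono_on_def)

lemma std_restrict_eq_std_order:
  assumes "Y \<subseteq> {1..size_top T}"
  shows "std_restrict T Y = std_order Y (tle T)"
proof -
  have pre: "preorder_on_set Y (tle T)"
    by (rule preorder_on_subset[OF preorder_on_tle assms])
  have Y: "{1..size_top T} \<inter> Y = Y"
    using assms by auto
  have "subtopology (top_of T) Y = top_of_order Y (tle T)"
    by (rule topology_eqI_top_le)
      (simp_all add: topspace_top_of topspace_top_of_order Y top_le_subtopology top_le_top_of_order[OF pre]
        finite_subset[OF assms] del: One_nat_def)
  then have "top_of (std_restrict T Y) = top_of (std_order Y (tle T))"
    using finite_subset[OF assms finite_atLeastAtMost] by (simp add: top_of_std_order std_restrict.rep_eq)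
  then show ?thesis
    by (simp add: top_of_inject)
qed

section \<open>The coproduct through final segments of a carrier\<close>

definition upset :: "'a set \<Rightarrow> ('a \<Rightarrow> 'a \<Rightarrow> bool) \<Rightarrow> 'a set \<Rightarrow> bool" where
  "upset E R Y \<longleftrightarrow> Y \<subseteq> E \<and> (\<forall>x\<in>Y. \<forall>y\<in>E. R x y \<longrightarrow> y \<in> Y)"

lemma finite_upsets: "finite E \<Longrightarrow> finite {Y. upset E R Y}"
  by (rule finite_subset[of _ "Pow E"]) (auto simp: upset_def)

text \<open>Open sets of the standardization are the rank images of the final segments of
  \<open>E\<close>, and standardizing such an image gives the same topology as standardizing the
  segment itself. Hence all summands can be written with the original \<open>R\<close>.\<close>

lemma HT_coproduct_std_order:
  assumes "finite E" "preorder_on_set E R"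
  shows "HT_coproduct (bas (std_order E R))
    = (\<Sum>Y\<in>{Y. upset E R Y}. bas (std_order (E - Y) R, std_order Y R))"
proof -
  let ?r = "std_rank E"
  have inj: "inj_on ?r E"
    by (rule std_rank_inj_on[OF assms(1)])
  have restr: "std_restrict (std_order E R) (?r ` Y) = std_order Y R" if "Y \<subseteq> E" for Y
  proof -
    have "?r ` Y \<subseteq> {1..size_top (std_order E R)}"
      using that assms std_rank_image[OF assms(1)] by auto
    then have "std_restrict (std_order E R) (?r ` Y) = std_order (?r ` Y) (tle (std_order E R))"
      by (rule std_restrict_eq_std_order)
    also have "\<dots> = std_order Y R"
    proof (rule std_order_reindex)
      show "strict_mono_on Y ?r"
        using std_rank_strict_mono_on[OF assms(1)] that by (auto simp: strict_mono_on_def)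
      show "R x y \<longleftrightarrow> tle (std_order E R) (?r x) (?r y)" if "x \<in> Y" "y \<in> Y" for x y
        using assms that \<open>Y \<subseteq> E\<close> by (subst tle_std_order) auto
    qed (use assms that finite_subset preorder_on_subset in blast)+
    finally show ?thesis .
  qed
  have opens: "{Y. openin (top_of (std_order E R)) Y} = (`) ?r ` {Y. upset E R Y}"
    using assms by (auto simp: top_of_std_order openin_std_top topspace_top_of_order
        openin_top_of_order upset_def)
  have compl: "{1..size_top (std_order E R)} - ?r ` Y = ?r ` (E - Y)" if "Y \<subseteq> E" for Y
    using that assms inj_on_image_set_diff[OF inj, of E Y]
    by (simp add: std_rank_image[OF assms(1)] del: One_nat_def)
  have "inj_on ((`) ?r) {Y. upset E R Y}"
    using inj by (auto simp: inj_on_def upset_def inj_on_image_eq_iff[OF inj])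
  then have "HT_coproduct (bas (std_order E R)) = (\<Sum>Y\<in>{Y. upset E R Y}.
      bas (std_restrict (std_order E R) ({1..size_top (std_order E R)} - ?r ` Y),
        std_restrict (std_order E R) (?r ` Y)))"
    by (simp add: HT_coproduct_def opens sum.reindex)
  also have "\<dots> = (\<Sum>Y\<in>{Y. upset E R Y}. bas (std_order (E - Y) R, std_order Y R))"
    by (rule sum.cong) (auto simp: upset_def compl restr simp del: size_std_order One_nat_def)
  finally show ?thesis .
qed

section \<open>The product as a disjoint union of quasi-orders\<close>

lemma size_prod_top [simp]: "size_top (prod_top T T') = size_top T + size_top T'"
  using topspace_shift_prod_top[OF topspace_top_of topspace_top_of, of T T']
  by (simp add: size_top.rep_eq prod_top.rep_eq)

text \<open>Open sets of the product with one of the two components empty show that no relation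
  leaves its block, and that inside a block the relation is that of the factor.\<close>

lemma tle_prod_top:
  "tle (prod_top T T') x y \<longleftrightarrow> tle T x y \<or>
    size_top T < x \<and> size_top T < y \<and> tle T' (x - size_top T) (y - size_top T)"
  (is "?L \<longleftrightarrow> ?R")
proof -
  let ?n = "size_top T"
  have op: "openin (top_of (prod_top T T')) U \<longleftrightarrow> (\<exists>Y Y'. openin (top_of T) Y \<and>
      openin (top_of T') Y' \<and> U = Y \<union> (\<lambda>i. i + ?n) ` Y')" for U
    by (simp add: prod_top.rep_eq openin_shift_prod_top[OF topspace_top_of topspace_top_of])
  have sp: "topspace (top_of (prod_top T T')) = {1..?n + size_top T'}"
    by (simp add: topspace_top_of)
  have sub: "Y \<subseteq> {1..?n}" if "openin (top_of T) Y" for Y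
    using openin_subset[OF that] by (simp add: topspace_top_of)
  have sub': "Y \<subseteq> {1..size_top T'}" if "openin (top_of T') Y" for Y
    using openin_subset[OF that] by (simp add: topspace_top_of)
  show ?thesis
  proof
    assume L: ?L
    have x: "1 \<le> x" "x \<le> ?n + size_top T'"
      using L tle_mem[of "prod_top T T'" x y] by auto
    have all: "y \<in> Y \<union> (\<lambda>i. i + ?n) ` Y'"
      if "openin (top_of T) Y" "openin (top_of T') Y'" "x \<in> Y \<union> (\<lambda>i. i + ?n) ` Y'" for Y Y'
      using L that unfolding top_le_def op by blast
    show ?R
    proof (cases "x \<le> ?n")
      case True
      have "y \<in> Y" if "openin (top_of T) Y" "x \<in> Y" for Y
        using all[of Y "{}"] that by auto
      moreover have "x \<in> topspace (top_of T)"
        using True x by (simp add: topspace_top_of)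
      ultimately show ?thesis
        unfolding top_le_def by blast
    next
      case False
      then have xs: "x - ?n \<in> topspace (top_of T')"
        using x by (auto simp: topspace_top_of)
      have *: "y - ?n \<in> Y \<and> ?n < y" if "openin (top_of T') Y" "x - ?n \<in> Y" for Y
      proof -
        have "y \<in> {} \<union> (\<lambda>i. i + ?n) ` Y"
          using that False by (intro all) (auto simp: image_iff intro!: bexI[of _ "x - ?n"])
        then show ?thesis
          using sub'[OF that(1)] by auto
      qed
      then show ?thesis
        using False xs *[OF openin_topspace] unfolding top_le_def by auto
    qed
  next
    assume R: ?R
    then have "x \<in> {1..?n + size_top T'}" "y \<in> {1..?n + size_top T'}"
      using tle_mem[of T x y] tle_mem[of T' "x - ?n" "y - ?n"] by auto
    moreover have "y \<in> Y \<union> (\<lambda>i. i + ?n) ` Y'"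
      if "openin (top_of T) Y" "openin (top_of T') Y'" "x \<in> Y \<union> (\<lambda>i. i + ?n) ` Y'" for Y Y'
    proof (cases "x \<le> ?n")
      case True
      then show ?thesis
        using that R sub'[OF that(2)] by (fastforce simp: top_le_def)
    next
      case False
      then have "x - ?n \<in> Y'"
        using that sub[OF that(1)] by auto
      moreover have "?n < y" "tle T' (x - ?n) (y - ?n)"
        using R False tle_mem[of T x y] by auto
      ultimately have "y - ?n \<in> Y'" "y = y - ?n + ?n"
        using that by (auto simp: top_le_def)
      then show ?thesis
        by blast
    qed
    ultimately show ?L
      unfolding top_le_def op sp by blast
  qed
qed

lemma size_empty_top [simp]: "size_top empty_top = 0"
  by (simp add: size_top.rep_eq empty_top.rep_eq)

lemma size_top_0_iff: "size_top T = 0 \<longleftrightarrow> T = empty_top"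
proof
  assume "size_top T = 0"
  then show "T = empty_top"
    by (intro fin_top_eqI) (auto dest: tle_mem)
qed simp

lemma std_order_empty_iff: "finite E \<Longrightarrow> std_order E R = empty_top \<longleftrightarrow> E = {}"
  by (simp add: size_top_0_iff[symmetric])

lemma prod_top_assoc: "prod_top (prod_top T T') T'' = prod_top T (prod_top T' T'')"
proof (rule fin_top_eqI)
  fix x y
  show "tle (prod_top (prod_top T T') T'') x y \<longleftrightarrow> tle (prod_top T (prod_top T' T'')) x y"
    using tle_mem[of T' "x - size_top T" "y - size_top T"]
    by (auto simp: tle_prod_top)
qed simp

lemma prod_top_empty: "prod_top empty_top T = T" "prod_top T empty_top = T"
proof -
  have "\<not> tle empty_top x y" for x y
    using tle_mem[of empty_top x y] by auto
  then show "prod_top empty_top T = T" "prod_top T empty_top = T"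
    using tle_mem[of T] by (auto intro!: fin_top_eqI simp: tle_prod_top Suc_le_eq)
qed

text \<open>Puts both factors of a product on one carrier with one relation: \<open>E\<close> comes
  first and nothing relates it to \<open>F\<close>. The condition passes to subsets, as
  multiplicativity of the coproduct requires.\<close>

definition separated :: "nat set \<Rightarrow> nat set \<Rightarrow> (nat \<Rightarrow> nat \<Rightarrow> bool) \<Rightarrow> bool" where
  "separated E F R \<longleftrightarrow> finite E \<and> finite F \<and> preorder_on_set (E \<union> F) R \<and>
    (\<forall>x\<in>E. \<forall>y\<in>F. x < y \<and> \<not> R x y \<and> \<not> R y x)"

lemma separated_subset: "separated E F R \<Longrightarrow> E' \<subseteq> E \<Longrightarrow> F' \<subseteq> F \<Longrightarrow> separated E' F' R"
  unfolding separated_def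
  by (meson Un_mono finite_subset preorder_on_subset subset_iff)

text \<open>In the union, ranks on \<open>E\<close> are unchanged and ranks on \<open>F\<close> are
  raised by \<open>card E\<close>, which is the shift in the definition of the product.\<close>

lemma prod_top_std_order:
  assumes sep: "separated E F R"
  shows "prod_top (std_order E R) (std_order F R) = std_order (E \<union> F) R"
proof (rule eq_std_orderI)
  have fin: "finite E" "finite F" and disj: "E \<inter> F = {}"
    and pre: "preorder_on_set E R" "preorder_on_set F R" "preorder_on_set (E \<union> F) R"
    using sep by (auto simp: separated_def intro: preorder_on_subset)
  show "finite (E \<union> F)" "preorder_on_set (E \<union> F) R"
    using fin pre by auto
  show "size_top (prod_top (std_order E R) (std_order F R)) = card (E \<union> F)"
    using fin disj by (simp add: card_Un_disjoint)
  have rE: "std_rank (E \<union> F) x = std_rank E x" if "x \<in> E" for x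
  proof -
    have "{e \<in> E \<union> F. e \<le> x} = {e \<in> E. e \<le> x}"
      using sep that by (force simp: separated_def)
    then show ?thesis
      by (simp add: std_rank_def)
  qed
  have rF: "std_rank (E \<union> F) x = card E + std_rank F x" if "x \<in> F" for x
  proof -
    have "{e \<in> E \<union> F. e \<le> x} = E \<union> {e \<in> F. e \<le> x}"
      using sep that by (force simp: separated_def)
    moreover have "card (E \<union> {e \<in> F. e \<le> x}) = card E + card {e \<in> F. e \<le> x}"
      using fin disj by (intro card_Un_disjoint) auto
    ultimately show ?thesis
      by (simp add: std_rank_def)
  qed
  have posE: "std_rank E x \<le> card E" if "x \<in> E" for x
    using that std_rank_image[OF fin(1)] by fastforce
  have posF: "0 < std_rank F x" if "x \<in> F" for x
    using that std_rank_image[OF fin(2)] by fastforce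
  fix x y assume xy: "x \<in> E \<union> F" "y \<in> E \<union> F"
  show "tle (prod_top (std_order E R) (std_order F R)) (std_rank (E \<union> F) x) (std_rank (E \<union> F) y) \<longleftrightarrow> R x y"
  proof (cases "x \<in> E"; cases "y \<in> E")
    assume "x \<in> E" "y \<in> E"
    then show ?thesis
      using fin posE[of x] by (simp add: tle_prod_top rE tle_std_order pre)
  next
    assume h: "x \<in> E" "y \<notin> E"
    then have "\<not> R x y" "y \<in> F"
      using sep xy by (auto simp: separated_def)
    then show ?thesis
      using h fin posE[of x] posF[of y] tle_mem[of "std_order E R" "std_rank E x" "card E + std_rank F y"]
      by (auto simp: tle_prod_top rE rF)
  next
    assume h: "x \<notin> E" "y \<in> E"
    then have "\<not> R x y" "x \<in> F"
      using sep xy by (auto simp: separated_def)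
    then show ?thesis
      using h fin posE[of y] posF[of x] tle_mem[of "std_order E R" "card E + std_rank F x" "std_rank E y"]
      by (auto simp: tle_prod_top rE rF)
  next
    assume h: "x \<notin> E" "y \<notin> E"
    then have "x \<in> F" "y \<in> F"
      using xy by auto
    then show ?thesis
      using h fin posF[of x] posF[of y]
        tle_mem[of "std_order E R" "card E + std_rank F x" "card E + std_rank F y"]
      by (auto simp: tle_prod_top rF tle_std_order pre)
  qed
qed

text \<open>The quasi-order of the product, cut at \<open>size_top T\<close>, presents both factors
  at once.\<close>

lemma separated_representatives:
  obtains E F R where "separated E F R" "T = std_order E R" "T' = std_order F R"
    "E = {1..size_top T}" "F = {size_top T + 1..size_top T + size_top T'}"
    "R = tle (prod_top T T')"
proof -
  let ?n = "size_top T" and ?R = "tle (prod_top T T')"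
  let ?F = "{?n + 1..?n + size_top T'}"
  have pre: "preorder_on_set ({1..?n} \<union> ?F) ?R"
    by (rule preorder_on_subset[OF preorder_on_tle]) auto
  have "separated {1..?n} ?F ?R"
    using pre by (auto simp: separated_def tle_prod_top dest: tle_mem)
  moreover have "std_order {1..?n} ?R = std_order {1..?n} (tle T)"
    by (rule std_order_cong) (auto simp: preorder_on_tle tle_prod_top simp del: One_nat_def)
  moreover have "std_order ((\<lambda>i. i + ?n) ` {1..size_top T'}) ?R = std_order {1..size_top T'} (tle T')"
    by (rule std_order_reindex)
      (auto simp: preorder_on_tle tle_prod_top strict_mono_on_def simp del: One_nat_def dest: tle_mem)
  moreover have "(\<lambda>i. i + ?n) ` {1..size_top T'} = ?F"
    by (simp add: image_add_atLeastAtMost' add.commute del: One_nat_def)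
  ultimately show ?thesis
    by (intro that[of "{1..?n}" ?F ?R]) (simp_all only: std_order_fin_top)
qed

section \<open>The Hopf algebra of finite topologies\<close>

lemma HT_simps:
  "mul HT = bilin_ext (\<lambda>T T'. bas (prod_top T T'))" "unit HT = bas empty_top"
  "comul HT = HT_coproduct" "counit HT = (\<lambda>x. Poly_Mapping.lookup x empty_top)"
  by (simp_all add: HT_def)

lemma linear_lookup: "Vector_Spaces.linear scale (*) (\<lambda>x :: 'a \<Rightarrow>\<^sub>0 'k::field. Poly_Mapping.lookup x a)"
  unfolding linear_iff_module_hom module_hom_def module_hom_axioms_def
  using vector_space_scale[where ?'b = 'a and ?'k = 'k]
  by (auto simp: module_iff_vector_space lookup_add) (unfold_locales, simp_all add: algebra_simps)

lemma lin_HT_coproduct: "lin HT_coproduct"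
  unfolding HT_coproduct_def by (rule lin_lin_ext)

lemma HT_algebra: "is_algebra (HT :: (fin_top, 'k::field) hopf_data)"
proof -
  let ?m = "bilin_ext (\<lambda>T T'. bas (prod_top T T')) :: (fin_top \<Rightarrow>\<^sub>0 'k) \<Rightarrow> _"
  have assoc: "?m (?m x y) z = ?m x (?m y z)" for x y z
  proof -
    have "?m (?m x y) (bas c) = ?m x (?m y (bas c))" for c
      by (rule lin_eqI2[where f = "\<lambda>x y. ?m (?m x y) (bas c)"])
        (auto simp: prod_top_assoc intro!: lin_comp[OF lin_bilin_ext_left lin_bilin_ext_left]
          lin_comp[OF lin_bilin_ext_left lin_bilin_ext_right] lin_bilin_ext_left
          lin_comp[OF lin_bilin_ext_right lin_bilin_ext_left])
    then show ?thesis
      by (rule lin_eqI[where x = z, rotated 2])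
        (auto intro!: lin_bilin_ext_right lin_comp[OF lin_bilin_ext_right lin_bilin_ext_right])
  qed
  have "?m (bas empty_top) x = x" "?m x (bas empty_top) = x" for x
    by (rule lin_eqI[OF lin_bilin_ext_right lin_id(2)] lin_eqI[OF lin_bilin_ext_left lin_id(2)],
        simp add: prod_top_empty)+
  then show ?thesis
    by (simp add: is_algebra_def HT_simps assoc lin_bilin_ext_left lin_bilin_ext_right)
qed

text \<open>Both sides run over chains of two open sets. Splitting the left factor again gives an
  open \<open>Y\<close> and a set \<open>Z\<close> open in the rest, that is the chain from
  \<open>Y\<close> to \<open>Y \<union> Z\<close>; splitting the right factor gives a
  \<open>Z\<close> open in \<open>Y\<close>.\<close>

lemma HT_coassoc:
  "tensor_assoc (tensor_map HT_coproduct id (HT_coproduct x)) = tensor_map id HT_coproduct (HT_coproduct x)"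
proof (rule lin_eqI[where x = x])
  fix T
  define E R where ER: "E = {1..size_top T}" "R = tle T"
  have T: "T = std_order E R"
    by (simp only: ER std_order_fin_top)
  have fin: "finite E" and pre: "preorder_on_set E R"
    unfolding ER by (simp_all add: preorder_on_tle del: One_nat_def)
  have sub: "finite Y" "preorder_on_set Y R" if "Y \<subseteq> E" for Y
    using that fin pre finite_subset preorder_on_subset by blast+
  let ?P = "Sigma {Y. upset E R Y} (\<lambda>Y. {Z. upset (E - Y) R Z})"
  let ?Q = "Sigma {Y. upset E R Y} (\<lambda>Y. {Z. upset Y R Z})"
  have "tensor_assoc (tensor_map HT_coproduct id (HT_coproduct (bas T)))
      = (\<Sum>Y\<in>{Y. upset E R Y}. \<Sum>Z\<in>{Z. upset (E - Y) R Z}.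
          bas (std_order (E - Y - Z) R, std_order Z R, std_order Y R))"
    by (simp add: T HT_coproduct_std_order[OF fin pre] HT_coproduct_std_order[OF sub]
        linD(5)[OF lin_tensor_map] linD(5)[OF lin_tensor_assoc] tensor_sum_left)
  also have "\<dots> = (\<Sum>(Y, Z)\<in>?P. bas (std_order (E - Y - Z) R, std_order Z R, std_order Y R))"
    by (rule sum.Sigma) (auto simp: finite_upsets fin)
  also have "\<dots> = (\<Sum>(Y, Z)\<in>?Q. bas (std_order (E - Y) R, std_order (Y - Z) R, std_order Z R))"
  proof (rule sum.reindex_bij_witness[where i = "\<lambda>(Y, Z). (Z, Y - Z)" and j = "\<lambda>(Y, Z). (Y \<union> Z, Y)"],
      goal_cases)
    case (1 a)
    then show ?case by (auto simp: upset_def)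
  next
    case (2 a)
    then show ?case by (auto simp: upset_def)
  next
    case (3 a)
    then show ?case by (auto simp: upset_def)
  next
    case (4 a)
    then show ?case by (auto simp: upset_def)
  next
    case (5 a)
    obtain Y Z where a: "a = (Y, Z)" "upset E R Y" "upset (E - Y) R Z"
      using 5 by auto
    then have "(Y \<union> Z) - Y = Z" "E - (Y \<union> Z) = E - Y - Z"
      by (auto simp: upset_def)
    then show ?case
      by (simp add: a)
  qed
  also have "\<dots> = (\<Sum>Y\<in>{Y. upset E R Y}. \<Sum>Z\<in>{Z. upset Y R Z}.
          bas (std_order (E - Y) R, std_order (Y - Z) R, std_order Z R))"
    by (rule sum.Sigma[symmetric]) (auto intro!: finite_upsets fin sub simp: upset_def)
  also have "\<dots> = (\<Sum>Y\<in>{Y. upset E R Y}. tensor (bas (std_order (E - Y) R)) (HT_coproduct (bas (std_order Y R))))"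
    by (rule sum.cong) (auto simp: upset_def HT_coproduct_std_order[OF sub] tensor_sum_right)
  also have "\<dots> = tensor_map id HT_coproduct (HT_coproduct (bas T))"
    by (simp add: T HT_coproduct_std_order[OF fin pre] linD(5)[OF lin_tensor_map])
  finally show "tensor_assoc (tensor_map HT_coproduct id (HT_coproduct (bas T)))
      = tensor_map id HT_coproduct (HT_coproduct (bas T))" .
qed (auto intro!: lin_comp[OF lin_tensor_assoc] lin_comp[OF lin_tensor_map lin_HT_coproduct])

text \<open>For the counit laws, only the term with an empty left factor (\<open>Y = E\<close>) or
  an empty right factor (\<open>Y = {}\<close>) survives.\<close>

lemma HT_coalgebra: "is_coalgebra (HT :: (fin_top, 'k::field) hopf_data)"
proof -
  have c: "lin_ext (\<lambda>(a, b). scale (Poly_Mapping.lookup (bas a) empty_top) (bas b)) (HT_coproduct x) = x"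
    "lin_ext (\<lambda>(a, b). scale (Poly_Mapping.lookup (bas b) empty_top) (bas a)) (HT_coproduct x) = x"
    for x :: "fin_top \<Rightarrow>\<^sub>0 'k"
  proof -
    have "lin_ext (\<lambda>(a, b). scale (Poly_Mapping.lookup (bas a) empty_top) (bas b)) (HT_coproduct (bas T)) = (bas T :: fin_top \<Rightarrow>\<^sub>0 'k)
      \<and> lin_ext (\<lambda>(a, b). scale (Poly_Mapping.lookup (bas b) empty_top) (bas a)) (HT_coproduct (bas T)) = (bas T :: fin_top \<Rightarrow>\<^sub>0 'k)"
      for T
    proof -
      define E R where ER: "E = {1..size_top T}" "R = tle T"
      have T: "T = std_order E R"
        by (simp only: ER std_order_fin_top)
      have fin: "finite E" and pre: "preorder_on_set E R"
        unfolding ER by (simp_all add: preorder_on_tle del: One_nat_def)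
      have 1: "lin_ext (\<lambda>(a, b). scale (Poly_Mapping.lookup (bas a) empty_top) (bas b)) (HT_coproduct (bas T))
          = (\<Sum>Y\<in>{Y. upset E R Y}. if Y = E then bas T else 0 :: fin_top \<Rightarrow>\<^sub>0 'k)"
        unfolding T HT_coproduct_std_order[OF fin pre] linD(5)[OF lin_lin_ext]
        by (rule sum.cong) (use fin in \<open>auto simp: upset_def lookup_bas std_order_empty_iff\<close>)
      have 2: "lin_ext (\<lambda>(a, b). scale (Poly_Mapping.lookup (bas b) empty_top) (bas a)) (HT_coproduct (bas T))
          = (\<Sum>Y\<in>{Y. upset E R Y}. if Y = {} then bas T else 0 :: fin_top \<Rightarrow>\<^sub>0 'k)"
        unfolding T HT_coproduct_std_order[OF fin pre] linD(5)[OF lin_lin_ext]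
        by (rule sum.cong)
          (auto simp: upset_def lookup_bas std_order_empty_iff finite_subset[OF _ fin])
      have "upset E R E" "upset E R {}"
        by (auto simp: upset_def)
      then show ?thesis
        unfolding 1 2 using finite_upsets[OF fin] by (simp add: sum.delta')
    qed
    then show "lin_ext (\<lambda>(a, b). scale (Poly_Mapping.lookup (bas a) empty_top) (bas b)) (HT_coproduct x) = x"
      "lin_ext (\<lambda>(a, b). scale (Poly_Mapping.lookup (bas b) empty_top) (bas a)) (HT_coproduct x) = x"
      by (auto intro!: lin_eqI[where x = x and g = "\<lambda>x. x"] lin_comp[OF lin_lin_ext lin_HT_coproduct] lin_id)
  qed
  show ?thesis
    by (simp add: is_coalgebra_def HT_simps lin_HT_coproduct linear_lookup HT_coassoc c)
qed

text \<open>As no relation joins \<open>E\<close> and \<open>F\<close>, the final segments of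
  \<open>E \<union> F\<close> are exactly the unions of a final segment of \<open>E\<close> and one
  of \<open>F\<close>, and each term of the coproduct of the product factors accordingly.\<close>

lemma HT_bialgebra: "is_bialgebra (HT :: (fin_top, 'k::field) hopf_data)"
proof -
  let ?m = "bilin_ext (\<lambda>T T'. bas (prod_top T T')) :: (fin_top \<Rightarrow>\<^sub>0 'k) \<Rightarrow> _"
  have comul: "HT_coproduct (?m x y) = tensor_square_mul HT (HT_coproduct x) (HT_coproduct y)" for x y
  proof (rule lin_eqI2[where f = "\<lambda>x y. HT_coproduct (?m x y)"])
    fix T T'
    obtain E F R where sep: "separated E F R" and T: "T = std_order E R" "T' = std_order F R"
      by (rule separated_representatives)
    have fin: "finite E" "finite F" and pre: "preorder_on_set E R" "preorder_on_set F R"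
      and preEF: "preorder_on_set (E \<union> F) R" and disj: "E \<inter> F = {}"
      using sep by (auto simp: separated_def intro: preorder_on_subset)
    have "tensor_square_mul HT (HT_coproduct (bas T)) (HT_coproduct (bas T'))
        = (\<Sum>Y\<in>{Y. upset E R Y}. \<Sum>Z\<in>{Z. upset F R Z}.
           (bas (prod_top (std_order (E - Y) R) (std_order (F - Z) R),
             prod_top (std_order Y R) (std_order Z R)) :: _ \<Rightarrow>\<^sub>0 'k))"
      by (simp add: T HT_coproduct_std_order fin pre linD(5)[OF lin_tensor_square_mul(1)]
          linD(5)[OF lin_tensor_square_mul(2)] tensor_square_mul_bas HT_simps)
        (rule sum.swap)
    also have "\<dots> = (\<Sum>Y\<in>{Y. upset E R Y}. \<Sum>Z\<in>{Z. upset F R Z}.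
           bas (std_order (E \<union> F - (Y \<union> Z)) R, std_order (Y \<union> Z) R))"
    proof (intro sum.cong refl)
      fix Y Z assume "Y \<in> {Y. upset E R Y}" "Z \<in> {Z. upset F R Z}"
      then have YZ: "Y \<subseteq> E" "Z \<subseteq> F"
        by (auto simp: upset_def)
      then have "E \<union> F - (Y \<union> Z) = (E - Y) \<union> (F - Z)"
        using disj by auto
      then show "(bas (prod_top (std_order (E - Y) R) (std_order (F - Z) R), prod_top (std_order Y R) (std_order Z R)) :: _ \<Rightarrow>\<^sub>0 'k)
          = bas (std_order (E \<union> F - (Y \<union> Z)) R, std_order (Y \<union> Z) R)"
        using YZ by (simp add: prod_top_std_order separated_subset[OF sep])
    qed
    also have "\<dots> = (\<Sum>(Y, Z)\<in>{Y. upset E R Y} \<times> {Z. upset F R Z}.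
           bas (std_order (E \<union> F - (Y \<union> Z)) R, std_order (Y \<union> Z) R))"
      by (rule sum.cartesian_product)
    also have "\<dots> = (\<Sum>Y\<in>{Y. upset (E \<union> F) R Y}. bas (std_order (E \<union> F - Y) R, std_order Y R))"
    proof (rule sum.reindex_bij_witness[where i = "\<lambda>Y. (Y \<inter> E, Y \<inter> F)" and j = "\<lambda>(Y, Z). Y \<union> Z"], goal_cases)
      case (1 a)
      then show ?case using disj by (auto simp: upset_def)
    next
      case (2 a)
      then show ?case using sep by (auto simp: upset_def separated_def)
    next
      case (3 b)
      then show ?case by (auto simp: upset_def)
    next
      case (4 b)
      then show ?case by (auto simp: upset_def)
    next
      case (5 a)
      then show ?case by (auto split: prod.splits)
    qed
    also have "\<dots> = HT_coproduct (?m (bas T) (bas T'))"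
      using fin preEF by (simp add: T prod_top_std_order[OF sep] HT_coproduct_std_order)
    finally show "HT_coproduct (?m (bas T) (bas T'))
        = tensor_square_mul HT (HT_coproduct (bas T)) (HT_coproduct (bas T'))" ..
  qed (auto intro!: lin_comp[OF lin_HT_coproduct] lin_bilin_ext_left lin_bilin_ext_right
      lin_comp[OF lin_tensor_square_mul(1) lin_HT_coproduct] lin_comp[OF lin_tensor_square_mul(2) lin_HT_coproduct])
  have counit: "Poly_Mapping.lookup (?m x y) empty_top
      = Poly_Mapping.lookup x empty_top * Poly_Mapping.lookup y empty_top" for x y
  proof -
    \<comment> \<open>The scalar identity is moved into the one-dimensional space with basis
      \<open>()\<close>, where \<open>lin_eqI2\<close> applies; the coordinate at \<open>()\<close>
      brings it back.\<close>
    have "scale (Poly_Mapping.lookup (?m x y) empty_top) (bas ())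
        = scale (Poly_Mapping.lookup x empty_top) (scale (Poly_Mapping.lookup y empty_top) (bas ()))"
      by (rule lin_eqI2[where f = "\<lambda>x y. scale (Poly_Mapping.lookup (?m x y) empty_top) (bas ())"])
        (auto intro!: lin_comp[OF lin_scale_left[OF linear_lookup]] lin_bilin_ext_left lin_bilin_ext_right
          lin_scale_left[OF linear_lookup] lin_comp[OF lin_scale]
          simp: lookup_bas size_top_0_iff[symmetric])
    then have "Poly_Mapping.lookup (scale (Poly_Mapping.lookup (?m x y) empty_top) (bas ())) ()
        = Poly_Mapping.lookup (scale (Poly_Mapping.lookup x empty_top) (scale (Poly_Mapping.lookup y empty_top) (bas ()))) ()"
      by simp
    then show ?thesis
      by (simp add: lookup_bas)
  qed
  \<comment> \<open>The empty topology is presented on the empty carrier, so that the general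
    coproduct formula also covers the unit.\<close>
  have "std_order {} (\<lambda>_ _. False) = empty_top"
    by (simp add: size_top_0_iff[symmetric])
  moreover have "HT_coproduct (bas (std_order {} (\<lambda>_ _. False)))
      = (bas (std_order {} (\<lambda>_ _. False), std_order {} (\<lambda>_ _. False)) :: _ \<Rightarrow>\<^sub>0 'k)"
  proof -
    have "{Y. upset {} (\<lambda>_ _. False) Y} = {{} :: nat set}"
      by (auto simp: upset_def)
    then show ?thesis
      by (subst HT_coproduct_std_order) (auto simp: preorder_on_set_def)
  qed
  ultimately have "HT_coproduct (bas empty_top) = (tensor (bas empty_top) (bas empty_top) :: _ \<Rightarrow>\<^sub>0 'k)"
    by simp
  then show ?thesis
    using HT_algebra HT_coalgebra comul counit by (simp add: is_bialgebra_def HT_simps lookup_bas)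
qed

text \<open>Only an inclusion, because repeated basis vectors can cancel in positive
  characteristic.\<close>

lemma keys_sum_bas:
  fixes f :: "'i \<Rightarrow> 'b"
  shows "Poly_Mapping.keys (\<Sum>i\<in>I. bas (f i) :: 'b \<Rightarrow>\<^sub>0 'c::field) \<subseteq> f ` I"
proof -
  have "Poly_Mapping.keys (\<Sum>i\<in>I. bas (f i) :: 'b \<Rightarrow>\<^sub>0 'c) \<subseteq> (\<Union>i\<in>I. Poly_Mapping.keys (bas (f i) :: 'b \<Rightarrow>\<^sub>0 'c))"
    by (rule Poly_Mapping.keys_sum)
  then show ?thesis
    by (auto simp: bas_def)
qed

lemma HT_hopf: "is_hopf_algebra (HT :: (fin_top, 'k::field) hopf_data)"
proof -
  have "\<exists>S. is_antipode (HT :: (fin_top, 'k) hopf_data) S"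
  proof (rule connected_graded_antipode_exists[OF HT_bialgebra, where e = empty_top and deg = size_top])
    fix T T1 T2
    assume "(T1, T2) \<in> Poly_Mapping.keys (comul HT (bas T) :: _ \<Rightarrow>\<^sub>0 'k)"
    moreover define E R where ER: "E = {1..size_top T}" "R = tle T"
    have T: "T = std_order E R"
      by (simp only: ER std_order_fin_top)
    have fin: "finite E" and pre: "preorder_on_set E R"
      unfolding ER by (simp_all add: preorder_on_tle del: One_nat_def)
    ultimately obtain Y where Y: "Y \<subseteq> E" "T1 = std_order (E - Y) R" "T2 = std_order Y R"
      using keys_sum_bas[of "\<lambda>Y. (std_order (E - Y) R, std_order Y R)" "{Y. upset E R Y}"]
      by (auto simp: HT_simps T HT_coproduct_std_order[OF fin pre] upset_def)
    then have "finite Y"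
      using fin finite_subset by blast
    then show "size_top T1 + size_top T2 = size_top T"
      using Y fin by (simp add: T card_Diff_subset card_mono)
  qed (auto simp: HT_simps size_top_0_iff lookup_bas)
  then show ?thesis
    by (simp add: is_hopf_algebra_def HT_bialgebra)
qed


section \<open>Packing and order patterns\<close>

lemma letters_Abs: "packed w \<Longrightarrow> letters (Abs_packed_word w) = w"
  by (rule Abs_packed_word_inverse) simp

lemma packed_letters: "packed (letters w)"
  using letters[of w] by simp

lemma set_packed: "packed w \<Longrightarrow> set w = {1..wmax w}"
  by (simp add: packed_def)

lemma wmax_eqI: "set w = {1..m} \<Longrightarrow> wmax w = m"
  unfolding wmax_def by (rule Max_eqI) auto

lemma wmax_card: "packed w \<Longrightarrow> wmax w = card (set w)"
  by (simp add: packed_def)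

lemma wmax_pack: "wmax (pack v) = card (set v)"
  by (rule wmax_eqI) (simp only: pack_def set_map std_rank_image[OF finite_set])

lemma length_pack [simp]: "length (pack v) = length v"
  by (simp add: pack_def)

lemma pack_packed: "packed w \<Longrightarrow> pack w = w"
  unfolding pack_def
  by (rule map_idI) (auto simp: set_packed std_rank_initial_segment simp del: One_nat_def)

lemma std_rank_less_iff:
  assumes "finite A" "x \<in> A" "y \<in> A"
  shows "std_rank A x < std_rank A y \<longleftrightarrow> x < y" "std_rank A x = std_rank A y \<longleftrightarrow> x = y"
  using std_rank_strict_mono[OF assms(1,3), of x] std_rank_strict_mono[OF assms(1,2), of y]
  by (cases x y rule: linorder_cases; force)+

lemma sorted_list_of_set_set: "sorted_wrt (<) s \<Longrightarrow> sorted_list_of_set (set s) = s"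
  for s :: "'a::linorder list"
  by (simp add: sorted_list_of_set.idem_if_sorted_distinct strict_sorted_iff)

text \<open>The entries of \<open>s\<close> not exceeding the one at position \<open>i\<close> are
  exactly the first \<open>i\<close>; positions count from 1.\<close>

lemma std_rank_letter:
  assumes "sorted_wrt (<) s" "i \<in> {1..length s}"
  shows "std_rank (set s) (letter s i) = i"
proof -
  have le: "s ! j \<le> s ! (i - 1) \<longleftrightarrow> j < i" if "j < length s" for j
  proof
    assume "j < i"
    then show "s ! j \<le> s ! (i - 1)"
      using assms(2) sorted_wrt_nth_less[OF assms(1), of j "i - 1"]
      by (cases "j = i - 1") fastforce+
  next
    assume h: "s ! j \<le> s ! (i - 1)"
    show "j < i"
    proof (rule ccontr)
      assume "\<not> j < i"
      then have "s ! (i - 1) < s ! j"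
        using assms(2) that by (intro sorted_wrt_nth_less[OF assms(1)]) auto
      then show False
        using h by simp
    qed
  qed
  have "{e \<in> set s. e \<le> letter s i} = (!) s ` {..<i}"
  proof (intro equalityI subsetI)
    fix e assume "e \<in> {e \<in> set s. e \<le> letter s i}"
    then show "e \<in> (!) s ` {..<i}"
      using le by (auto simp: letter_def in_set_conv_nth)
  next
    fix e assume "e \<in> (!) s ` {..<i}"
    then obtain j where "j < i" "e = s ! j"
      by auto
    moreover from this have "j < length s"
      using assms(2) by auto
    ultimately show "e \<in> {e \<in> set s. e \<le> letter s i}"
      using le by (simp add: letter_def)
  qed
  moreover have "inj_on ((!) s) {..<i}"
    using assms by (auto intro!: inj_on_nth simp: strict_sorted_iff)
  ultimately show ?thesis
    by (simp add: std_rank_def card_image)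
qed

lemma set_map_letter:
  assumes "set u = {1..length s}"
  shows "set (map (letter s) u) = set s"
proof -
  have "{1..length s} = Suc ` {..<length s}"
    by (simp add: image_Suc_lessThan)
  then have "letter s ` {1..length s} = set s"
    by (auto simp: letter_def image_image set_conv_nth)
  then show ?thesis
    by (simp only: set_map assms)
qed

lemma pack_map_letter:
  assumes "sorted_wrt (<) s" "set u = {1..length s}"
  shows "pack (map (letter s) u) = u"
  unfolding pack_def set_map_letter[OF assms(2)] map_map
  by (rule map_idI) (use assms std_rank_letter[OF assms(1)] in \<open>auto simp del: One_nat_def\<close>)

lemma letter_sorted_list_of_set:
  assumes "finite A" "x \<in> A"
  shows "letter (sorted_list_of_set A) (std_rank A x) = x"
proof -
  have "x \<in> set (sorted_list_of_set A)"
    using assms by simp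
  then obtain k where k: "k < length (sorted_list_of_set A)" "x = sorted_list_of_set A ! k"
    by (metis in_set_conv_nth)
  have "std_rank (set (sorted_list_of_set A)) (letter (sorted_list_of_set A) (Suc k)) = Suc k"
    by (rule std_rank_letter) (use assms k in auto)
  then show ?thesis
    using k assms by (simp add: letter_def)
qed

text \<open>With \<open>pack_map_letter\<close>, this shows that a word amounts to its packing
  together with its set of letters. The reindexings by quasi-shuffles below are inverted through
  this correspondence.\<close>

lemma map_letter_pack: "map (letter (sorted_list_of_set (set v))) (pack v) = v"
  unfolding pack_def map_map by (rule map_idI) (simp add: letter_sorted_list_of_set)

lemma pack_map_strict_mono: "strict_mono_on (set v) h \<Longrightarrow> pack (map h v) = pack v"
  by (simp add: pack_def std_rank_strict_mono_image)

text \<open>The assumptions say that \<open>v'\<close> arises from \<open>v\<close> by an increasing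
  relabelling of letters, and packing forgets such relabellings.\<close>

lemma pack_eq_of_pattern:
  assumes len: "length v = length v'"
    and less: "\<And>i j. i < length v \<Longrightarrow> j < length v \<Longrightarrow> v ! i < v ! j \<Longrightarrow> v' ! i < v' ! j"
    and eq: "\<And>i j. i < length v \<Longrightarrow> j < length v \<Longrightarrow> v ! i = v ! j \<Longrightarrow> v' ! i = v' ! j"
  shows "pack v = pack v'"
proof -
  \<comment> \<open>Any position carrying the letter \<open>a\<close> serves, since equal letters of
    \<open>v\<close> sit over equal letters of \<open>v'\<close>.\<close>
  define h where "h a = v' ! (SOME i. i < length v \<and> v ! i = a)" for a
  have h: "h (v ! i) = v' ! i" if "i < length v" for i
  proof -
    have "\<exists>j. j < length v \<and> v ! j = v ! i"
      using that by blast
    from someI_ex[OF this] show ?thesis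
      unfolding h_def using eq that by blast
  qed
  have "v' = map h v"
    by (rule nth_equalityI) (auto simp: len h)
  moreover have "strict_mono_on (set v) h"
    using less h by (auto simp: strict_mono_on_def in_set_conv_nth)
  ultimately show ?thesis
    by (simp add: pack_map_strict_mono)
qed

text \<open>A packed word has as many distinct letters as its maximum, so its letters are bounded by
  its length.\<close>

lemma finite_packed_words_of_length: "finite {w. length (letters w) = n}"
proof -
  have "set (letters w) \<subseteq> {1..length (letters w)}" for w
    using set_packed[OF packed_letters[of w]] wmax_card[OF packed_letters[of w]] card_length[of "letters w"]
    by (metis atLeastatMost_subset_iff order_refl)
  then have "letters ` {w. length (letters w) = n} \<subseteq> {xs. set xs \<subseteq> {1..n} \<and> length xs = n}"
    by auto
  then have "finite (letters ` {w. length (letters w) = n})"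
    by (rule finite_subset) (rule finite_lists_length_eq, simp)
  then show ?thesis
    by (rule finite_imageD) (simp add: inj_on_def letters_inject)
qed

section \<open>Product and internal coproduct of packed words through packing\<close>

lemma QSh_two:
  "w \<in> QSh [p, q] \<longleftrightarrow> length w = p + q \<and> packed w \<and> sorted_wrt (<) (take p w) \<and> sorted_wrt (<) (drop p w)"
  by (auto simp: QSh_def less_Suc_eq numeral_2_eq_2)

lemma letter_take: "a \<in> {1..p} \<Longrightarrow> letter (take p w) a = letter w a"
  by (auto simp: letter_def)

lemma letter_drop: "a \<in> {1..q} \<Longrightarrow> length w = p + q \<Longrightarrow> letter (drop p w) a = letter w (a + p)"
  by (auto simp: letter_def nth_drop add.commute)

lemma word_comp_shifted_concat:
  assumes "packed u" "packed v" "length w = wmax u + wmax v"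
  shows "word_comp w (shifted_concat u v)
    = map (letter (take (wmax u) w)) u @ map (letter (drop (wmax u) w)) v"
proof -
  have "letter w a = letter (take (wmax u) w) a" if "a \<in> set u" for a
    using that set_packed[OF assms(1)] by (simp only: letter_take)
  moreover have "letter w (a + wmax u) = letter (drop (wmax u) w) a" if "a \<in> set v" for a
    using that set_packed[OF assms(2)] by (simp only: letter_drop[OF _ assms(3)])
  ultimately show ?thesis
    by (simp add: word_comp_def shifted_concat_def)
qed

lemma WQSym_simps:
  "mul WQSym = bilin_ext (\<lambda>u v. \<Sum>w\<in>QSh [wmax (letters u), wmax (letters v)].
     Mbas (word_comp w (shifted_concat (letters u) (letters v))))"
  "unit WQSym = Mbas []" "comul WQSym = WQSym_coproduct"
  "counit WQSym = (\<lambda>x. Poly_Mapping.lookup x (Abs_packed_word []))"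
  by (simp_all add: WQSym_def)

text \<open>A quasi-shuffle \<open>w\<close> lists in increasing order the letters substituted into
  \<open>u\<close>, then those substituted into \<open>v\<close>. It is recovered from the resulting
  word \<open>x\<close> by sorting the letter sets of the prefix and of the suffix, while packing
  these two pieces recovers \<open>u\<close> and \<open>v\<close>.\<close>

lemma WQSym_mul_bas:
  "mul WQSym (bas u) (bas v) = (\<Sum>x\<in>{x. pack (take (length (letters u)) (letters x)) = letters u \<and>
     pack (drop (length (letters u)) (letters x)) = letters v}. bas x)"
proof -
  let ?u = "letters u" and ?v = "letters v" and ?n = "length (letters u)"
  let ?p = "wmax ?u" and ?q = "wmax ?v"
  have u: "set ?u = {1..?p}" "packed ?u" and v: "set ?v = {1..?q}" "packed ?v"
    using set_packed packed_letters by blast+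
  have "mul WQSym (bas u) (bas v) = (\<Sum>w\<in>QSh [?p, ?q]. bas (Abs_packed_word (word_comp w (shifted_concat ?u ?v))))"
    by (simp add: WQSym_simps Mbas_def)
  also have "\<dots> = (\<Sum>x\<in>{x. pack (take ?n (letters x)) = ?u \<and> pack (drop ?n (letters x)) = ?v}. bas x)"
  proof (rule sum.reindex_bij_witness[where
        i = "\<lambda>x. sorted_list_of_set (set (take ?n (letters x))) @ sorted_list_of_set (set (drop ?n (letters x)))"
        and j = "\<lambda>w. Abs_packed_word (word_comp w (shifted_concat ?u ?v))"])
    fix w assume w: "w \<in> QSh [?p, ?q]"
    then have len: "length w = ?p + ?q" and srt: "sorted_wrt (<) (take ?p w)" "sorted_wrt (<) (drop ?p w)"
      by (auto simp: QSh_two)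
    let ?x = "Abs_packed_word (word_comp w (shifted_concat ?u ?v))"
    have x: "letters ?x = map (letter (take ?p w)) ?u @ map (letter (drop ?p w)) ?v"
      using letters_Abs[OF packed_product_term[OF u(2) v(2) w]]
      by (simp add: word_comp_shifted_concat[OF u(2) v(2) len])
    have su: "set ?u = {1..length (take ?p w)}" and sv: "set ?v = {1..length (drop ?p w)}"
      using u v len by auto
    show "sorted_list_of_set (set (take ?n (letters ?x))) @ sorted_list_of_set (set (drop ?n (letters ?x))) = w"
      using set_map_letter[OF su] set_map_letter[OF sv]
      by (simp add: x sorted_list_of_set_set[OF srt(1)] sorted_list_of_set_set[OF srt(2)] del: set_map)
    show "?x \<in> {x. pack (take ?n (letters x)) = ?u \<and> pack (drop ?n (letters x)) = ?v}"
      by (simp add: x pack_map_letter[OF srt(1) su] pack_map_letter[OF srt(2) sv])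
  next
    fix x assume "x \<in> {x. pack (take ?n (letters x)) = ?u \<and> pack (drop ?n (letters x)) = ?v}"
    then have pu: "pack (take ?n (letters x)) = ?u" and pv: "pack (drop ?n (letters x)) = ?v"
      by auto
    let ?s = "sorted_list_of_set (set (take ?n (letters x)))"
    let ?t = "sorted_list_of_set (set (drop ?n (letters x)))"
    have len: "length ?s = ?p" "length ?t = ?q"
      using wmax_pack[of "take ?n (letters x)"] wmax_pack[of "drop ?n (letters x)"]
      by (simp_all add: pu pv)
    have "set (?s @ ?t) = set (letters x)"
      using set_append[of "take ?n (letters x)" "drop ?n (letters x)"] by (simp del: set_append add: set_append[of ?s ?t])
    then have "packed (?s @ ?t)"
      using set_packed[OF packed_letters[of x]] by (intro packedI[of _ "wmax (letters x)"]) simp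
    then show QSh: "?s @ ?t \<in> QSh [?p, ?q]"
      using len by (simp add: QSh_two)
    have "word_comp (?s @ ?t) (shifted_concat ?u ?v) = map (letter ?s) ?u @ map (letter ?t) ?v"
      using len by (subst word_comp_shifted_concat[OF u(2) v(2)]) simp_all
    also have "\<dots> = letters x"
      using map_letter_pack[of "take ?n (letters x)"] map_letter_pack[of "drop ?n (letters x)"]
      by (simp add: pu pv)
    finally show "Abs_packed_word (word_comp (?s @ ?t) (shifted_concat ?u ?v)) = x"
      by (simp add: letters_Abs letters_inject[symmetric] packed_letters)
  qed simp
  finally show ?thesis .
qed

section \<open>Block words of compositions and lexicographic comparison\<close>

text \<open>\<open>block_word\<close> in recursive form; the free starting letter \<open>c\<close>
  permits induction on the composition.\<close>

primrec block_from :: "nat \<Rightarrow> nat list \<Rightarrow> nat list" where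
  "block_from c [] = []"
| "block_from c (i # is) = replicate i c @ block_from (Suc c) is"

lemma block_word_eq_block_from: "block_word is = block_from 1 is"
proof -
  have "concat (map (\<lambda>j. replicate (is ! j) (j + c)) [0..<length is]) = block_from c is" for c
  proof (induction "is" arbitrary: c)
    case (Cons i "is")
    have "[0..<length (i # is)] = 0 # map Suc [0..<length is]"
      by (simp add: map_Suc_upt upt_conv_Cons del: upt_Suc)
    then have "concat (map (\<lambda>j. replicate ((i # is) ! j) (j + c)) [0..<length (i # is)])
        = replicate i c @ concat (map (\<lambda>j. replicate (is ! j) (j + Suc c)) [0..<length is])"
      by (simp add: o_def del: upt_Suc)
    then show ?case
      by (simp only: Cons block_from.simps)
  qed simp
  then show ?thesis
    by (simp add: block_word_def del: One_nat_def)
qed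

lemma length_block_from [simp]: "length (block_from c is) = sum_list is"
  by (induction "is" arbitrary: c) auto

lemma set_block_from: "set (block_from c is) \<subseteq> {c..<c + length is}"
proof (induction "is" arbitrary: c)
  case (Cons i "is")
  have "set (block_from c (i # is)) \<subseteq> {c} \<union> set (block_from (Suc c) is)"
    by auto
  then show ?case
    using Cons[of "Suc c"] by auto
qed simp

lemma sorted_block_from: "sorted (block_from c is)"
proof (induction "is" arbitrary: c)
  case (Cons i "is")
  have "\<forall>y\<in>set (block_from (Suc c) is). c \<le> y"
    using set_block_from[of "Suc c" "is"] by auto
  then show ?case
    using Cons by (auto simp: sorted_append)
qed simp

lemma count_block_from: "j < length is \<Longrightarrow> count (mset (block_from c is)) (c + j) = is ! j"
proof (induction "is" arbitrary: c j)
  case (Cons i "is")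
  show ?case
  proof (cases j)
    case 0
    have "c \<notin> set (block_from (Suc c) is)"
      using set_block_from[of "Suc c" "is"] by auto
    then have "count (mset (block_from (Suc c) is)) c = 0"
      by (simp add: not_in_iff[symmetric])
    then show ?thesis
      by (simp add: 0)
  next
    case (Suc k)
    then show ?thesis
      using Cons.IH[of k "Suc c"] Cons.prems by simp
  qed
qed simp

lemma set_block_word:
  assumes "0 \<notin> set is"
  shows "set (block_word is) = {1..length is}"
proof -
  have "x \<in> set (block_word is)" if "x \<in> {1..length is}" for x
  proof -
    have "count (mset (block_from 1 is)) (1 + (x - 1)) = is ! (x - 1)"
      by (rule count_block_from) (use that in auto)
    moreover have "is ! (x - 1) \<in> set is"
      using that by (intro nth_mem) auto
    ultimately have "count (mset (block_from 1 is)) x \<noteq> 0"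
      using assms that by (metis add.commute atLeastAtMost_iff le_add_diff_inverse2)
    then show ?thesis
      by (simp add: block_word_eq_block_from count_eq_zero_iff del: One_nat_def)
  qed
  then show ?thesis
    using set_block_from[of 1 "is"] by (auto simp: block_word_eq_block_from)
qed

text \<open>A weakly increasing word is determined by its multiplicities, so such words with letters
  \<open>{1..p}\<close> are the block words of compositions. Part number \<open>j\<close>, counted
  from 0, is the multiplicity of the letter \<open>Suc j\<close>.\<close>

lemma block_word_of_counts:
  assumes "sorted B" "set B = {1..p}"
  shows "block_word (map (\<lambda>j. count (mset B) (Suc j)) [0..<p]) = B"
proof -
  let ?is = "map (\<lambda>j. count (mset B) (Suc j)) [0..<p]"
  have "count (mset (block_from 1 ?is)) x = count (mset B) x" for x
  proof (cases "x \<in> {1..p}")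
    case True
    then show ?thesis
      using count_block_from[of "x - 1" ?is 1] by (simp add: less_diff_conv2 Suc_le_eq)
  next
    case False
    then have "x \<notin> set (block_from 1 ?is)" "x \<notin> set B"
      using set_block_from[of 1 ?is] assms by auto
    then show ?thesis
      by (metis count_eq_zero_iff set_mset_mset)
  qed
  then have "mset (block_from 1 ?is) = mset B"
    by (rule multiset_eqI)
  then show ?thesis
    unfolding block_word_eq_block_from
    by (metis assms(1) properties_for_sort sorted_block_from sorted_sort_id)
qed

text \<open>With the block number as first component, entries of different blocks already compare
  correctly, and inside a block the lexicographic order is the order of the entries of
  \<open>v\<close>.\<close>

lemma blocks_sorted_iff_zip_sorted:
  assumes "length v = sum_list is"
  shows "(\<forall>j<length is. sorted_wrt (<) (take (is ! j) (drop (sum_list (take j is)) v)))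
    \<longleftrightarrow> sorted_wrt (<) (zip (block_from c is) v)"
  using assms
proof (induction "is" arbitrary: c v)
  case (Cons i "is")
  have len: "length (drop i v) = sum_list is"
    using Cons.prems by simp
  have zip: "zip (block_from c (i # is)) v
      = map (Pair c) (take i v) @ zip (block_from (Suc c) is) (drop i v)"
  proof -
    have "zip (replicate i c @ block_from (Suc c) is) (take i v @ drop i v)
        = zip (replicate i c) (take i v) @ zip (block_from (Suc c) is) (drop i v)"
      using Cons.prems by (intro zip_append) simp
    moreover have "zip (replicate i c) (take i v) = map (Pair c) (take i v)"
      using Cons.prems by (simp add: zip_replicate1)
    ultimately show ?thesis
      by simp
  qed
  have cross: "x < y" if "x \<in> set (map (Pair c) (take i v))" "y \<in> set (zip (block_from (Suc c) is) (drop i v))" for x y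
  proof -
    have "fst y \<in> set (block_from (Suc c) is)"
      using that(2) by (metis in_set_zipE prod.collapse)
    then show ?thesis
      using that(1) set_block_from[of "Suc c" "is"] by (auto simp: less_prod_def')
  qed
  have pair: "sorted_wrt (<) (map (Pair c) (take i v)) \<longleftrightarrow> sorted_wrt (<) (take i v)"
    by (simp add: sorted_wrt_map less_prod_def')
  have "(\<forall>j<length (i # is). sorted_wrt (<) (take ((i # is) ! j) (drop (sum_list (take j (i # is))) v)))
      \<longleftrightarrow> sorted_wrt (<) (take i v) \<and>
        (\<forall>j<length is. sorted_wrt (<) (take (is ! j) (drop (sum_list (take j is)) (drop i v))))"
    by (auto simp: less_Suc_eq_0_disj add.commute)
  then show ?case
    unfolding zip sorted_wrt_append pair Cons.IH[OF len, of "Suc c"] using cross by auto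
qed simp

lemma QSh_iff_zip_sorted:
  "v \<in> QSh is \<longleftrightarrow> length v = sum_list is \<and> packed v \<and> sorted_wrt (<) (zip (block_word is) v)"
  unfolding QSh_def block_word_eq_block_from using blocks_sorted_iff_zip_sorted[of v "is" 1] by auto

lemma map_letter_zip:
  assumes "length s = length t" "set u \<subseteq> {1..length s}"
  shows "zip (map (letter s) u) (map (letter t) u) = map (letter (zip s t)) u"
proof -
  have "(letter s a, letter t a) = letter (zip s t) a" if "a \<in> set u" for a
    using assms that by (force simp: letter_def)
  then show ?thesis
    by (simp add: zip_map1 zip_map2 zip_same_conv_map)
qed

text \<open>Lexicographically, the blocks of \<open>b\<close> come first and the letters of \<open>a\<close> refine them.\<close>

lemma WQSym_internal_bas:
  "WQSym_internal (bas u) = (\<Sum>(a, b)\<in>{(a, b). length (letters a) = length (letters b) \<and>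
     pack (zip (letters b) (letters a)) = letters u}. bas (a, b))"
proof -
  let ?u = "letters u" and ?m = "wmax (letters u)"
  have u: "set ?u = {1..?m}" "packed ?u"
    using set_packed packed_letters by blast+
  let ?D = "Sigma (compositions ?m) QSh"
  let ?C = "{(a, b). length (letters a) = length (letters b) \<and> pack (zip (letters b) (letters a)) = ?u}"
  let ?j = "\<lambda>(is, v). (Abs_packed_word (word_comp v ?u), Abs_packed_word (word_comp (block_word is) ?u))"
  let ?s = "\<lambda>a b. sorted_list_of_set (set (zip (letters b) (letters a)))"
  \<comment> \<open>Sorting the pairs lexicographically gives the block word in the first
    components, whose multiplicities are the composition, and the quasi-shuffle in the second
    ones.\<close>
  let ?i = "\<lambda>(a, b). (map (\<lambda>j. count (mset (map fst (?s a b))) (Suc j)) [0..<wmax (letters b)], map snd (?s a b))"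
  have fin_comp: "finite (compositions ?m)"
  proof -
    have "is \<in> compositions ?m \<Longrightarrow> set is \<subseteq> {0..?m} \<and> length is \<le> ?m" for "is"
    proof -
      assume "is \<in> compositions ?m"
      then have c: "sum_list is = ?m" "0 \<notin> set is"
        by (auto simp: compositions_def)
      \<comment> \<open>Positivity of the parts bounds the number of parts by their sum.\<close>
      have "length is \<le> sum_list is" if "0 \<notin> set is" for "is" :: "nat list"
        using that by (induction "is") auto
      then show ?thesis
        using c member_le_sum_list[of _ "is"] by fastforce
    qed
    then have "compositions ?m \<subseteq> {is. set is \<subseteq> {0..?m} \<and> length is \<le> ?m}"
      by auto
    then show ?thesis
      by (rule finite_subset) (rule finite_lists_length_le, simp)
  qed
  have fin_QSh: "finite (QSh is)" for "is"
  proof -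
    have "QSh is \<subseteq> letters ` {w. length (letters w) = sum_list is}"
    proof
      fix w assume "w \<in> QSh is"
      then have "letters (Abs_packed_word w) = w" "length w = sum_list is"
        by (auto simp: QSh_def letters_Abs)
      then show "w \<in> letters ` {w. length (letters w) = sum_list is}"
        by (metis (mono_tags, lifting) imageI mem_Collect_eq)
    qed
    then show ?thesis
      using finite_subset finite_packed_words_of_length by blast
  qed
  have "WQSym_internal (bas u) = (\<Sum>is\<in>compositions ?m. \<Sum>v\<in>QSh is. bas (?j (is, v)))"
    by (simp add: WQSym_internal_def Mbas_def)
  also have "\<dots> = (\<Sum>x\<in>?D. bas (?j x))"
    by (subst sum.Sigma) (auto simp: fin_comp fin_QSh case_prod_unfold)
  also have "\<dots> = (\<Sum>x\<in>?C. bas x)"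
  proof (rule sum.reindex_bij_witness[where i = ?i and j = ?j])
    fix x assume "x \<in> ?D"
    then obtain "is" v where x: "x = (is, v)" and comp: "is \<in> compositions ?m" and v: "v \<in> QSh is"
      by auto
    let ?B = "block_word is"
    have lenB: "length ?B = ?m" and lenv: "length v = ?m"
      using comp v by (auto simp: compositions_def QSh_def block_word_eq_block_from)
    have srt: "sorted_wrt (<) (zip ?B v)"
      using v by (simp add: QSh_iff_zip_sorted)
    let ?a = "Abs_packed_word (word_comp v ?u)" and ?b = "Abs_packed_word (word_comp ?B ?u)"
    have a: "letters ?a = map (letter v) ?u" and b: "letters ?b = map (letter ?B) ?u"
      using packed_internal_terms[OF u(2) comp] v
      by (simp_all add: letters_Abs) (simp_all add: word_comp_def)
    have zip: "zip (letters ?b) (letters ?a) = map (letter (zip ?B v)) ?u"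
      unfolding a b by (rule map_letter_zip) (use u lenB lenv in auto)
    have su: "set ?u = {1..length (zip ?B v)}"
      using u lenB lenv by simp
    have s: "?s ?a ?b = zip ?B v"
      unfolding zip set_map_letter[OF su] by (rule sorted_list_of_set_set[OF srt])
    have "set (letters ?b) = {1..length is}"
      unfolding b using comp lenB u
      by (subst set_map_letter) (auto simp: set_block_word compositions_def simp del: One_nat_def)
    then have wb: "wmax (letters ?b) = length is"
      by (rule wmax_eqI)
    have "map (\<lambda>j. count (mset ?B) (Suc j)) [0..<length is] = is"
      by (rule nth_equalityI) (use count_block_from[of _ "is" 1] in \<open>auto simp: block_word_eq_block_from\<close>)
    then show "?i (?j x) = x"
      using lenB lenv by (simp add: x s wb flip: mset_map)
    show "?j x \<in> ?C"
      using pack_map_letter[OF srt su] zip by (simp add: x a b)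
  next
    fix x assume "x \<in> ?C"
    then obtain a b where x: "x = (a, b)" and len: "length (letters a) = length (letters b)"
      and p: "pack (zip (letters b) (letters a)) = ?u"
      by auto
    let ?z = "zip (letters b) (letters a)"
    let ?B = "map fst (?s a b)" and ?V = "map snd (?s a b)" and ?p = "wmax (letters b)"
    let ?is = "map (\<lambda>j. count (mset ?B) (Suc j)) [0..<?p]"
    have z: "?z = map (letter (?s a b)) ?u"
      using map_letter_pack[of ?z] by (simp add: p)
    have lens: "length (?s a b) = ?m"
      using wmax_pack[of ?z] by (simp add: p)
    have srt: "sorted_wrt (<) (?s a b)"
      by simp
    have fsts: "letter ?B i = fst (letter (?s a b) i)" "letter ?V i = snd (letter (?s a b) i)"
      if "i \<in> set ?u" for i
      using that u lens by (auto simp: letter_def)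
    have wb: "word_comp ?B ?u = letters b"
    proof -
      have "word_comp ?B ?u = map fst (map (letter (?s a b)) ?u)"
        unfolding word_comp_def map_map by (rule map_cong) (simp_all only: fsts o_apply)
      also have "\<dots> = map fst ?z"
        by (rule arg_cong[OF z[symmetric]])
      finally show ?thesis
        using len by simp
    qed
    have wa: "word_comp ?V ?u = letters a"
    proof -
      have "word_comp ?V ?u = map snd (map (letter (?s a b)) ?u)"
        unfolding word_comp_def map_map by (rule map_cong) (simp_all only: fsts o_apply)
      also have "\<dots> = map snd ?z"
        by (rule arg_cong[OF z[symmetric]])
      finally show ?thesis
        using len by simp
    qed
    have sB: "set ?B = {1..?p}" and sV: "set ?V = {1..wmax (letters a)}"
      using len set_packed[OF packed_letters[of b]] set_packed[OF packed_letters[of a]]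
        map_fst_zip[of "letters b" "letters a"] map_snd_zip[of "letters b" "letters a"]
      by (simp_all only: set_map set_sorted_list_of_set[OF finite_set] set_map[symmetric])
    have "sorted ?B"
      by (rule sorted_wrt_map_mono[where f = fst, OF srt]) (auto simp: less_prod_def' less_imp_le)
    then have B: "block_word ?is = ?B"
      by (rule block_word_of_counts[OF _ sB])
    then have sum: "sum_list ?is = ?m"
      using lens length_block_from[of 1 ?is] unfolding block_word_eq_block_from[symmetric] by simp
    \<comment> \<open>No part is zero, because every letter up to \<open>?p\<close> occurs in
      \<open>?B\<close>.\<close>
    have comp: "?is \<in> compositions ?m"
      using sum sB by (auto simp: compositions_def image_iff simp flip: count_eq_zero_iff)
    have "?V \<in> QSh ?is"
      unfolding QSh_iff_zip_sorted B sum using lens packedI[OF sV] srt by (simp add: zip_map_fst_snd)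
    then show "?i x \<in> ?D"
      using comp by (simp add: x)
    show "?j (?i x) = x"
      by (simp add: x B wa wb letters_Abs letters_inject[symmetric] packed_letters del: mset_map)
  qed simp
  also have "\<dots> = (\<Sum>(a, b)\<in>?C. bas (a, b))"
    by (simp add: case_prod_unfold)
  finally show ?thesis .
qed


section \<open>The morphism on basis elements\<close>

text \<open>The two conditions on linear extensions as a single one, for any carrier and any totally
  ordered set of values. It serves words, maps on a carrier and lexicographically ordered pairs
  alike.\<close>

definition lin_on :: "'a set \<Rightarrow> ('a \<Rightarrow> 'a \<Rightarrow> bool) \<Rightarrow> ('a \<Rightarrow> 'z::linorder) \<Rightarrow> bool" where
  "lin_on E R f \<longleftrightarrow> (\<forall>x\<in>E. \<forall>y\<in>E. R x y \<longrightarrow> (if R y x then f x = f y else f x < f y))"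

lemma lin_onD: "lin_on E R f \<Longrightarrow> R x y \<Longrightarrow> x \<in> E \<Longrightarrow> y \<in> E \<Longrightarrow> if R y x then f x = f y else f x < f y"
  unfolding lin_on_def by blast

lemma lin_on_cong: "(\<And>x. x \<in> E \<Longrightarrow> f x = g x) \<Longrightarrow> lin_on E R f \<longleftrightarrow> lin_on E R g"
  by (auto simp: lin_on_def)

lemma lin_on_top:
  "(\<forall>i j. top_less T i j \<longrightarrow> f i < f j) \<and> (\<forall>i j. top_eqv T i j \<longrightarrow> f i = f j)
    \<longleftrightarrow> lin_on (topspace T) (top_le T) f"
  (is "?L \<longleftrightarrow> ?R")
proof
  assume L: ?L
  have "if top_le T j i then f i = f j else f i < f j" if "top_le T i j" for i j
    using that L[THEN conjunct1, rule_format, of i j] L[THEN conjunct2, rule_format, of i j]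
    by (simp add: top_less_def top_eqv_def)
  then show ?R
    unfolding lin_on_def by blast
next
  assume R: ?R
  have "if top_le T j i then f i = f j else f i < f j" if "top_le T i j" for i j
    by (rule lin_onD[OF R that top_leD[OF that]])
  then show ?L
    unfolding top_less_def top_eqv_def by metis
qed

lemma lin_on_rel_cong:
  assumes "\<And>x y. x \<in> E \<Longrightarrow> y \<in> E \<Longrightarrow> R x y \<longleftrightarrow> R' x y"
  shows "lin_on E R f \<longleftrightarrow> lin_on E R' f"
  unfolding lin_on_def by (intro ball_cong refl imp_cong if_cong) (simp_all add: assms)

lemma mem_lin_words:
  "w \<in> lin_words T \<longleftrightarrow> length (letters w) = size_top T \<and>
    lin_on {1..size_top T} (tle T) (letter (letters w))"
  using lin_on_top[of "top_of T" "letter (letters w)"] by (simp add: lin_words_def topspace_top_of)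

lemma letter_pack: "i \<in> {1..length v} \<Longrightarrow> letter (pack v) i = std_rank (set v) (letter v i)"
  by (auto simp: letter_def pack_def)

lemma letter_mem: "i \<in> {1..length v} \<Longrightarrow> letter v i \<in> set v"
  by (auto simp: letter_def)

text \<open>Packing preserves and reflects both strict inequality and equality of letters.\<close>

lemma lin_on_pack: "lin_on {1..length v} R (letter (pack v)) \<longleftrightarrow> lin_on {1..length v} R (letter v)"
  unfolding lin_on_def
  by (intro ball_cong refl imp_cong)
    (simp add: letter_pack letter_mem std_rank_less_iff del: One_nat_def atLeastAtMost_iff)

lemma pack_mem_lin_words:
  "Abs_packed_word (pack v) \<in> lin_words T \<longleftrightarrow> length v = size_top T \<and> lin_on {1..size_top T} (tle T) (letter v)"
  using lin_on_pack[of v "tle T"] by (auto simp: mem_lin_words letters_Abs packed_pack)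

lemma finite_lin_words: "finite (lin_words T)"
  by (rule finite_subset[OF _ finite_packed_words_of_length[of "size_top T"]]) (auto simp: mem_lin_words)

lemma lin_Lambda: "lin Lambda"
  unfolding Lambda_def by (rule lin_lin_ext)

lemma Lambda_bas: "Lambda (bas T) = (\<Sum>w\<in>lin_words T. bas w)"
  by (simp add: Lambda_def)

text \<open>Each relation of the product lies inside one block, so the conditions on
  \<open>x\<close> split at \<open>n\<close>; packing the two pieces does not affect them.\<close>

lemma mem_lin_words_prod_top:
  assumes "size_top T = n"
  shows "x \<in> lin_words (prod_top T T') \<longleftrightarrow> Abs_packed_word (pack (take n (letters x))) \<in> lin_words T \<and>
    Abs_packed_word (pack (drop n (letters x))) \<in> lin_words T'"
proof (cases "length (letters x) = n + size_top T'")
  case True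
  let ?x = "letters x" and ?R = "tle (prod_top T T')"
  have "lin_on {1..n + size_top T'} ?R (letter ?x)
      \<longleftrightarrow> lin_on {1..n} (tle T) (letter (take n ?x)) \<and> lin_on {1..size_top T'} (tle T') (letter (drop n ?x))"
    (is "?L \<longleftrightarrow> ?A \<and> ?B")
  proof
    assume L: ?L
    have ?A
      unfolding lin_on_def
    proof (intro ballI impI)
      fix i j assume ij: "i \<in> {1..n}" "j \<in> {1..n}" "tle T i j"
      then have "?R i j" "?R j i \<longleftrightarrow> tle T j i" "i \<in> {1..n + size_top T'}" "j \<in> {1..n + size_top T'}"
        using assms by (auto simp: tle_prod_top)
      then have "if tle T j i then letter ?x i = letter ?x j else letter ?x i < letter ?x j"
        using L unfolding lin_on_def by metis
      then show "if tle T j i then letter (take n ?x) i = letter (take n ?x) j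
          else letter (take n ?x) i < letter (take n ?x) j"
        using ij by (simp only: letter_take)
    qed
    moreover have ?B
      unfolding lin_on_def
    proof (intro ballI impI)
      fix i j assume ij: "i \<in> {1..size_top T'}" "j \<in> {1..size_top T'}" "tle T' i j"
      then have "?R (i + n) (j + n)" "?R (j + n) (i + n) \<longleftrightarrow> tle T' j i"
          "i + n \<in> {1..n + size_top T'}" "j + n \<in> {1..n + size_top T'}"
        using assms by (auto simp: tle_prod_top dest: tle_mem)
      then have "if tle T' j i then letter ?x (i + n) = letter ?x (j + n) else letter ?x (i + n) < letter ?x (j + n)"
        using L unfolding lin_on_def by metis
      then show "if tle T' j i then letter (drop n ?x) i = letter (drop n ?x) j
          else letter (drop n ?x) i < letter (drop n ?x) j"
        using ij by (simp only: letter_drop[OF _ True])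
    qed
    ultimately show "?A \<and> ?B" ..
  next
    assume AB: "?A \<and> ?B"
    show ?L
      unfolding lin_on_def
    proof (intro ballI impI)
      fix i j assume R: "?R i j"
      show "if ?R j i then letter ?x i = letter ?x j else letter ?x i < letter ?x j"
      proof (cases "tle T i j")
        case t: True
        then have ij: "i \<in> {1..n}" "j \<in> {1..n}"
          using tle_mem[of T i j] assms by auto
        then have "?R j i \<longleftrightarrow> tle T j i"
          using assms by (auto simp: tle_prod_top)
        moreover have "if tle T j i then letter (take n ?x) i = letter (take n ?x) j
            else letter (take n ?x) i < letter (take n ?x) j"
          using AB ij t unfolding lin_on_def by metis
        ultimately show ?thesis
          using ij by (simp only: letter_take)
      next
        case False
        then have t: "n < i" "n < j" "tle T' (i - n) (j - n)"
          using R assms by (auto simp: tle_prod_top)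
        then have ij: "i - n \<in> {1..size_top T'}" "j - n \<in> {1..size_top T'}"
          using tle_mem[of T' "i - n" "j - n"] by auto
        have "?R j i \<longleftrightarrow> tle T' (j - n) (i - n)"
          using t assms by (auto simp: tle_prod_top dest: tle_mem)
        moreover have "if tle T' (j - n) (i - n) then letter (drop n ?x) (i - n) = letter (drop n ?x) (j - n)
            else letter (drop n ?x) (i - n) < letter (drop n ?x) (j - n)"
          using AB ij t unfolding lin_on_def by metis
        moreover have "letter (drop n ?x) (i - n) = letter ?x i" "letter (drop n ?x) (j - n) = letter ?x j"
          using ij t by (simp_all only: letter_drop[OF _ True]) simp_all
        ultimately show ?thesis
          by (simp only:)
      qed
    qed
  qed
  then show ?thesis
    using True assms by (simp add: pack_mem_lin_words mem_lin_words[of x])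
next
  case False
  then have "x \<notin> lin_words (prod_top T T')"
    using assms by (simp add: mem_lin_words)
  moreover have "\<not> (length (take n (letters x)) = n \<and> length (drop n (letters x)) = size_top T')"
    using False by auto
  ultimately show ?thesis
    using assms by (auto simp: pack_mem_lin_words simp del: length_take length_drop)
qed

section \<open>Compatibility of \<Lambda> with the products\<close>

lemma lin_mul_WQSym: "lin (\<lambda>x. mul WQSym x y)" "lin (mul WQSym x)"
  unfolding WQSym_simps by (rule lin_bilin_ext_left lin_bilin_ext_right)+

text \<open>A word \<open>x\<close> determines \<open>u\<close> and \<open>v\<close> as the packings
  of its prefix and suffix. Hence each word arises from at most one pair, and the words that arise
  are the linear extensions of the product.\<close>

lemma Lambda_mul: "Lambda (mul HT x y) = mul WQSym (Lambda x) (Lambda y :: packed_word \<Rightarrow>\<^sub>0 'k::field)"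
proof (rule lin_eqI2[where f = "\<lambda>x y. Lambda (mul HT x y)"])
  fix T T'
  let ?n = "size_top T"
  let ?X = "\<lambda>u v. {x. pack (take ?n (letters x)) = letters u \<and> pack (drop ?n (letters x)) = letters v}"
  have fin: "finite (?X u v)" for u v
  proof (rule finite_subset[OF _ finite_packed_words_of_length[of "length (letters u) + length (letters v)"]])
    show "?X u v \<subseteq> {w. length (letters w) = length (letters u) + length (letters v)}"
      by (clarsimp simp: length_pack[symmetric, of "take ?n _"] length_pack[symmetric, of "drop ?n _"] simp del: length_pack)
        (metis append_take_drop_id length_append length_pack)
  qed
  have "mul WQSym (Lambda (bas T)) (Lambda (bas T') :: packed_word \<Rightarrow>\<^sub>0 'k)
      = (\<Sum>u\<in>lin_words T. \<Sum>v\<in>lin_words T'. mul WQSym (bas u) (bas v))"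
    by (simp add: Lambda_bas linD(5)[OF lin_mul_WQSym(1)] linD(5)[OF lin_mul_WQSym(2)]) (rule sum.swap)
  also have "\<dots> = (\<Sum>u\<in>lin_words T. \<Sum>v\<in>lin_words T'. \<Sum>x\<in>?X u v. bas x)"
    by (intro sum.cong refl, subst WQSym_mul_bas) (auto simp: mem_lin_words)
  also have "\<dots> = (\<Sum>(u, v, x)\<in>Sigma (lin_words T) (\<lambda>u. Sigma (lin_words T') (?X u)). bas x)"
    by (simp add: sum.Sigma finite_lin_words fin split_def)
  also have "\<dots> = (\<Sum>x\<in>lin_words (prod_top T T'). bas x)"
    by (rule sum.reindex_bij_witness[where j = "\<lambda>(u, v, x). x" and
          i = "\<lambda>x. (Abs_packed_word (pack (take ?n (letters x))), Abs_packed_word (pack (drop ?n (letters x))), x)"])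
      (auto simp: mem_lin_words_prod_top letters_Abs packed_pack letters_inverse)
  also have "\<dots> = Lambda (mul HT (bas T) (bas T'))"
    by (simp add: HT_simps Lambda_bas)
  finally show "Lambda (mul HT (bas T) (bas T')) = mul WQSym (Lambda (bas T)) (Lambda (bas T') :: packed_word \<Rightarrow>\<^sub>0 'k)" ..
qed (auto intro!: lin_comp[OF lin_Lambda] lin_comp[OF lin_mul_WQSym(1) lin_Lambda]
    lin_comp[OF lin_mul_WQSym(2) lin_Lambda] simp: HT_simps lin_bilin_ext_left lin_bilin_ext_right)

section \<open>Words as functions on an index set\<close>

lemma filter_sorted_list_of_set:
  "finite E \<Longrightarrow> filter P (sorted_list_of_set E) = sorted_list_of_set {x \<in> E. P x}"
  for E :: "'a::linorder set"
  using sorted_list_of_set_set[of "filter P (sorted_list_of_set E)"] by (simp add: sorted_wrt_filter)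

lemma letter_map_sorted_list_of_set:
  assumes "finite E" "x \<in> E"
  shows "letter (map f (sorted_list_of_set E)) (std_rank E x) = f x"
proof -
  have "std_rank E x \<in> {1..card E}"
    using std_rank_image[OF assms(1)] assms(2) by blast
  then have "letter (map f (sorted_list_of_set E)) (std_rank E x) = f (letter (sorted_list_of_set E) (std_rank E x))"
    using assms by (auto simp: letter_def)
  then show ?thesis
    by (simp add: letter_sorted_list_of_set assms)
qed

lemma map_letter_std_rank:
  assumes "finite E" "length w = card E"
  shows "map (\<lambda>x. letter w (std_rank E x)) (sorted_list_of_set E) = w"
proof (rule nth_equalityI)
  fix k assume "k < length (map (\<lambda>x. letter w (std_rank E x)) (sorted_list_of_set E))"
  then have k: "k < length (sorted_list_of_set E)"
    by simp
  then have "std_rank (set (sorted_list_of_set E)) (letter (sorted_list_of_set E) (Suc k)) = Suc k"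
    using assms by (intro std_rank_letter) auto
  then have "std_rank E (sorted_list_of_set E ! k) = Suc k"
    using assms by (simp add: letter_def)
  then show "map (\<lambda>x. letter w (std_rank E x)) (sorted_list_of_set E) ! k = w ! k"
    using k by (simp add: letter_def)
qed (use assms in simp)

text \<open>Packed linear extensions as functions on the carrier, so that cutting is restriction and
  gluing is a case distinction. Extensionality makes such a function determined by its values on
  \<open>E\<close>.\<close>

definition packed_maps :: "nat set \<Rightarrow> (nat \<Rightarrow> nat \<Rightarrow> bool) \<Rightarrow> (nat \<Rightarrow> nat) set" where
  "packed_maps E R = {f \<in> extensional E. f ` E = {1..card (f ` E)} \<and> lin_on E R f}"

abbreviation word_of :: "nat set \<Rightarrow> (nat \<Rightarrow> nat) \<Rightarrow> packed_word" where
  "word_of E f \<equiv> Abs_packed_word (map f (sorted_list_of_set E))"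

lemma letters_word_of:
  "finite E \<Longrightarrow> f ` E = {1..m} \<Longrightarrow> letters (word_of E f) = map f (sorted_list_of_set E)"
  by (rule letters_Abs, rule packedI[of _ m]) simp

lemma word_of_restrict: "finite E \<Longrightarrow> word_of E (restrict f E) = word_of E f"
  by (metis (no_types, lifting) map_cong restrict_apply' set_sorted_list_of_set)

text \<open>Listing a function along the sorted carrier gives a word; reading the word at position
  \<open>std_rank E x\<close> gives the value at \<open>x\<close> back.\<close>

lemma Lambda_std_order:
  assumes fin: "finite E" and pre: "preorder_on_set E R"
  shows "Lambda (bas (std_order E R)) = (\<Sum>f\<in>packed_maps E R. bas (word_of E f) :: packed_word \<Rightarrow>\<^sub>0 'k::field)"
  unfolding Lambda_bas
proof (rule sum.reindex_bij_witness[where i = "word_of E" and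
      j = "\<lambda>w. restrict (\<lambda>x. letter (letters w) (std_rank E x)) E"])
  let ?T = "std_order E R"
  let ?j = "\<lambda>w. restrict (\<lambda>x. letter (letters w) (std_rank E x)) E"
  have j_word: "map (?j w) (sorted_list_of_set E) = letters w" "word_of E (?j w) = w"
    if "w \<in> lin_words ?T" for w
  proof -
    have len: "length (letters w) = card E"
      using that fin by (simp add: mem_lin_words)
    show word: "map (?j w) (sorted_list_of_set E) = letters w"
    proof -
      have "map (?j w) (sorted_list_of_set E) = map (\<lambda>x. letter (letters w) (std_rank E x)) (sorted_list_of_set E)"
        using fin by (intro map_cong) auto
      then show ?thesis
        by (simp only: map_letter_std_rank[OF fin len])
    qed
    show "word_of E (?j w) = w"
      by (simp add: word letters_inverse)
  qed
  {
    fix w assume w: "w \<in> lin_words ?T"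
    then have len: "length (letters w) = card E" and lin: "lin_on {1..card E} (tle ?T) (letter (letters w))"
      using fin by (auto simp: mem_lin_words)
    note word = j_word(1)[OF w]
    show "word_of E (?j w) = w"
      by (rule j_word(2)[OF w])
    then show "bas (word_of E (?j w)) = (bas w :: packed_word \<Rightarrow>\<^sub>0 'k)"
      by (simp only:)
    have "?j w ` E = set (map (?j w) (sorted_list_of_set E))"
      using fin by simp
    then have "?j w ` E = {1..card (?j w ` E)}"
      unfolding word using set_packed[OF packed_letters[of w]] by (metis card_atLeastAtMost diff_Suc_1)
    moreover have "lin_on E R (?j w)"
      unfolding lin_on_def
    proof (intro ballI impI)
      fix x y assume xy: "x \<in> E" "y \<in> E" "R x y"
      then have "std_rank E x \<in> {1..card E}" "std_rank E y \<in> {1..card E}"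
        using std_rank_image[OF fin] by blast+
      then show "if R y x then ?j w x = ?j w y else ?j w x < ?j w y"
        using lin_onD[OF lin, of "std_rank E x" "std_rank E y"] xy
          tle_std_order[OF fin pre xy(1,2)] tle_std_order[OF fin pre xy(2,1)]
        by (simp only: restrict_apply' simp_thms True_implies_equals)
    qed
    ultimately show "?j w \<in> packed_maps E R"
      by (simp add: packed_maps_def)
  next
    fix f assume f: "f \<in> packed_maps E R"
    then have l: "letters (word_of E f) = map f (sorted_list_of_set E)"
      and lin: "lin_on E R f" and ext: "f \<in> extensional E"
      using letters_word_of[OF fin] by (auto simp: packed_maps_def)
    show "?j (word_of E f) = f"
      using ext by (auto simp: l letter_map_sorted_list_of_set[OF fin] extensional_def)
    have "lin_on {1..card E} (tle ?T) (letter (letters (word_of E f)))"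
      unfolding lin_on_def std_rank_image[OF fin, symmetric] l
    proof (intro ballI impI)
      fix i j assume "i \<in> std_rank E ` E" "j \<in> std_rank E ` E" and ij: "tle ?T i j"
      then obtain x y where xy: "x \<in> E" "y \<in> E" "i = std_rank E x" "j = std_rank E y"
        by blast
      then show "if tle ?T j i
          then letter (map f (sorted_list_of_set E)) i = letter (map f (sorted_list_of_set E)) j
          else letter (map f (sorted_list_of_set E)) i < letter (map f (sorted_list_of_set E)) j"
        using lin_onD[OF lin, of x y] ij
        by (simp only: letter_map_sorted_list_of_set[OF fin] tle_std_order[OF fin pre] simp_thms True_implies_equals)
    qed
    then show "word_of E f \<in> lin_words ?T"
      using fin by (simp add: mem_lin_words l)
  }
qed

section \<open>Compatibility of \<Lambda> with the coproducts\<close>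

lemma std_rank_interval: "x \<in> {k + 1..m} \<Longrightarrow> std_rank {k + 1..m} x = x - k" for x k m :: nat
proof -
  assume "x \<in> {k + 1..m}"
  then have "{e \<in> {k + 1..m}. e \<le> x} = {k + 1..x}"
    by auto
  then show ?thesis
    by (simp add: std_rank_def)
qed

lemma lin_WQSym_coproduct: "lin WQSym_coproduct"
  unfolding WQSym_coproduct_def by (rule lin_lin_ext)

text \<open>As the letters fill \<open>{1..m}\<close>, those above \<open>k\<close> fill an
  interval, and packing them just subtracts \<open>k\<close>.\<close>

lemma WQSym_coproduct_word_of:
  assumes fin: "finite E" and img: "f ` E = {1..m}"
  shows "WQSym_coproduct (bas (word_of E f)) = (\<Sum>k\<in>{0..m}.
    bas (word_of {x \<in> E. f x \<le> k} f, word_of {x \<in> E. k < f x} (\<lambda>x. f x - k)))"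
proof -
  let ?w = "map f (sorted_list_of_set E)"
  have l: "letters (word_of E f) = ?w"
    by (rule letters_word_of[OF fin img])
  have max: "wmax ?w = m"
    using fin img by (intro wmax_eqI) simp
  have "restrict_word ?w {1..k} = map f (sorted_list_of_set {x \<in> E. f x \<le> k})" for k
  proof -
    have "{x \<in> E. f x \<in> {1..k}} = {x \<in> E. f x \<le> k}"
      using img by auto
    then show ?thesis
      by (simp add: restrict_word_def filter_map o_def filter_sorted_list_of_set[OF fin] del: One_nat_def atLeastAtMost_iff)
  qed
  moreover have "pack (restrict_word ?w {k + 1..m}) = map (\<lambda>x. f x - k) (sorted_list_of_set {x \<in> E. k < f x})"
    if "k \<le> m" for k
  proof -
    have sub: "{x \<in> E. f x \<in> {k + 1..m}} = {x \<in> E. k < f x}"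
      using img by auto
    have "f ` {x \<in> E. k < f x} = f ` E \<inter> {k + 1..m}"
      unfolding sub[symmetric] by auto
    then have im: "f ` {x \<in> E. k < f x} = {k + 1..m}"
      unfolding img by auto
    have "restrict_word ?w {k + 1..m} = map f (sorted_list_of_set {x \<in> E. k < f x})"
      using sub by (simp add: restrict_word_def filter_map o_def filter_sorted_list_of_set[OF fin] del: One_nat_def atLeastAtMost_iff)
    moreover have "f x \<in> {k + 1..m}" if "x \<in> {x \<in> E. k < f x}" for x
      using im that by blast
    ultimately show ?thesis
      using fin by (simp add: pack_def im std_rank_interval del: One_nat_def atLeastAtMost_iff)
  qed
  ultimately show ?thesis
    unfolding WQSym_coproduct_def lin_ext_bas l max Mbas_def tensor_bas by (intro sum.cong refl) simp
qed

lemma finite_packed_maps: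
  assumes "finite E"
  shows "finite (packed_maps E R)"
proof -
  have "packed_maps E R \<subseteq> E \<rightarrow>\<^sub>E {1..card E}"
  proof
    fix f assume f: "f \<in> packed_maps E R"
    have "card (f ` E) \<le> card E"
      by (rule card_image_le[OF assms])
    then have "f ` E \<subseteq> {1..card E}"
      using f unfolding packed_maps_def by fastforce
    then show "f \<in> E \<rightarrow>\<^sub>E {1..card E}"
      using f by (auto simp: packed_maps_def PiE_def)
  qed
  then show ?thesis
    by (rule finite_subset) (intro finite_PiE assms, simp)
qed

text \<open>Cutting an extension at height \<open>k\<close> (\<open>?j\<close>) and gluing two
  extensions by lifting the upper one (\<open>?i\<close>) are mutually inverse. The height is
  recovered as the number of values taken on the complement of \<open>Y\<close>.\<close>

lemma Lambda_comul_std_order: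
  fixes R :: "nat \<Rightarrow> nat \<Rightarrow> bool"
  assumes fin: "finite E" and pre: "preorder_on_set E R"
  shows "WQSym_coproduct (Lambda (bas (std_order E R)))
    = (tensor_map Lambda Lambda (HT_coproduct (bas (std_order E R))) :: _ \<Rightarrow>\<^sub>0 'k::field)"
proof -
  have sub: "finite Y" "preorder_on_set Y R" if "Y \<subseteq> E" for Y
    using that fin pre finite_subset preorder_on_subset by blast+
  let ?P = "Sigma (packed_maps E R) (\<lambda>f. {0..card (f ` E)})"
  let ?Q = "Sigma {Y. upset E R Y} (\<lambda>Y. packed_maps (E - Y) R \<times> packed_maps Y R)"
  let ?Y = "\<lambda>f k. {x \<in> E. k < f x}"
  let ?j = "\<lambda>(f, k). (?Y f k, restrict f (E - ?Y f k), restrict (\<lambda>x. f x - k) (?Y f k))"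
  let ?i = "\<lambda>(Y, g, h). (restrict (\<lambda>x. if x \<in> Y then h x + card (g ` (E - Y)) else g x) E, card (g ` (E - Y)))"
  have "WQSym_coproduct (Lambda (bas (std_order E R)))
      = (\<Sum>f\<in>packed_maps E R. \<Sum>k\<in>{0..card (f ` E)}.
          (bas (word_of {x \<in> E. f x \<le> k} f, word_of (?Y f k) (\<lambda>x. f x - k)) :: _ \<Rightarrow>\<^sub>0 'k))"
    unfolding Lambda_std_order[OF fin pre] linD(5)[OF lin_WQSym_coproduct]
    by (intro sum.cong refl WQSym_coproduct_word_of[OF fin]) (simp add: packed_maps_def)
  also have "\<dots> = (\<Sum>(f, k)\<in>?P. bas (word_of {x \<in> E. f x \<le> k} f, word_of (?Y f k) (\<lambda>x. f x - k)))"
    by (rule sum.Sigma) (auto simp: finite_packed_maps fin)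
  also have "\<dots> = (\<Sum>(Y, g, h)\<in>?Q. bas (word_of (E - Y) g, word_of Y h))"
  proof (rule sum.reindex_bij_witness[where i = ?i and j = ?j])
    fix p assume "p \<in> ?P"
    then obtain f k where p: "p = (f, k)" and f: "f \<in> packed_maps E R" and k: "k \<le> card (f ` E)"
      by auto
    define m where "m = card (f ` E)"
    let ?Z = "?Y f k"
    have img: "f ` E = {1..m}" and lf: "lin_on E R f" and ext: "f \<in> extensional E"
      using f unfolding packed_maps_def m_def by blast+
    have compl: "E - ?Z = {x \<in> E. f x \<le> k}"
      by auto
    have "f ` (E - ?Z) = f ` E \<inter> {1..k}"
    proof (intro equalityI subsetI)
      fix i assume "i \<in> f ` E \<inter> {1..k}"
      then obtain x where "x \<in> E" "i = f x" "f x \<le> k"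
        by auto
      then show "i \<in> f ` (E - ?Z)"
        unfolding compl by blast
    qed (use img in \<open>auto simp: compl\<close>)
    then have img1: "f ` (E - ?Z) = {1..k}"
      unfolding img using k by (auto simp: m_def)
    have "f ` ?Z = f ` E \<inter> {k + 1..m}"
    proof (intro equalityI subsetI)
      fix i assume "i \<in> f ` E \<inter> {k + 1..m}"
      then obtain x where "x \<in> E" "i = f x" "k < f x"
        by auto
      then show "i \<in> f ` ?Z"
        by blast
    qed (use img in auto)
    then have img2: "f ` ?Z = {k + 1..m}"
      unfolding img by auto
    have "(\<lambda>x. f x - k) ` ?Z = (\<lambda>i. i - k) ` {k + 1..m}"
      unfolding img2[symmetric] image_image ..
    also have "\<dots> = {1..m - k}"
    proof -
      have "{k + 1..m} = (\<lambda>i. i + k) ` {1..m - k}"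
        unfolding image_add_atLeastAtMost' using k by (simp add: add.commute m_def)
      then show ?thesis
        by (simp only: image_image add_diff_cancel_right' image_ident)
    qed
    finally have img3: "(\<lambda>x. f x - k) ` ?Z = {1..m - k}" .
    \<comment> \<open>A linear extension is weakly increasing, hence the points above
      \<open>k\<close> form a final segment.\<close>
    have mono: "f x \<le> f y" if "x \<in> E" "y \<in> E" "R x y" for x y
      using lf that unfolding lin_on_def by (metis order.order_iff_strict)
    have "upset E R ?Z"
      using mono by (force simp: upset_def)
    moreover have "restrict f (E - ?Z) \<in> packed_maps (E - ?Z) R"
      using lf img1 by (auto simp: packed_maps_def lin_on_def)
    moreover have "restrict (\<lambda>x. f x - k) ?Z \<in> packed_maps ?Z R"
      using lf img3 by (auto simp: packed_maps_def lin_on_def diff_less_mono)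
    ultimately show "?j p \<in> ?Q"
      by (simp add: p)
    have c: "card (restrict f (E - ?Z) ` (E - ?Z)) = k"
      by (simp add: img1 del: One_nat_def)
    have "restrict (\<lambda>x. if x \<in> ?Z then restrict (\<lambda>x. f x - k) ?Z x + k else restrict f (E - ?Z) x) E = f"
      using ext by (auto simp: extensional_def)
    then show "?i (?j p) = p"
      by (simp only: p split c)
    have "word_of (E - ?Z) (restrict f (E - ?Z)) = word_of (E - ?Z) f"
      "word_of ?Z (restrict (\<lambda>x. f x - k) ?Z) = word_of ?Z (\<lambda>x. f x - k)"
      using fin by (auto intro!: word_of_restrict)
    then show "((case ?j p of (Y, g, h) \<Rightarrow> bas (word_of (E - Y) g, word_of Y h)) :: _ \<Rightarrow>\<^sub>0 'k)
        = (case p of (f, k) \<Rightarrow> bas (word_of {x \<in> E. f x \<le> k} f, word_of (?Y f k) (\<lambda>x. f x - k)))"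
      by (simp only: p split compl)
  next
    fix q assume "q \<in> ?Q"
    then obtain Y g h where q: "q = (Y, g, h)" and up: "upset E R Y"
      and g: "g \<in> packed_maps (E - Y) R" and h: "h \<in> packed_maps Y R"
      by auto
    define k l where "k = card (g ` (E - Y))" and "l = card (h ` Y)"
    define f where "f = restrict (\<lambda>x. if x \<in> Y then h x + k else g x) E"
    have YE: "Y \<subseteq> E"
      using up by (simp add: upset_def)
    have ig: "g ` (E - Y) = {1..k}" and ih: "h ` Y = {1..l}"
      using g h unfolding packed_maps_def k_def l_def by blast+
    have gx: "1 \<le> g x" "g x \<le> k" if "x \<in> E - Y" for x
      using that ig by (metis atLeastAtMost_iff imageI)+
    have hx: "1 \<le> h x" if "x \<in> Y" for x
      using that ih by (metis atLeastAtMost_iff imageI)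
    have "f ` E = f ` (E - Y) \<union> f ` Y"
      using YE by auto
    also have "f ` (E - Y) = g ` (E - Y)"
      by (auto simp: f_def)
    also have "f ` Y = (\<lambda>i. i + k) ` h ` Y"
      using YE by (force simp: f_def image_iff)
    also have "(\<lambda>i. i + k) ` h ` Y = {1 + k..l + k}"
      by (subst ih) (rule image_add_atLeastAtMost')
    finally have imf: "f ` E = {1..k + l}"
      unfolding ig by auto
    then have cf: "card (f ` E) = k + l"
      by simp
    have lin: "lin_on E R f"
      unfolding lin_on_def
    proof (intro ballI impI)
      fix x y assume xy: "x \<in> E" "y \<in> E" "R x y"
      show "if R y x then f x = f y else f x < f y"
      proof (cases "x \<in> Y")
        case True
        then have "y \<in> Y"
          using up xy by (auto simp: upset_def)
        then show ?thesis
          using lin_onD[of Y R h x y] h xy True by (simp add: packed_maps_def f_def split: if_splits)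
      next
        case False
        show ?thesis
        proof (cases "y \<in> Y")
          case True
          \<comment> \<open>A relation from outside \<open>Y\<close> into \<open>Y\<close> is strict
            because \<open>Y\<close> is a final segment, and the values obey: at most
            \<open>k\<close> outside, above \<open>k\<close> inside.\<close>
          then have "\<not> R y x"
            using up xy False by (auto simp: upset_def)
          then show ?thesis
            using gx[of x] hx[of y] xy True False by (simp add: f_def)
        next
          case y: False
          then show ?thesis
            using lin_onD[of "E - Y" R g x y] g xy False by (simp add: packed_maps_def f_def split: if_splits)
        qed
      qed
    qed
    have "f \<in> packed_maps E R"
      using lin imf cf by (simp add: packed_maps_def f_def)
    moreover have "k \<in> {0..card (f ` E)}"
      using cf by simp
    ultimately show "?i q \<in> ?P"
      unfolding f_def k_def q by simp
    \<comment> \<open>The threshold \<open>k\<close> recovers \<open>Y\<close>, since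
      \<open>g\<close> is at most \<open>k\<close> and \<open>h\<close> is at least 1.\<close>
    have Z: "?Y f k = Y"
    proof (intro equalityI subsetI)
      fix x assume "x \<in> ?Y f k"
      then show "x \<in> Y"
        using gx[of x] by (auto simp: f_def split: if_splits)
    next
      fix x assume "x \<in> Y"
      then show "x \<in> ?Y f k"
        using YE hx[of x] by (auto simp: f_def)
    qed
    have "g \<in> extensional (E - Y)" "h \<in> extensional Y"
      using g h by (auto simp: packed_maps_def)
    then have "restrict f (E - Y) = g" "restrict (\<lambda>x. f x - k) Y = h"
      using YE by (auto simp: fun_eq_iff extensional_def f_def)
    then have "?j (f, k) = q"
      by (simp only: q split Z)
    then show "?j (?i q) = q"
      by (simp only: q split f_def k_def)
  qed
  also have "\<dots> = (\<Sum>Y\<in>{Y. upset E R Y}. \<Sum>(g, h)\<in>packed_maps (E - Y) R \<times> packed_maps Y R.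
      bas (word_of (E - Y) g, word_of Y h))"
    by (subst sum.Sigma)
      (auto intro!: finite_upsets fin finite_cartesian_product finite_packed_maps sub simp: upset_def split_def)
  also have "\<dots> = (\<Sum>Y\<in>{Y. upset E R Y}. tensor (Lambda (bas (std_order (E - Y) R))) (Lambda (bas (std_order Y R))))"
    by (rule sum.cong) (auto simp: Lambda_std_order sub tensor_sum_left tensor_sum_right upset_def
        sum.cartesian_product[symmetric] intro: sum.swap)
  also have "\<dots> = tensor_map Lambda Lambda (HT_coproduct (bas (std_order E R)))"
    by (simp add: HT_coproduct_std_order[OF fin pre] linD(5)[OF lin_tensor_map])
  finally show ?thesis .
qed

lemma Lambda_comul: "WQSym_coproduct (Lambda x) = tensor_map Lambda Lambda (HT_coproduct x)"
proof (rule lin_eqI[where x = x])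
  fix T
  show "WQSym_coproduct (Lambda (bas T)) = tensor_map Lambda Lambda (HT_coproduct (bas T))"
    using Lambda_comul_std_order[OF finite_atLeastAtMost preorder_on_tle[of T]]
    by (simp only: std_order_fin_top)
qed (auto intro!: lin_comp[OF lin_WQSym_coproduct lin_Lambda] lin_comp[OF lin_tensor_map lin_HT_coproduct])

section \<open>Unit, counit, surjectivity of \<Lambda> and the Hopf algebra of packed words\<close>

lemma packed_Nil: "packed []"
  by (simp add: packedI[of _ 0])

lemma lin_words_empty_top: "lin_words empty_top = {Abs_packed_word []}"
  by (auto simp: mem_lin_words letters_inject[symmetric] letters_Abs packed_Nil lin_on_def)

text \<open>The empty word extends the empty topology and no other one. As before, the scalars are
  compared in the one-dimensional space with basis \<open>()\<close>.\<close>

lemma Lambda_counit: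
  "Poly_Mapping.lookup (Lambda x) (Abs_packed_word []) = (Poly_Mapping.lookup x empty_top :: 'k::field)"
proof -
  have "scale (Poly_Mapping.lookup (Lambda x) (Abs_packed_word [])) (bas ())
      = (scale (Poly_Mapping.lookup x empty_top) (bas ()) :: unit \<Rightarrow>\<^sub>0 'k)"
  proof (rule lin_eqI[where x = x])
    fix T
    have "Abs_packed_word [] \<in> lin_words T \<longleftrightarrow> T = empty_top"
      by (auto simp: lin_words_empty_top)
        (auto simp: mem_lin_words letters_Abs packed_Nil simp flip: size_top_0_iff)
    then have "Poly_Mapping.lookup (Lambda (bas T)) (Abs_packed_word []) = (if T = empty_top then 1 else 0 :: 'k)"
      by (simp add: Lambda_bas lookup_sum lookup_bas finite_lin_words)
    then show "scale (Poly_Mapping.lookup (Lambda (bas T)) (Abs_packed_word [])) (bas ())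
      = (scale (Poly_Mapping.lookup (bas T) empty_top) (bas ()) :: unit \<Rightarrow>\<^sub>0 'k)"
      by (simp add: lookup_bas)
  qed (auto intro!: lin_comp[OF lin_scale_left[OF linear_lookup] lin_Lambda] lin_scale_left[OF linear_lookup])
  then have "Poly_Mapping.lookup (scale (Poly_Mapping.lookup (Lambda x) (Abs_packed_word [])) (bas ())) ()
      = Poly_Mapping.lookup (scale (Poly_Mapping.lookup x empty_top) (bas ()) :: unit \<Rightarrow>\<^sub>0 'k) ()"
    by simp
  then show ?thesis
    by (simp add: lookup_bas)
qed

lemma Lambda_unit: "Lambda (unit HT) = unit WQSym"
  by (simp add: HT_simps WQSym_simps Lambda_bas lin_words_empty_top Mbas_def)

text \<open>The total quasi-order induced by the letters of a word has that word as its only linear extension.\<close>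

lemma Lambda_preimage: "\<exists>T. Lambda (bas T) = bas w"
proof -
  let ?n = "length (letters w)" and ?R = "\<lambda>i j. letter (letters w) i \<le> letter (letters w) j"
  have pre: "preorder_on_set {1..?n} ?R"
    by (auto simp: preorder_on_set_def)
  let ?T = "std_order {1..?n} ?R"
  have size: "size_top ?T = ?n"
    by simp
  have le: "tle ?T i j \<longleftrightarrow> ?R i j" if "i \<in> {1..?n}" "j \<in> {1..?n}" for i j
    using tle_std_order[OF _ pre that] std_rank_initial_segment[OF that(1)] std_rank_initial_segment[OF that(2)]
    by simp
  have lin_iff: "lin_on {1..?n} (tle ?T) f \<longleftrightarrow> lin_on {1..?n} ?R f" for f :: "nat \<Rightarrow> nat"
    by (rule lin_on_rel_cong) (rule le)
  have "w' = w" if "w' \<in> lin_words ?T" for w'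
  proof -
    have len: "length (letters w') = ?n" and lin: "lin_on {1..?n} ?R (letter (letters w'))"
      using that by (simp_all only: mem_lin_words size lin_iff)
    have "pack (letters w) = pack (letters w')"
    proof (rule pack_eq_of_pattern)
      fix i j assume ij: "i < ?n" "j < ?n"
      then have "Suc i \<in> {1..?n}" "Suc j \<in> {1..?n}"
        by auto
      then have "if ?R (Suc j) (Suc i) then letter (letters w') (Suc i) = letter (letters w') (Suc j)
          else letter (letters w') (Suc i) < letter (letters w') (Suc j)" if "?R (Suc i) (Suc j)"
        using that by (intro lin_onD[OF lin])
      then show "letters w ! i < letters w ! j \<Longrightarrow> letters w' ! i < letters w' ! j"
        "letters w ! i = letters w ! j \<Longrightarrow> letters w' ! i = letters w' ! j"
        by (auto simp: letter_def split: if_splits)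
    qed (simp add: len)
    then show ?thesis
      by (simp add: pack_packed packed_letters letters_inject)
  qed
  moreover have "w \<in> lin_words ?T"
    unfolding mem_lin_words size lin_iff by (simp add: lin_on_def)
  ultimately have "lin_words ?T = {w}"
    by blast
  then show ?thesis
    by (intro exI[of _ ?T]) (simp add: Lambda_bas)
qed

lemma surj_Lambda: "surj (Lambda :: (fin_top \<Rightarrow>\<^sub>0 'k::field) \<Rightarrow> packed_word \<Rightarrow>\<^sub>0 'k)"
proof -
  \<comment> \<open>Choosing a preimage for each basis word and extending linearly gives a section
    of \<Lambda>.\<close>
  obtain t where t: "Lambda (bas (t w)) = (bas w :: packed_word \<Rightarrow>\<^sub>0 'k)" for w
    using Lambda_preimage by metis
  have "Lambda (lin_ext (\<lambda>w. bas (t w)) y) = y" for y :: "packed_word \<Rightarrow>\<^sub>0 'k"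
    by (rule lin_eqI[where x = y]) (auto intro!: lin_comp[OF lin_Lambda lin_lin_ext] lin_id simp: t)
  then show ?thesis
    by (metis surjI)
qed

text \<open>No axiom is checked on quasi-shuffles: all are pushed forward from topologies along the
  surjection \<Lambda>.\<close>

lemma WQSym_bialgebra: "is_bialgebra (WQSym :: (packed_word, 'k::field) hopf_data)"
  by (rule bialgebra_transfer[OF HT_bialgebra lin_Lambda surj_Lambda])
    (simp_all only: Lambda_mul Lambda_unit lin_mul_WQSym,
      simp_all add: WQSym_simps HT_simps Lambda_comul Lambda_counit lin_WQSym_coproduct linear_lookup)

text \<open>The grading is by word length: the coproduct distributes the letters according to a
  threshold, so the lengths add up.\<close>

lemma WQSym_hopf: "is_hopf_algebra (WQSym :: (packed_word, 'k::field) hopf_data)"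
proof -
  have "\<exists>S. is_antipode (WQSym :: (packed_word, 'k) hopf_data) S"
  proof (rule connected_graded_antipode_exists[OF WQSym_bialgebra, where e = "Abs_packed_word []"
        and deg = "\<lambda>w. length (letters w)"])
    fix w w1 w2
    let ?w = "letters w"
    assume "(w1, w2) \<in> Poly_Mapping.keys (comul WQSym (bas w) :: _ \<Rightarrow>\<^sub>0 'k)"
    then obtain k where k: "k \<le> wmax ?w" "w1 = Abs_packed_word (restrict_word ?w {1..k})"
      "w2 = Abs_packed_word (pack (restrict_word ?w {k + 1..wmax ?w}))"
      using keys_sum_bas[of "\<lambda>k. (Abs_packed_word (restrict_word ?w {1..k}),
          Abs_packed_word (pack (restrict_word ?w {k + 1..wmax ?w})))" "{0..wmax ?w}"]
      by (auto simp: WQSym_simps WQSym_coproduct_def Mbas_def)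
    have "length (restrict_word ?w {k + 1..wmax ?w}) = length (filter (\<lambda>a. a \<notin> {1..k}) ?w)"
      unfolding restrict_word_def using set_packed[OF packed_letters[of w]]
      by (intro arg_cong[where f = length] filter_cong) auto
    then show "length (letters w1) + length (letters w2) = length ?w"
      using sum_length_filter_compl[of "\<lambda>a. a \<in> {1..k}" ?w] k
      by (simp add: letters_Abs packed_pack packed_restrict_word packed_letters restrict_word_def
          del: One_nat_def atLeastAtMost_iff)
        (simp add: letters_Abs packed_restrict_word[unfolded restrict_word_def] packed_letters del: One_nat_def atLeastAtMost_iff)
  qed (auto simp: WQSym_simps Mbas_def lookup_bas letters_Abs packed_Nil letters_inject[symmetric])
  then show ?thesis
    by (simp add: is_hopf_algebra_def WQSym_bialgebra)
qed

lemma Lambda_hopf_morphism: "is_hopf_morphism HT WQSym (Lambda :: (fin_top \<Rightarrow>\<^sub>0 'k::field) \<Rightarrow> _)"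
proof -
  have comul: "comul WQSym (Lambda x) = tensor_map Lambda Lambda (comul HT x)"
    and counit: "counit WQSym (Lambda x) = counit HT x" for x :: "fin_top \<Rightarrow>\<^sub>0 'k"
    by (simp_all add: WQSym_simps HT_simps Lambda_comul Lambda_counit)
  show ?thesis
    unfolding is_hopf_morphism_def
    using bialgebra_morphism_antipode[OF HT_bialgebra WQSym_bialgebra lin_Lambda Lambda_mul Lambda_unit comul counit]
    by (auto simp: HT_hopf WQSym_hopf lin_Lambda Lambda_mul Lambda_unit comul counit)
qed


section \<open>Admissible topologies and the internal coproducts\<close>

lemma top_le_quot_top:
  "top_le (quot_top T T') x y \<longleftrightarrow> x \<in> topspace T \<and> y \<in> topspace T \<and>
    (\<lambda>x y. top_le T x y \<or> top_le T' y x)\<^sup>+\<^sup>+ x y"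
proof -
  have "preorder_on_set (topspace T) (\<lambda>x y. top_le T x y \<or> top_le T' y x)\<^sup>+\<^sup>+"
    unfolding preorder_on_set_def
    using tranclp_trans[of "\<lambda>x y. top_le T x y \<or> top_le T' y x"] by (auto simp: top_le_refl)
  then show ?thesis
    by (simp add: quot_top_def top_le_top_of_order)
qed

text \<open>Suppose open sets \<open>U\<close> and \<open>V\<close> separate the class and
  \<open>x\<close> lies in \<open>U\<close>. An upward step stays in \<open>U\<close> because
  \<open>U\<close> is open; a downward step cannot land in \<open>V\<close>, for then its starting
  point would be in \<open>V\<close> too. So no zigzag from \<open>x\<close> leaves
  \<open>U\<close>.\<close>

lemma connectedin_zigzag_class:
  assumes "x \<in> topspace T"
  shows "connectedin T {y. (\<lambda>x y. top_le T x y \<or> top_le T y x)\<^sup>+\<^sup>+ x y}" (is "connectedin T ?C")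
proof -
  let ?S = "\<lambda>x y. top_le T x y \<or> top_le T y x"
  have sub: "?C \<subseteq> topspace T"
  proof
    fix y assume "y \<in> ?C"
    then have "?S\<^sup>+\<^sup>+ x y"
      by simp
    then show "y \<in> topspace T"
      by induction (auto dest: top_leD)
  qed
  have False if UV: "openin T U" "openin T V" "?C \<subseteq> U \<union> V" "U \<inter> V \<inter> ?C = {}" "V \<inter> ?C \<noteq> {}" "x \<in> U" for U V
  proof -
    have step: "z \<in> U" if "y \<in> U" "y \<in> ?C" "?S y z" for y z
    proof -
      have z: "z \<in> ?C"
        using that by (auto intro: tranclp.trancl_into_trancl)
      show ?thesis
      proof (cases "top_le T y z")
        case True
        then show ?thesis
          using UV(1) that(1) by (auto simp: top_le_def)
      next
        case False
        then have "z \<in> V \<Longrightarrow> y \<in> V"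
          using that(3) UV(2) by (auto simp: top_le_def)
        then show ?thesis
          using UV z that by blast
      qed
    qed
    have "y \<in> U" if "?S\<^sup>+\<^sup>+ x y" for y
      using that
    proof induction
      case (base y)
      have "x \<in> ?C"
        using assms by (auto simp: top_le_refl intro: tranclp.r_into_trancl)
      then show ?case
        using step base UV(6) by blast
    next
      case (step y z)
      then show ?case
        using \<open>\<And>z y. y \<in> U \<Longrightarrow> y \<in> ?C \<Longrightarrow> ?S y z \<Longrightarrow> z \<in> U\<close> by blast
    qed
    then show False
      using UV by blast
  qed
  note sep = this
  have x: "x \<in> ?C"
    using assms by (auto simp: top_le_refl intro: tranclp.r_into_trancl)
  show ?thesis
    unfolding connectedin
  proof (intro conjI sub notI)
    assume "\<exists>E1 E2. openin T E1 \<and> openin T E2 \<and> ?C \<subseteq> E1 \<union> E2 \<and> E1 \<inter> E2 \<inter> ?C = {} \<and>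
      E1 \<inter> ?C \<noteq> {} \<and> E2 \<inter> ?C \<noteq> {}"
    then obtain U V where UV: "openin T U" "openin T V" "?C \<subseteq> U \<union> V" "U \<inter> V \<inter> ?C = {}"
      "U \<inter> ?C \<noteq> {}" "V \<inter> ?C \<noteq> {}"
      by blast
    then have "x \<in> U \<or> x \<in> V"
      using x by blast
    moreover have "?C \<subseteq> V \<union> U" "V \<inter> U \<inter> ?C = {}"
      using UV by blast+
    ultimately show False
      using sep[of U V] sep[of V U] UV by blast
  qed
qed

text \<open>
  For \<open>b\<close> compatible with the quotient and \<open>a\<close> with \<open>T'\<close>, the topology \<open>T'\<close> is recovered
  as the restriction of \<open>T\<close> to the level sets of \<open>b\<close>.
\<close>

lemma admissible_iff_lexicographic:
  fixes a b :: "'a \<Rightarrow> nat"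
  assumes fin: "finite (topspace T)"
  shows "admissible T T' \<and> lin_on (topspace T) (top_le T') a \<and> lin_on (topspace T) (top_le (quot_top T T')) b
    \<longleftrightarrow> lin_on (topspace T) (top_le T) (\<lambda>x. (b x, a x)) \<and>
      T' = top_of_order (topspace T) (\<lambda>x y. top_le T x y \<and> b x = b y)"
    (is "?adm \<and> ?la \<and> ?lb \<longleftrightarrow> ?lex \<and> T' = ?T'")
proof
  let ?X = "topspace T"
  let ?S = "\<lambda>x y. top_le T x y \<or> top_le T' y x"
  let ?S' = "\<lambda>x y. top_le T' x y \<or> top_le T' y x"
  assume asm: "?adm \<and> ?la \<and> ?lb"
  then have adm: ?adm and la: ?la and lb: ?lb
    by auto
  have sp: "topspace T' = ?X"
    using adm by (simp add: admissible_def)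
  have le: "top_le T x y" if "top_le T' x y" for x y
    using that adm sp unfolding top_le_def admissible_def by blast
  have bQ: "if ?S\<^sup>+\<^sup>+ y x then b x = b y else b x < b y" if "?S\<^sup>+\<^sup>+ x y" "x \<in> ?X" "y \<in> ?X" for x y
    using lin_onD[OF lb, of x y] that by (simp add: top_le_quot_top)
  \<comment> \<open>The quotient adds the reversed relations of \<open>T'\<close> to
    \<open>T\<close>, so points related in \<open>T'\<close> become equivalent there and
    \<open>b\<close> agrees on them.\<close>
  have b_eq: "b x = b y" if "top_le T' x y" for x y
  proof -
    have "?S\<^sup>+\<^sup>+ x y" "?S\<^sup>+\<^sup>+ y x"
      using le[OF that] that by (auto intro: tranclp.r_into_trancl)
    then show ?thesis
      using bQ[of x y] top_leD[OF that] sp by simp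
  qed
  \<comment> \<open>Equal values of \<open>b\<close> force equivalence in the quotient by
    \<open>T'\<close>; admissibility turns this into a zigzag in \<open>T'\<close>, whose class is
    connected, and on connected sets \<open>T\<close> and \<open>T'\<close> coincide.\<close>
  have conv: "top_le T' x y" if xy: "top_le T x y" "b x = b y" for x y
  proof -
    have mem: "x \<in> ?X" "y \<in> ?X"
      using top_leD[OF xy(1)] by auto
    have Q: "?S\<^sup>+\<^sup>+ x y"
      using xy by (auto intro: tranclp.r_into_trancl)
    then have "?S\<^sup>+\<^sup>+ y x"
      using bQ[OF Q mem] xy(2) by (simp split: if_splits)
    then have "top_eqv (quot_top T T') x y"
      using Q mem by (simp add: top_eqv_def top_le_quot_top)
    then have "top_eqv (quot_top T' T') x y"
      using adm mem by (simp add: admissible_def)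
    then have S': "?S'\<^sup>+\<^sup>+ x y"
      by (simp add: top_eqv_def top_le_quot_top)
    let ?C = "{y. ?S'\<^sup>+\<^sup>+ x y}"
    have "connectedin T' ?C"
      by (rule connectedin_zigzag_class) (simp add: sp mem)
    then have "subtopology T' ?C = subtopology T ?C"
      using adm by (simp add: admissible_def)
    moreover have "x \<in> ?C" "y \<in> ?C"
      using S' mem sp by (auto simp: top_le_refl intro: tranclp.r_into_trancl)
    ultimately show ?thesis
      using xy(1) top_le_subtopology[of T' ?C x y] top_le_subtopology[of T ?C x y] by simp
  qed
  have pre: "preorder_on_set ?X (\<lambda>x y. top_le T x y \<and> b x = b y)"
    unfolding preorder_on_set_def using top_le_refl top_le_trans by metis
  have "T' = ?T'"
  proof (rule topology_eqI_top_le)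
    show "top_le T' x y \<longleftrightarrow> top_le ?T' x y" for x y
      unfolding top_le_top_of_order[OF pre] using le b_eq conv top_leD by metis
  qed (simp_all add: sp fin topspace_top_of_order)
  moreover have ?lex
    unfolding lin_on_def
  proof (intro ballI impI)
    fix x y assume xy: "x \<in> ?X" "y \<in> ?X" "top_le T x y"
    have Q: "?S\<^sup>+\<^sup>+ x y"
      using xy by (auto intro: tranclp.r_into_trancl)
    have ble: "b x \<le> b y"
      using bQ[OF Q xy(1,2)] by (simp split: if_splits)
    show "if top_le T y x then (b x, a x) = (b y, a y) else (b x, a x) < (b y, a y)"
    proof (cases "b x = b y")
      case True
      then have "top_le T' x y" "top_le T' y x \<longleftrightarrow> top_le T y x"
        using conv le xy by auto
      then show ?thesis
        using lin_onD[OF la, of x y] xy True by (simp add: less_prod_def')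
    next
      case False
      then have "\<not> top_le T y x"
        using bQ[OF tranclp.r_into_trancl[of ?S, OF disjI1] xy(2,1)] ble by (fastforce split: if_splits)
      then show ?thesis
        using False ble by (simp add: less_prod_def')
    qed
  qed
  ultimately show "?lex \<and> T' = ?T'"
    by simp
next
  let ?X = "topspace T"
  let ?S = "\<lambda>x y. top_le T x y \<or> top_le T' y x"
  let ?S' = "\<lambda>x y. top_le T' x y \<or> top_le T' y x"
  assume asm: "?lex \<and> T' = ?T'"
  then have lex: ?lex and T': "T' = ?T'"
    by auto
  have pre: "preorder_on_set ?X (\<lambda>x y. top_le T x y \<and> b x = b y)"
    unfolding preorder_on_set_def using top_le_refl top_le_trans by metis
  have sp: "topspace T' = ?X"
    by (simp add: T' topspace_top_of_order)
  have le: "top_le T' x y \<longleftrightarrow> top_le T x y \<and> b x = b y" for x y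
    unfolding T' top_le_top_of_order[OF pre] using top_leD by metis
  have lexD: "if top_le T y x then b x = b y \<and> a x = a y else b x < b y \<or> b x = b y \<and> a x < a y"
    if "top_le T x y" for x y
    using lin_onD[OF lex that top_leD[OF that]] by (auto simp: less_prod_def' split: if_splits)
  have mono: "b x \<le> b y" if "top_le T x y" for x y
    using lexD[OF that] by (auto split: if_splits)
  have mono_S: "b x \<le> b y" if "?S x y" for x y
    using that mono le by auto
  have S_eq: "?S' x y \<and> ?S' y x" if "?S x y" "b x = b y" for x y
    using that le by auto
  have Q_mono: "b x \<le> b y" if "?S\<^sup>+\<^sup>+ x y" for x y
    using that by induction (use mono_S order_trans in blast)+
  \<comment> \<open>\<open>b\<close> never decreases along a path for \<open>?S\<close>. If it does
    not end higher than it starts, it is constant along the path, so every step is a relation of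
    \<open>T'\<close> in one direction or the other.\<close>
  have Q_eq: "?S'\<^sup>+\<^sup>+ x y \<and> ?S'\<^sup>+\<^sup>+ y x" if "?S\<^sup>+\<^sup>+ x y" "b y \<le> b x" for x y
    using that
  proof induction
    case (base y)
    then have "b x = b y"
      using mono_S by (simp add: antisym)
    then show ?case
      using S_eq[OF base(1)] tranclp.r_into_trancl[of ?S'] by blast
  next
    case (step y z)
    have "b x \<le> b y" "b y \<le> b z"
      using Q_mono[OF step(1)] mono_S[OF step(2)] by auto
    then have eq: "b y = b z" "b y \<le> b x"
      using step.prems by auto
    have S': "?S' y z" "?S' z y"
      using S_eq[OF step(2) eq(1)] by auto
    note IH = step.IH[OF eq(2)]
    show ?case
      using tranclp.trancl_into_trancl[of ?S', OF conjunct1[OF IH] S'(1)]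
        tranclp_trans[OF tranclp.r_into_trancl[of ?S', OF S'(2)] conjunct2[OF IH]] by (rule conjI)
  qed
  have S'_S: "?S\<^sup>+\<^sup>+ x y" if "?S'\<^sup>+\<^sup>+ x y" for x y
    using that
  proof induction
    case (base y)
    then show ?case
      using le by (intro tranclp.r_into_trancl) auto
  next
    case (step y z)
    then have "?S y z"
      using le by auto
    with step.IH show ?case
      by (rule tranclp.trancl_into_trancl)
  qed
  have ?adm
    unfolding admissible_def
  proof (intro conjI allI impI ballI)
    show "topspace T' = ?X"
      by (rule sp)
    show "openin T' U" if "openin T U" for U
      using that unfolding T' openin_top_of_order openin_iff_final_segment[OF fin] by blast
  next
    fix Y assume Y: "connectedin T' Y"
    \<comment> \<open>A level set of \<open>b\<close> and its complement are both open in
      \<open>T'\<close>, so a connected set stays within one level.\<close>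
    have b_const: "b x = b y" if "x \<in> Y" "y \<in> Y" for x y
    proof (rule ccontr)
      assume ne: "b x \<noteq> b y"
      have 1: "openin T' {z \<in> ?X. b z = b x}" "openin T' {z \<in> ?X. b z \<noteq> b x}"
        unfolding T' openin_top_of_order by auto
      have sub: "Y \<subseteq> ?X"
        using Y sp by (simp add: connectedin)
      have "Y \<subseteq> {z \<in> ?X. b z = b x} \<union> {z \<in> ?X. b z \<noteq> b x}"
        using sub by auto
      moreover have "{z \<in> ?X. b z = b x} \<inter> {z \<in> ?X. b z \<noteq> b x} \<inter> Y = {}"
        by auto
      moreover have "{z \<in> ?X. b z = b x} \<inter> Y \<noteq> {}" "{z \<in> ?X. b z \<noteq> b x} \<inter> Y \<noteq> {}"
        using that ne sub by auto
      ultimately show False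
        using Y 1 unfolding connectedin by blast
    qed
    show "subtopology T' Y = subtopology T Y"
      by (rule topology_eqI_top_le) (use fin sp b_const in \<open>auto simp: top_le_subtopology le\<close>)
  next
    fix x y assume xy: "x \<in> ?X" "y \<in> ?X"
    show "top_eqv (quot_top T T') x y \<longleftrightarrow> top_eqv (quot_top T' T') x y"
      unfolding top_eqv_def top_le_quot_top sp
      using xy Q_mono[of y x] Q_eq[of x y] S'_S[of x y] S'_S[of y x] by blast
  qed
  moreover have ?la
    unfolding lin_on_def
  proof (intro ballI impI)
    fix x y assume xy: "top_le T' x y"
    then show "if top_le T' y x then a x = a y else a x < a y"
      using lexD[of x y] by (auto simp: le split: if_splits)
  qed
  moreover have ?lb
    unfolding lin_on_def
  proof (intro ballI impI)
    fix x y assume xy: "x \<in> ?X" "y \<in> ?X" "top_le (quot_top T T') x y"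
    then have Q: "?S\<^sup>+\<^sup>+ x y"
      by (simp add: top_le_quot_top)
    show "if top_le (quot_top T T') y x then b x = b y else b x < b y"
    proof (cases "?S\<^sup>+\<^sup>+ y x")
      case True
      then have "b x = b y"
        using Q_mono[OF Q] Q_mono[OF True] by simp
      then show ?thesis
        using True xy by (simp add: top_le_quot_top)
    next
      case False
      \<comment> \<open>Otherwise \<open>Q_eq\<close> would give a zigzag in \<open>T'\<close> from
        \<open>y\<close> to \<open>x\<close>, hence the excluded path back.\<close>
      then have "\<not> b y \<le> b x"
        using Q_eq[OF Q] S'_S by blast
      then show ?thesis
        using False by (simp add: top_le_quot_top)
    qed
  qed
  ultimately show "?adm \<and> ?la \<and> ?lb"
    by simp
qed

section \<open>Comparison of the two internal coproducts\<close>

lemma finite_admissible: "finite {T'. admissible (top_of T) (top_of T')}"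
proof (rule finite_imageD)
  let ?o = "\<lambda>T'. {U. openin (top_of T') U}"
  have "?o ` {T'. admissible (top_of T) (top_of T')} \<subseteq> Pow (Pow {1..size_top T})"
  proof (clarify)
    fix T' U x assume "admissible (top_of T) (top_of T')" "openin (top_of T') U" "x \<in> U"
    then show "x \<in> {1..size_top T}"
      using openin_subset[of "top_of T'" U] by (auto simp: admissible_def topspace_top_of)
  qed
  then show "finite (?o ` {T'. admissible (top_of T) (top_of T')})"
    by (rule finite_subset) simp
  show "inj_on ?o {T'. admissible (top_of T) (top_of T')}"
    by (auto intro!: inj_onI simp: top_of_inject[symmetric] topology_eq set_eq_iff)
qed

lemma letter_zip:
  "length v = length w \<Longrightarrow> i \<in> {1..length v} \<Longrightarrow> letter (zip v w) i = (letter v i, letter w i)"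
  by (auto simp: letter_def)

lemma tensor_sum_bas:
  "tensor (\<Sum>a\<in>A. bas a) (\<Sum>b\<in>B. bas b) = (\<Sum>(a, b)\<in>A \<times> B. bas (a, b))"
  unfolding tensor_sum_left unfolding tensor_sum_right by (simp add: sum.cartesian_product)

text \<open>Both sides equal the sum over \<open>?G\<close>, the pairs whose lexicographic word of
  pairs extends \<open>T\<close>. On the topological side \<open>T'\<close> is determined by the
  pair through the level sets of \<open>b\<close>; on the word side \<open>u\<close> is determined
  as the packing of the word of pairs.\<close>

lemma Lambda_internal:
  "tensor_map Lambda Lambda (HT_internal x) = (WQSym_internal (Lambda x) :: _ \<Rightarrow>\<^sub>0 'k::field)"
proof (rule lin_eqI[where x = x])
  fix T
  let ?n = "size_top T"
  let ?G = "{(a, b). length (letters a) = ?n \<and> length (letters b) = ?n \<and>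
      lin_on {1..?n} (tle T) (\<lambda>i. (letter (letters b) i, letter (letters a) i))}"
  let ?A = "{T'. admissible (top_of T) (top_of T')}"
  let ?C = "\<lambda>u. {(a, b). length (letters a) = length (letters b) \<and> pack (zip (letters b) (letters a)) = letters u}"
  have size_quot: "size_top (quotient_top T T') = ?n" for T'
    by (simp add: size_top.rep_eq quotient_top.rep_eq quot_top_def topspace_top_of_order)
  \<comment> \<open>The characterization of admissible topologies, read on words. If the point sets
    differ, both sides fail, and the case split removes this case.\<close>
  have key: "admissible (top_of T) (top_of T') \<and> a \<in> lin_words T' \<and> b \<in> lin_words (quotient_top T T')
      \<longleftrightarrow> (a, b) \<in> ?G \<and> top_of T' = top_of_order {1..?n}
        (\<lambda>x y. tle T x y \<and> letter (letters b) x = letter (letters b) y)" for T' a b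
  proof (cases "topspace (top_of T') = topspace (top_of T)")
    case True
    then have "size_top T' = ?n"
      by (simp add: size_top.rep_eq)
    then show ?thesis
      using admissible_iff_lexicographic[of "top_of T" "top_of T'" "letter (letters a)" "letter (letters b)"]
      by (auto simp: mem_lin_words topspace_top_of size_quot quotient_top.rep_eq simp del: One_nat_def)
  next
    case False
    then have "\<not> admissible (top_of T) (top_of T')"
      by (simp add: admissible_def)
    moreover have "top_of T' \<noteq> top_of_order {1..?n} (\<lambda>x y. tle T x y \<and> letter (letters b) x = letter (letters b) y)"
    proof
      assume "top_of T' = top_of_order {1..?n} (\<lambda>x y. tle T x y \<and> letter (letters b) x = letter (letters b) y)"
      then have "topspace (top_of T') = {1..?n}"
        by (simp only: topspace_top_of_order)
      then show False
        using False by (simp only: topspace_top_of)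
    qed
    ultimately show ?thesis
      by simp
  qed
  have "tensor_map Lambda Lambda (HT_internal (bas T))
      = (\<Sum>T'\<in>?A. \<Sum>(a, b)\<in>lin_words T' \<times> lin_words (quotient_top T T'). bas (a, b) :: _ \<Rightarrow>\<^sub>0 'k)"
    unfolding HT_internal_def lin_ext_bas linD(5)[OF lin_tensor_map]
    by (intro sum.cong refl)
      (simp only: tensor_map_bas Lambda_bas tensor_sum_bas)
  also have "\<dots> = (\<Sum>(T', a, b)\<in>Sigma ?A (\<lambda>T'. lin_words T' \<times> lin_words (quotient_top T T')). bas (a, b))"
    by (subst sum.Sigma) (auto simp: finite_admissible finite_lin_words split_def)
  also have "\<dots> = (\<Sum>(a, b)\<in>?G. bas (a, b))"
  proof (rule sum.reindex_bij_witness[where j = "\<lambda>(T', a, b). (a, b)" and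
        i = "\<lambda>(a, b). (Abs_fin_top (top_of_order {1..?n} (\<lambda>x y. tle T x y \<and> letter (letters b) x = letter (letters b) y)), a, b)"])
    fix p assume "p \<in> Sigma ?A (\<lambda>T'. lin_words T' \<times> lin_words (quotient_top T T'))"
    then obtain T' a b where p: "p = (T', a, b)" and m: "admissible (top_of T) (top_of T')"
      "a \<in> lin_words T'" "b \<in> lin_words (quotient_top T T')"
      by auto
    have k: "(a, b) \<in> ?G" "top_of T' = top_of_order {1..?n}
        (\<lambda>x y. tle T x y \<and> letter (letters b) x = letter (letters b) y)"
      using key[of T' a b] m by blast+
    show "(case (case p of (T', a, b) \<Rightarrow> (a, b)) of (a, b) \<Rightarrow> (Abs_fin_top (top_of_order {1..?n}
        (\<lambda>x y. tle T x y \<and> letter (letters b) x = letter (letters b) y)), a, b)) = p"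
      by (simp only: p split k(2)[symmetric] top_of_inverse)
    show "(case p of (T', a, b) \<Rightarrow> (a, b)) \<in> ?G"
      using k(1) by (simp only: p split)
  next
    fix q assume q: "q \<in> ?G"
    obtain a b where ab: "q = (a, b)"
      by (cases q)
    let ?O = "top_of_order {1..?n} (\<lambda>x y. tle T x y \<and> letter (letters b) x = letter (letters b) y)"
    have "top_of (Abs_fin_top ?O) = ?O"
      by (rule Abs_fin_top_inverse) (auto simp: topspace_top_of_order)
    then have "admissible (top_of T) (top_of (Abs_fin_top ?O)) \<and> a \<in> lin_words (Abs_fin_top ?O) \<and>
        b \<in> lin_words (quotient_top T (Abs_fin_top ?O))"
      using key[of "Abs_fin_top ?O" a b] q ab by blast
    then show "(case q of (a, b) \<Rightarrow> (Abs_fin_top (top_of_order {1..?n}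
        (\<lambda>x y. tle T x y \<and> letter (letters b) x = letter (letters b) y)), a, b))
        \<in> Sigma ?A (\<lambda>T'. lin_words T' \<times> lin_words (quotient_top T T'))"
      unfolding ab by (simp del: One_nat_def)
  qed (auto split: prod.splits)
  finally have L: "tensor_map Lambda Lambda (HT_internal (bas T)) = (\<Sum>(a, b)\<in>?G. bas (a, b) :: _ \<Rightarrow>\<^sub>0 'k)" .
  \<comment> \<open>Packing the word of pairs keeps all lexicographic comparisons, so membership in
    \<open>lin_words T\<close> can be tested on the pairs.\<close>
  have key2: "(u \<in> lin_words T \<and> (a, b) \<in> ?C u) \<longleftrightarrow>
      ((a, b) \<in> ?G \<and> u = Abs_packed_word (pack (zip (letters b) (letters a))))" for u a b
  proof -
    have "u = Abs_packed_word (pack (zip (letters b) (letters a))) \<longleftrightarrow> pack (zip (letters b) (letters a)) = letters u"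
      by (metis letters_Abs letters_inverse packed_pack)
    moreover have "Abs_packed_word (pack (zip (letters b) (letters a))) \<in> lin_words T \<and>
        length (letters a) = length (letters b) \<longleftrightarrow> (a, b) \<in> ?G"
    proof (cases "length (letters a) = ?n \<and> length (letters b) = ?n")
      case True
      then have "lin_on {1..?n} (tle T) (letter (zip (letters b) (letters a)))
          \<longleftrightarrow> lin_on {1..?n} (tle T) (\<lambda>i. (letter (letters b) i, letter (letters a) i))"
        by (intro lin_on_cong letter_zip) auto
      then show ?thesis
        using True by (simp add: pack_mem_lin_words)
    next
      case False
      then show ?thesis
        by (auto simp: pack_mem_lin_words)
    qed
    ultimately show ?thesis
      by auto
  qed
  have lin_int: "lin WQSym_internal"
    unfolding WQSym_internal_def by (rule lin_lin_ext)
  have fin_C: "finite (?C u)" for u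
  proof (rule finite_subset)
    show "?C u \<subseteq> {w. length (letters w) = length (letters u)} \<times> {w. length (letters w) = length (letters u)}"
      by (auto dest!: arg_cong[where f = length])
  qed (simp add: finite_packed_words_of_length)
  have "WQSym_internal (Lambda (bas T)) = (\<Sum>u\<in>lin_words T. \<Sum>(a, b)\<in>?C u. bas (a, b) :: _ \<Rightarrow>\<^sub>0 'k)"
    by (simp add: Lambda_bas linD(5)[OF lin_int] WQSym_internal_bas)
  also have "\<dots> = (\<Sum>(u, a, b)\<in>Sigma (lin_words T) ?C. bas (a, b))"
    by (rule sum.Sigma) (use finite_lin_words fin_C in blast)+
  also have "\<dots> = (\<Sum>(a, b)\<in>?G. bas (a, b))"
  proof (rule sum.reindex_bij_witness[where j = "\<lambda>(u, a, b). (a, b)" and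
        i = "\<lambda>(a, b). (Abs_packed_word (pack (zip (letters b) (letters a))), a, b)"])
    fix p assume "p \<in> Sigma (lin_words T) ?C"
    then obtain u a b where p: "p = (u, a, b)" and m: "u \<in> lin_words T" "(a, b) \<in> ?C u"
      by blast
    then have k: "(a, b) \<in> ?G" "u = Abs_packed_word (pack (zip (letters b) (letters a)))"
      using key2[of u a b] by blast+
    show "(case (case p of (u, a, b) \<Rightarrow> (a, b)) of (a, b) \<Rightarrow>
        (Abs_packed_word (pack (zip (letters b) (letters a))), a, b)) = p"
      by (simp only: p split k(2)[symmetric])
    show "(case p of (u, a, b) \<Rightarrow> (a, b)) \<in> ?G"
      using k(1) by (simp only: p split)
  next
    fix q assume q: "q \<in> ?G"
    obtain a b where ab: "q = (a, b)"
      by (cases q)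
    then have "Abs_packed_word (pack (zip (letters b) (letters a))) \<in> lin_words T \<and>
        (a, b) \<in> ?C (Abs_packed_word (pack (zip (letters b) (letters a))))"
      using key2[of "Abs_packed_word (pack (zip (letters b) (letters a)))" a b] q by blast
    then show "(case q of (a, b) \<Rightarrow> (Abs_packed_word (pack (zip (letters b) (letters a))), a, b))
        \<in> Sigma (lin_words T) ?C"
      unfolding ab by simp
  qed (auto split: prod.splits)
  finally show "tensor_map Lambda Lambda (HT_internal (bas T)) = (WQSym_internal (Lambda (bas T)) :: _ \<Rightarrow>\<^sub>0 'k)"
    using L by simp
qed (auto intro!: lin_comp[OF lin_tensor_map] lin_comp[OF _ lin_Lambda]
    simp: HT_internal_def WQSym_internal_def lin_lin_ext)

section \<open>Realization by noncommutative series\<close>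

text \<open>At a word \<open>v\<close> exactly one basis element can contribute, the packing of
  \<open>v\<close>.\<close>

lemma realization_lookup: "realization x v = Poly_Mapping.lookup x (Abs_packed_word (pack v))"
proof -
  have "pack v = letters w \<longleftrightarrow> w = Abs_packed_word (pack v)" for w
    by (metis letters_Abs letters_inverse packed_pack)
  then have "realization x v = (\<Sum>w\<in>Poly_Mapping.keys x.
      if w = Abs_packed_word (pack v) then Poly_Mapping.lookup x w else 0)"
    unfolding realization_def by (intro sum.cong) auto
  then show ?thesis
    by (simp add: in_keys_iff)
qed

text \<open>An infinite alphabet has enough letters to spell, for each packed word \<open>w\<close>,
  a word that packs to \<open>w\<close>; the coefficient there is the coordinate at
  \<open>w\<close>.\<close>

lemma inj_realization:
  assumes "infinite (UNIV :: 'z::linorder set)"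
  shows "inj (realization :: (packed_word \<Rightarrow>\<^sub>0 'k::field) \<Rightarrow> 'z list \<Rightarrow> 'k)"
proof (rule injI)
  fix x y :: "packed_word \<Rightarrow>\<^sub>0 'k"
  assume eq: "(realization x :: 'z list \<Rightarrow> 'k) = realization y"
  show "x = y"
  proof (rule poly_mapping_eqI)
    fix w
    obtain A :: "'z set" where A: "finite A" "card A = wmax (letters w)"
      using infinite_arbitrarily_large[OF assms] by blast
    let ?v = "map (letter (sorted_list_of_set A)) (letters w)"
    have "pack ?v = letters w"
      using A set_packed[OF packed_letters[of w]] by (intro pack_map_letter) simp_all
    then have "Abs_packed_word (pack ?v) = w"
      by (simp add: letters_inverse)
    then show "Poly_Mapping.lookup x w = Poly_Mapping.lookup y w"
      using fun_cong[OF eq, of ?v] by (simp add: realization_lookup)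
  qed
qed

text \<open>A word \<open>v\<close> comes from at most one map, the one sending \<open>i\<close> to
  its \<open>i\<close>-th letter. The cardinality is thus 0 or 1, and the coefficients agree in
  every characteristic.\<close>

lemma realization_Lambda:
  "(realization (Lambda (bas T)) :: 'z::linorder list \<Rightarrow> 'k::field) = Lambda_series T"
proof
  fix v :: "'z list"
  let ?n = "size_top T"
  let ?F = "{f \<in> lin_maps (top_of T). map f [1..<?n + 1] = v}"
  let ?f = "restrict (letter v) {1..?n}"
  have lm: "f \<in> lin_maps (top_of T) \<longleftrightarrow> f \<in> extensional {1..?n} \<and> lin_on {1..?n} (tle T) f" for f :: "nat \<Rightarrow> 'z"
    using lin_on_top[of "top_of T" f] unfolding lin_maps_def by (simp add: topspace_top_of PiE_def)
  have word: "f \<in> extensional {1..?n} \<and> map f [1..<?n + 1] = v \<longleftrightarrow> length v = ?n \<and> f = ?f" for f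
  proof
    assume f: "f \<in> extensional {1..?n} \<and> map f [1..<?n + 1] = v"
    then have len: "length v = ?n"
      by auto
    have "f i = letter v i" if "i \<in> {1..?n}" for i
    proof -
      have "letter (map f [1..<?n + 1]) i = f i"
        using that by (auto simp: letter_def simp del: upt_Suc)
      then show ?thesis
        using f by simp
    qed
    then show "length v = ?n \<and> f = ?f"
      using f len by (auto simp: fun_eq_iff extensional_def)
  next
    assume f: "length v = ?n \<and> f = ?f"
    have "map f [1..<?n + 1] = v"
      by (rule nth_equalityI) (use f in \<open>auto simp: letter_def simp del: upt_Suc\<close>)
    then show "f \<in> extensional {1..?n} \<and> map f [1..<?n + 1] = v"
      using f by simp
  qed
  have lin_f: "lin_on {1..?n} (tle T) ?f \<longleftrightarrow> lin_on {1..?n} (tle T) (letter v)"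
    by (rule lin_on_cong) simp
  have "f \<in> ?F \<longleftrightarrow> f = ?f \<and> length v = ?n \<and> lin_on {1..?n} (tle T) (letter v)" for f
  proof (cases "f = ?f")
    case True
    show ?thesis
      using word[of ?f] lin_f unfolding lm mem_Collect_eq True by blast
  next
    case False
    then show ?thesis
      using word[of f] unfolding lm mem_Collect_eq by blast
  qed
  then have "?F = (if Abs_packed_word (pack v) \<in> lin_words T then {?f} else {})"
    unfolding pack_mem_lin_words by (simp only: set_eq_iff) simp
  then have "Lambda_series T v = (if Abs_packed_word (pack v) \<in> lin_words T then 1 else 0 :: 'k)"
    by (simp add: Lambda_series_def)
  then show "realization (Lambda (bas T)) v = (Lambda_series T v :: 'k)"
    by (simp add: realization_lookup Lambda_bas lookup_sum lookup_bas finite_lin_words)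
qed


theorem theorem5p7:
  assumes "infinite (UNIV :: 'z::linorder set)"
  shows "inj (realization :: (packed_word \<Rightarrow>\<^sub>0 'k::field) \<Rightarrow> 'z list \<Rightarrow> 'k) \<and>
    (\<forall>T. (realization (Lambda (bas T)) :: 'z list \<Rightarrow> 'k) = Lambda_series T) \<and>
    is_hopf_morphism HT WQSym (Lambda :: (fin_top \<Rightarrow>\<^sub>0 'k) \<Rightarrow> packed_word \<Rightarrow>\<^sub>0 'k) \<and>
    tensor_map (Lambda :: (fin_top \<Rightarrow>\<^sub>0 'k) \<Rightarrow> packed_word \<Rightarrow>\<^sub>0 'k) Lambda \<circ> HT_internal
      = WQSym_internal \<circ> Lambda"
  by (intro conjI allI inj_realization[OF assms] realization_Lambda Lambda_hopf_morphism)
    (simp add: fun_eq_iff Lambda_internal)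

end
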